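(* Let $\gamma:\Gamma\to\Delta$ and $\lambda:\Lambda\to\Delta$ be forwards immersions of finite graphs with (possibly empty) sets of marked vertices, where $\Gamma$ and $\Lambda$ are connected and relatively core. Let $\Theta=\mathrm{Core}^{\mathrm{rel}}(\Gamma\times_\Delta\Lambda)$, let $s:\mathbb{S}=\mathrm{Core}(\mathbb{S}_\Gamma\times_\Delta\mathbb{S}_\Lambda)\to\Theta$ be the natural map from the core of the fibre product of the long cycles of $\Gamma$ and $\Lambda$, and let $\Theta^s\subset\Theta$ be the subgraph with edge set $E(\Theta^s)=E(\Theta)-E(s(\mathbb{S}))$. Put $C_\Gamma=|\bar E(\Gamma)|+|V^i(\Gamma)|$ and $C_\Lambda=|\bar E(\Lambda)|+|V^i(\Lambda)|$. Then $$|E(\Theta^s)|\ \le\ 508\cdot C_\Gamma\cdot C_\Lambda\cdot\Big(|\bar E(\Lambda)|\cdot|E(\Gamma)|+|\bar E(\Gamma)|\cdot|E(\Lambda)|\Big).$$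
   Context: A graph is a directed graph $\Gamma=(V,E,o,t)$ with origin and target maps $o,t:E\to V$ (loops and multiple edges allowed), equipped with sets $V^i(\Gamma),V^f(\Gamma)\subset V(\Gamma)$ of initial and final vertices; marked vertices are those in $V^i\cup V^f$. Graph maps commute with $o,t$ and preserve initial and final vertices. A graph map is a forwards immersion if, at every vertex $v$, it is injective on the set of edges with origin $v$. $\beta_1$ is the first Betti number. A path is a graph map $f:I\to\Gamma$ from a directed segment; $o(f),t(f)$ are its first and last vertices. A path is accepting if $o(f)\in V^i(\Gamma)$ and $t(f)\in V^f(\Gamma)$, and admissible if it is accepting or $o(f)=t(f)$. A circle is a directed circular graph with $k\ge1$ edges consistently oriented; a cycle is a graph map $S^1\to\Gamma$ from a circle; its degree is the largest degree of a covering $S^1\to S^1$ through which it factors; it is primitive if its degree is $1$. $\mathrm{Core}(\Gamma)$ is the union of images of all cycles; $\mathrm{Core}^{\mathrm{rel}}(\Gamma)$ is the union of images of all admissible paths; $\Gamma$ is relatively core if it equals $\mathrm{Core}^{\mathrm{rel}}(\Gamma)$. A graph is connected if it is connected as an undirected graph. $\bar V(\Gamma)$ is the set of vertices whose indegree is $\ne1$ or whose outdegree is $\ne1$. $\bar E(\Gamma)$ is the collection (up to reparametrisation) of paths $e:I\to\Gamma$, injective on edges, whose image meets $\bar V(\Gamma)$ exactly in $\{o(e),t(e)\}$, together with cycles $f:S^1\to\Gamma$, injective on edges, whose image is disjoint from $\bar V(\Gamma)$ (so the elements of $\bar E(\Gamma)$ partition $E(\Gamma)$ into maximal unbranched segments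 and circle components). The fibre product $\Gamma\times_\Delta\Lambda$ has vertices the pairs $(u,v)$ with $\gamma(u)=\lambda(v)$, edges the pairs $(e,f)$ with $\gamma(e)=\lambda(f)$, coordinatewise $o,t$; its initial (final) vertices are the pairs of initial (final) vertices. Long cycles: $s_\Gamma:\mathbb{S}_\Gamma\to\Gamma$ is the disjoint union, one for each isomorphism class over $\Gamma$, of all primitive cycles $g:S^1\to\Gamma$ with $\deg(\gamma\circ g)\ge12\cdot\beta_1(\Gamma)$; there are at most $\beta_1(\Gamma)$ of them. $s_\Lambda:\mathbb{S}_\Lambda\to\Lambda$ is defined likewise. $\mathbb{S}_\Gamma\times_\Delta\mathbb{S}_\Lambda$ is the fibre product of $\gamma\circ s_\Gamma$ and $\lambda\circ s_\Lambda$, and $s$ is induced by $(s_\Gamma,s_\Lambda)$. *)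

theory Defs
  imports "Graph_Theory.Graph_Theory" "HOL-Library.Function_Algebras"
begin

record ('v, 'e) marked_graph =
  dg :: "('v, 'e) pre_digraph"
  initials :: "'v set"
  finals :: "'v set"

definition finite_marked_graph :: "('v, 'e) marked_graph \<Rightarrow> bool" where
  "finite_marked_graph \<Gamma> \<longleftrightarrow>
     fin_digraph (dg \<Gamma>) \<and> initials \<Gamma> \<subseteq> verts (dg \<Gamma>) \<and> finals \<Gamma> \<subseteq> verts (dg \<Gamma>)"


section \<open>Graph maps\<close>

record ('u, 'd, 'v, 'e) gmap =
  on_verts :: "'u \<Rightarrow> 'v"
  on_arcs :: "'d \<Rightarrow> 'e"

definition gcomp ::
  "('v, 'e, 'w, 'f) gmap \<Rightarrow> ('u, 'd, 'v, 'e) gmap \<Rightarrow> ('u, 'd, 'w, 'f) gmap" (infixl "\<circ>\<^sub>g" 55) where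
  "g \<circ>\<^sub>g f = \<lparr>on_verts = on_verts g \<circ> on_verts f, on_arcs = on_arcs g \<circ> on_arcs f\<rparr>"

text \<open>The values of a \<open>gmap\<close> outside its source graph are arbitrary, so maps out of \<open>A\<close> are
  compared on \<open>A\<close> only.\<close>

definition gmap_eq :: "('u, 'd) pre_digraph \<Rightarrow> ('u, 'd, 'v, 'e) gmap \<Rightarrow> ('u, 'd, 'v, 'e) gmap \<Rightarrow> bool" where
  "gmap_eq A f g \<longleftrightarrow> (\<forall>v\<in>verts A. on_verts f v = on_verts g v) \<and> (\<forall>e\<in>arcs A. on_arcs f e = on_arcs g e)"

text \<open>\<open>graph_map\<close> ignores markings; it is used for maps out of unmarked graphs (segments,
  circles, unions of circles), for which preservation of markings is vacuous.\<close>

definition graph_map :: "('u, 'd) pre_digraph \<Rightarrow> ('v, 'e) pre_digraph \<Rightarrow> ('u, 'd, 'v, 'e) gmap \<Rightarrow> bool" where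
  "graph_map G H f \<longleftrightarrow>
     on_verts f ` verts G \<subseteq> verts H \<and> on_arcs f ` arcs G \<subseteq> arcs H \<and>
     (\<forall>e\<in>arcs G. tail H (on_arcs f e) = on_verts f (tail G e) \<and>
                  head H (on_arcs f e) = on_verts f (head G e))"

definition marked_graph_map ::
  "('u, 'd) marked_graph \<Rightarrow> ('v, 'e) marked_graph \<Rightarrow> ('u, 'd, 'v, 'e) gmap \<Rightarrow> bool" where
  "marked_graph_map \<Gamma> \<Delta> f \<longleftrightarrow>
     graph_map (dg \<Gamma>) (dg \<Delta>) f \<and>
     on_verts f ` initials \<Gamma> \<subseteq> initials \<Delta> \<and> on_verts f ` finals \<Gamma> \<subseteq> finals \<Delta>"

definition forwards_immersion ::
  "('u, 'd) marked_graph \<Rightarrow> ('v, 'e) marked_graph \<Rightarrow> ('u, 'd, 'v, 'e) gmap \<Rightarrow> bool" where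
  "forwards_immersion \<Gamma> \<Delta> f \<longleftrightarrow>
     marked_graph_map \<Gamma> \<Delta> f \<and> (\<forall>v\<in>verts (dg \<Gamma>). inj_on (on_arcs f) (out_arcs (dg \<Gamma>) v))"

definition graph_iso :: "('u, 'd) pre_digraph \<Rightarrow> ('v, 'e) pre_digraph \<Rightarrow> ('u, 'd, 'v, 'e) gmap \<Rightarrow> bool" where
  "graph_iso G H f \<longleftrightarrow>
     graph_map G H f \<and> bij_betw (on_verts f) (verts G) (verts H) \<and> bij_betw (on_arcs f) (arcs G) (arcs H)"

definition covering_of_degree ::
  "nat \<Rightarrow> ('u, 'd) pre_digraph \<Rightarrow> ('v, 'e) pre_digraph \<Rightarrow> ('u, 'd, 'v, 'e) gmap \<Rightarrow> bool" where
  "covering_of_degree d G H p \<longleftrightarrow>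
     graph_map G H p \<and> on_verts p ` verts G = verts H \<and>
     (\<forall>v\<in>verts G. bij_betw (on_arcs p) (out_arcs G v) (out_arcs H (on_verts p v)) \<and>
                   bij_betw (on_arcs p) (in_arcs G v) (in_arcs H (on_verts p v))) \<and>
     (\<forall>w\<in>verts H. card {v \<in> verts G. on_verts p v = w} = d)"


section \<open>First Betti number\<close>

text \<open>A graph has no 2-cells, so its first rational homology is the kernel of the boundary map
  on rational 1-chains.\<close>

definition one_cycles :: "('v, 'e) pre_digraph \<Rightarrow> ('e \<Rightarrow> rat) set" where
  "one_cycles G =
     {c. (\<forall>e. e \<notin> arcs G \<longrightarrow> c e = 0) \<and>
         (\<forall>v\<in>verts G. (\<Sum>e\<in>in_arcs G v. c e) = (\<Sum>e\<in>out_arcs G v. c e))}"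

definition betti1 :: "('v, 'e) pre_digraph \<Rightarrow> nat" where
  "betti1 G = vector_space.dim (\<lambda>(a::rat) c e. a * c e) (one_cycles G)"


section \<open>Paths, cycles and cores\<close>

definition segment :: "nat \<Rightarrow> (nat, nat) pre_digraph" where
  "segment n = \<lparr>verts = {..n}, arcs = {..<n}, tail = id, head = Suc\<rparr>"

definition circle :: "nat \<Rightarrow> (nat, nat) pre_digraph" where
  "circle k = \<lparr>verts = {..<k}, arcs = {..<k}, tail = id, head = (\<lambda>i. Suc i mod k)\<rparr>"

text \<open>Paths of length 0 are allowed.\<close>

definition is_path :: "('v, 'e) pre_digraph \<Rightarrow> nat \<Rightarrow> (nat, nat, 'v, 'e) gmap \<Rightarrow> bool" where
  "is_path G n f \<longleftrightarrow> graph_map (segment n) G f"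

definition is_cycle :: "('v, 'e) pre_digraph \<Rightarrow> nat \<Rightarrow> (nat, nat, 'v, 'e) gmap \<Rightarrow> bool" where
  "is_cycle G k f \<longleftrightarrow> 1 \<le> k \<and> graph_map (circle k) G f"

definition accepting :: "('v, 'e) marked_graph \<Rightarrow> nat \<Rightarrow> (nat, nat, 'v, 'e) gmap \<Rightarrow> bool" where
  "accepting \<Gamma> n f \<longleftrightarrow> on_verts f 0 \<in> initials \<Gamma> \<and> on_verts f n \<in> finals \<Gamma>"

definition admissible :: "('v, 'e) marked_graph \<Rightarrow> nat \<Rightarrow> (nat, nat, 'v, 'e) gmap \<Rightarrow> bool" where
  "admissible \<Gamma> n f \<longleftrightarrow> accepting \<Gamma> n f \<or> on_verts f 0 = on_verts f n"

definition core :: "('v, 'e) pre_digraph \<Rightarrow> ('v, 'e) pre_digraph" where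
  "core G = G\<lparr>verts := \<Union>{on_verts f ` verts (circle k) | k f. is_cycle G k f},
              arcs := \<Union>{on_arcs f ` arcs (circle k) | k f. is_cycle G k f}\<rparr>"

definition rel_core :: "('v, 'e) marked_graph \<Rightarrow> ('v, 'e) marked_graph" where
  "rel_core \<Gamma> =
     (let V = \<Union>{on_verts f ` verts (segment n) | n f. is_path (dg \<Gamma>) n f \<and> admissible \<Gamma> n f};
          E = \<Union>{on_arcs f ` arcs (segment n) | n f. is_path (dg \<Gamma>) n f \<and> admissible \<Gamma> n f}
      in \<lparr>dg = (dg \<Gamma>)\<lparr>verts := V, arcs := E\<rparr>,
          initials = initials \<Gamma> \<inter> V, finals = finals \<Gamma> \<inter> V\<rparr>)"

definition relatively_core :: "('v, 'e) marked_graph \<Rightarrow> bool" where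
  "relatively_core \<Gamma> \<longleftrightarrow> \<Gamma> = rel_core \<Gamma>"

definition cycle_degree :: "('v, 'e) pre_digraph \<Rightarrow> nat \<Rightarrow> (nat, nat, 'v, 'e) gmap \<Rightarrow> nat" where
  "cycle_degree G k f =
     Max {d. \<exists>m p g. covering_of_degree d (circle k) (circle m) p \<and> is_cycle G m g \<and>
                     gmap_eq (circle k) f (g \<circ>\<^sub>g p)}"

definition primitive_cycle :: "('v, 'e) pre_digraph \<Rightarrow> nat \<Rightarrow> (nat, nat, 'v, 'e) gmap \<Rightarrow> bool" where
  "primitive_cycle G k f \<longleftrightarrow> is_cycle G k f \<and> cycle_degree G k f = 1"


section \<open>Isomorphism classes of paths and cycles\<close>

text \<open>A path or cycle in a graph, bundled with its source (some \<open>segment n\<close> or \<open>circle k\<close>).\<close>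

type_synonym ('v, 'e) curve = "(nat, nat) pre_digraph \<times> (nat, nat, 'v, 'e) gmap"

definition iso_over :: "('v, 'e) curve \<Rightarrow> ('v, 'e) curve \<Rightarrow> bool" where
  "iso_over x y \<longleftrightarrow>
     (\<exists>\<phi>. graph_iso (fst x) (fst y) \<phi> \<and> gmap_eq (fst x) (snd x) (snd y \<circ>\<^sub>g \<phi>))"

definition iso_classes :: "('v, 'e) curve set \<Rightarrow> ('v, 'e) curve set set" where
  "iso_classes X = X // {(x, y). x \<in> X \<and> y \<in> X \<and> iso_over x y}"

definition branch_verts :: "('v, 'e) pre_digraph \<Rightarrow> 'v set" where
  "branch_verts G = {v \<in> verts G. in_degree G v \<noteq> 1 \<or> out_degree G v \<noteq> 1}"

text \<open>The elements of \<open>bar_edges G\<close> are to partition the edges of \<open>G\<close>. Hence the paths have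
  positive length, and no interior point of the segment may be mapped to a branch vertex, not
  even to the image of an endpoint: otherwise the concatenation of two loops at the same
  vertex would count.\<close>

definition bar_edge_paths :: "('v, 'e) pre_digraph \<Rightarrow> ('v, 'e) curve set" where
  "bar_edge_paths G =
     {(segment n, f) | n f. 1 \<le> n \<and> is_path G n f \<and> inj_on (on_arcs f) (arcs (segment n)) \<and>
        {i \<in> verts (segment n). on_verts f i \<in> branch_verts G} = {0, n}}"

definition bar_edge_cycles :: "('v, 'e) pre_digraph \<Rightarrow> ('v, 'e) curve set" where
  "bar_edge_cycles G =
     {(circle k, f) | k f. is_cycle G k f \<and> inj_on (on_arcs f) (arcs (circle k)) \<and>
        on_verts f ` verts (circle k) \<inter> branch_verts G = {}}"

definition bar_edges :: "('v, 'e) pre_digraph \<Rightarrow> ('v, 'e) curve set set" where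
  "bar_edges G = iso_classes (bar_edge_paths G \<union> bar_edge_cycles G)"


section \<open>Fibre products\<close>

definition fibre_product ::
  "('u, 'd) pre_digraph \<Rightarrow> ('u, 'd, 'w, 'f) gmap \<Rightarrow> ('v, 'e) pre_digraph \<Rightarrow> ('v, 'e, 'w, 'f) gmap
     \<Rightarrow> ('u \<times> 'v, 'd \<times> 'e) pre_digraph" where
  "fibre_product G g H h =
     \<lparr>verts = {(u, v). u \<in> verts G \<and> v \<in> verts H \<and> on_verts g u = on_verts h v},
      arcs = {(d, e). d \<in> arcs G \<and> e \<in> arcs H \<and> on_arcs g d = on_arcs h e},
      tail = map_prod (tail G) (tail H), head = map_prod (head G) (head H)\<rparr>"

definition marked_fibre_product ::
  "('u, 'd) marked_graph \<Rightarrow> ('u, 'd, 'w, 'f) gmap \<Rightarrow> ('v, 'e) marked_graph \<Rightarrow> ('v, 'e, 'w, 'f) gmap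
     \<Rightarrow> ('u \<times> 'v, 'd \<times> 'e) marked_graph" where
  "marked_fibre_product \<Gamma> \<gamma> \<Lambda> lam =
     (let P = fibre_product (dg \<Gamma>) \<gamma> (dg \<Lambda>) lam
      in \<lparr>dg = P, initials = (initials \<Gamma> \<times> initials \<Lambda>) \<inter> verts P,
          finals = (finals \<Gamma> \<times> finals \<Lambda>) \<inter> verts P\<rparr>)"

definition gmap_prod ::
  "('u, 'd, 'v, 'e) gmap \<Rightarrow> ('u', 'd', 'v', 'e') gmap \<Rightarrow> ('u \<times> 'u', 'd \<times> 'd', 'v \<times> 'v', 'e \<times> 'e') gmap" where
  "gmap_prod f g = \<lparr>on_verts = map_prod (on_verts f) (on_verts g),
                    on_arcs = map_prod (on_arcs f) (on_arcs g)\<rparr>"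


section \<open>Long cycles\<close>

definition long_cycles ::
  "('v, 'e) pre_digraph \<Rightarrow> ('w, 'f) pre_digraph \<Rightarrow> ('v, 'e, 'w, 'f) gmap \<Rightarrow> ('v, 'e) curve set" where
  "long_cycles G D \<gamma> =
     {(circle k, g) | k g. primitive_cycle G k g \<and> 12 * betti1 G \<le> cycle_degree D k (\<gamma> \<circ>\<^sub>g g)}"

definition repr :: "('v, 'e) curve set \<Rightarrow> ('v, 'e) curve" where
  "repr c = (SOME x. x \<in> c)"

definition long_cycle_graph ::
  "('v, 'e) pre_digraph \<Rightarrow> ('w, 'f) pre_digraph \<Rightarrow> ('v, 'e, 'w, 'f) gmap
     \<Rightarrow> (('v, 'e) curve set \<times> nat, ('v, 'e) curve set \<times> nat) pre_digraph" where
  "long_cycle_graph G D \<gamma> =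
     \<lparr>verts = (SIGMA c:iso_classes (long_cycles G D \<gamma>). verts (fst (repr c))),
      arcs = (SIGMA c:iso_classes (long_cycles G D \<gamma>). arcs (fst (repr c))),
      tail = (\<lambda>(c, i). (c, tail (fst (repr c)) i)),
      head = (\<lambda>(c, i). (c, head (fst (repr c)) i))\<rparr>"

definition long_cycle_map ::
  "(('v, 'e) curve set \<times> nat, ('v, 'e) curve set \<times> nat, 'v, 'e) gmap" where
  "long_cycle_map =
     \<lparr>on_verts = (\<lambda>(c, i). on_verts (snd (repr c)) i),
      on_arcs = (\<lambda>(c, i). on_arcs (snd (repr c)) i)\<rparr>"

end

theory Submission
  imports Defs
begin

text \<open>Cut \<open>\<Gamma>\<close> and \<open>\<Lambda>\<close> into the elements of \<open>bar_edges\<close>. The edges of \<open>\<Theta>\<close> lying over a pair \<open>(c, d)\<close> of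
  segments form diagonals of the rectangle \<open>c \<times> d\<close>. Outdegrees in the fibre product exceed \<open>1\<close> only
  over pairs of branching vertices, so an Euler characteristic count shows that \<open>\<Theta>\<close> has at most
  \<open>C = |bar_edges \<Gamma>| |bar_edges \<Lambda>| + |initials \<Gamma>| |initials \<Lambda>|\<close> sources, dead ends and confluences. Up
  to \<open>2C\<close> exceptions the diagonals therefore run from boundary to boundary. If an edge \<open>e\<close> of the
  longer segment \<open>c\<close> lies in the middle part of many such diagonals, then two of them are close
  to each other, the labels read along the diagonals through \<open>e\<close> are periodic with a small period \<open>p\<close>,
  and so many paths starting over \<open>e\<close> cannot stay apart: one of them returns to a pair over \<open>e\<close>.
  Hence \<open>c\<close> and \<open>d\<close> lie on closed walks reading powers of the same word of length \<open>p\<close>, and these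
  walks are long cycles, since \<open>p\<close> is small compared to the lengths of \<open>c\<close> and \<open>d\<close> and
  \<open>betti1 \<le> |bar_edges|\<close>.\<close>

section \<open>Periodic sequences\<close>

text \<open>The constants arise as follows. More than \<open>17 * C\<close> positions over one edge
  leave \<open>12 * C\<close> gaps and \<open>5 * C + 1\<close> further positions. One of these gaps
  has a size \<open>g\<close> with \<open>12 * C * g\<close> less than the length of either segment,
  which accounts for the \<open>12 * betti1\<close> of the long cycles. The further positions are
  starting edges, one more than can be lost: \<open>C\<close> through confluences and dead ends of
  \<Theta>, and \<open>4 * C\<close> through vertices where a path may leave the periodic word.
  Treating the two sides of the diagonal \<open>i = j\<close> separately doubles the bound, and the
  reduction to middle positions multiplies it by 4, which makes 136 and stays below 508. The
  obstacle is that a forwards immersion determines walks by their labels in the forward direction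
  only. Backwards, arcs are unique only inside a segment. That a returning path comes back in phase
  with the word is therefore seen from the last arcs before its return, which requires diagonals
  with at least \<open>g\<close> cells behind the edge. This is why positions near the start of a
  diagonal are excluded as well as those near its end.\<close>

definition min_period :: "nat \<Rightarrow> (nat \<Rightarrow> 'a) \<Rightarrow> bool" where
  "min_period p U \<longleftrightarrow>
     0 < p \<and> (\<forall>t. U (t + p) = U t) \<and> (\<forall>k>0. (\<forall>t. U (t + k) = U t) \<longrightarrow> p \<le> k)"

lemma periodic_mult:
  assumes "\<And>t. U (t + p) = U t"
  shows "U (t + k * p) = U (t::nat)"
proof (induction k)
  case (Suc k)
  have "U (t + Suc k * p) = U ((t + k * p) + p)" by (simp add: ac_simps)
  then show ?case using assms Suc by simp
qed simp

lemma periodic_mod: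
  assumes "\<And>t. U (t + p) = U t"
  shows "U (t mod p) = U (t::nat)"
  using periodic_mult[of U p "t mod p" "t div p", OF assms] by simp

lemma periodic_dvd:
  assumes "\<And>t. U (t + p) = U t" "p dvd d"
  shows "U (t + d) = U (t::nat)"
  using periodic_mult[of U p t "d div p", OF assms(1)] assms(2) by simp

lemma periodic_mod_multiple:
  assumes "\<forall>t. U (t + n) = U t" "n dvd K"
  shows "U (t mod K) = U (t::nat)"
proof (rule periodic_mod)
  show "U (t + K) = U t" for t by (rule periodic_dvd[where p = n]) (use assms in blast)+
qed

lemma min_periodE:
  assumes "0 < g" "\<And>t. U (t + g) = U t"
  obtains p where "min_period p U" "p \<le> g"
proof -
  let ?P = "\<lambda>k. 0 < k \<and> (\<forall>t. U (t + k) = U t)"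
  have "?P g" using assms by simp
  then have "?P (LEAST k. ?P k)" "(LEAST k. ?P k) \<le> g"
    by (rule LeastI, rule Least_le)
  moreover have "(LEAST k. ?P k) \<le> k" if "?P k" for k
    using that by (rule Least_le)
  ultimately show thesis using that unfolding min_period_def by blast
qed

text \<open>A single matching window of length \<open>p\<close> suffices: by periodicity the match
  extends everywhere, so \<open>d mod p\<close> would be a period below the minimal one unless it is
  0.\<close>

lemma min_period_dvd:
  assumes p: "min_period p U" and d: "\<And>t. t < p \<Longrightarrow> U (d + t) = U t"
  shows "p dvd d"
proof -
  have p0: "0 < p" and per: "U (t + p) = U t" for t
    using p by (auto simp: min_period_def)
  have "U (t + d mod p) = U t" for t
  proof -
    have "U (t + d mod p) = U ((t + d mod p) mod p)" by (rule periodic_mod[symmetric]) (rule per)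
    also have "\<dots> = U ((d + t mod p) mod p)" by (simp add: mod_simps ac_simps)
    also have "\<dots> = U (d + t mod p)" by (rule periodic_mod) (rule per)
    also have "\<dots> = U (t mod p)" using d p0 by simp
    also have "\<dots> = U t" by (rule periodic_mod) (rule per)
    finally show ?thesis .
  qed
  then have "\<not> 0 < d mod p" using p p0 unfolding min_period_def
    by (metis mod_less_divisor not_le)
  then show ?thesis by (simp add: dvd_eq_mod_eq_0)
qed

section \<open>Small gaps and confluences\<close>

text \<open>Pigeonhole: one of the first \<open>q\<close> gaps of the sorted set is at most the
  average. Restricting to the first \<open>q\<close> gaps keeps at least \<open>r\<close> elements
  from \<open>x\<close> on.\<close>

lemma small_gap:
  fixes B :: "nat set"
  assumes fin: "finite B" and r: "q + r \<le> card B" and r0: "0 < r"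
  obtains x y where "x \<in> B" "y \<in> B" "x < y \<or> q = 0" "q * (y - x) \<le> Max B - Min B"
    "r \<le> card {j \<in> B. x \<le> j}"
proof (cases "q = 0")
  case True
  have "B \<noteq> {}" using r r0 by auto
  then have M: "Min B \<in> B" using fin by simp
  have "{j \<in> B. Min B \<le> j} = B" using fin by auto
  then show thesis using that[of "Min B" "Min B"] True M r by simp
next
  case False
  define xs where "xs = sorted_list_of_set B"
  have len: "length xs = card B" and set: "set xs = B" and srt: "sorted xs" "distinct xs"
    using fin by (auto simp: xs_def)
  have mono: "xs ! i < xs ! j" if "i < j" "j < card B" for i j
    using that srt len by (metis strict_sorted_iff sorted_wrt_nth_less)
  have inB: "xs ! i \<in> B" if "i < card B" for i using that len set nth_mem[of i xs] by simp
  have "\<exists>k<q. q * (xs ! Suc k - xs ! k) \<le> Max B - Min B"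
  proof (rule ccontr)
    assume "\<not> ?thesis"
    then have gap: "Max B - Min B < q * (xs ! Suc k - xs ! k)" if "k < q" for k
      using that by auto
    \<comment> \<open>The summand 1 records that the gaps exceed the average strictly; it produces
      the contradiction at \<open>k = q\<close>.\<close>
    have "q * xs ! k \<ge> q * xs ! 0 + k * (Max B - Min B) + (if k = 0 then 0 else 1)" if "k \<le> q" for k
      using that
    proof (induction k)
      case (Suc k)
      have "xs ! k < xs ! Suc k" using Suc.prems r r0 by (intro mono) auto
      then have "q * xs ! Suc k = q * xs ! k + q * (xs ! Suc k - xs ! k)"
        by (metis add_mult_distrib2 le_add_diff_inverse less_imp_le)
      with gap[of k] Suc show ?case by (simp split: if_splits)
    qed simp
    from this[of q] have "q * xs ! q > q * (xs ! 0 + (Max B - Min B))"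
      using False by (simp add: algebra_simps)
    then have "xs ! q > xs ! 0 + (Max B - Min B)" by simp
    moreover have "xs ! q \<le> Max B" "Min B \<le> xs ! 0"
      using inB[of q] inB[of 0] r r0 fin by auto
    ultimately show False by linarith
  qed
  then obtain k where k: "k < q" "q * (xs ! Suc k - xs ! k) \<le> Max B - Min B" by blast
  have kB: "Suc k < card B" using k r r0 by linarith
  have "inj_on (\<lambda>i. xs ! (k + i)) {..<r}"
    using srt(2) len kB r k by (auto simp: inj_on_def nth_eq_iff_index_eq)
  moreover have "(\<lambda>i. xs ! (k + i)) ` {..<r} \<subseteq> {j \<in> B. xs ! k \<le> j}"
  proof -
    have "xs ! k \<le> xs ! (k + i)" if "i < r" for i
      using mono[of k "k + i"] that r k by (cases "i = 0") auto
    then show ?thesis using inB r k by auto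
  qed
  ultimately have "card {..<r} \<le> card {j \<in> B. xs ! k \<le> j}"
    using fin by (intro card_inj_on_le[of _ _ "{j \<in> B. xs ! k \<le> j}"]) auto
  then show thesis
    using that[of "xs ! k" "xs ! Suc k"] k kB inB mono by auto
qed

text \<open>The edges reachable from \<open>S\<close> without passing a vertex of \<open>Z\<close> form a subgraph with few ends
  and, since indegrees exceed \<open>1\<close> only rarely, with few confluences; hence it has few roots.\<close>

lemma return_exists:
  fixes s t :: "'a \<Rightarrow> 'b"
  assumes finX: "finite X" and Z: "finite Z" "t ` X - s ` X \<subseteq> Z" and S: "S \<subseteq> X"
    and card: "card Z + card X < card S + card (t ` X)"
  defines "R \<equiv> {(r, r'). r \<in> X \<and> r' \<in> X \<and> t r = s r' \<and> t r \<notin> Z}"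
  shows "\<exists>x\<in>S. \<exists>x'\<in>S. (x, x') \<in> R\<^sup>+"
proof (rule ccontr)
  assume no: "\<not> ?thesis"
  define Y where "Y = R\<^sup>* `` S"
  have SY: "S \<subseteq> Y" by (auto simp: Y_def)
  have YX: "Y \<subseteq> X"
  proof -
    have "r' \<in> X" if "(r, r') \<in> R\<^sup>*" "r \<in> X" for r r'
      using that by (induction rule: rtrancl_induct) (auto simp: R_def)
    then show ?thesis using S by (auto simp: Y_def)
  qed
  have finY: "finite Y" using YX finX by (rule finite_subset)
  have "\<exists>a\<in>X. s a = z" if z: "z \<in> t ` Y - Z" for z
  proof -
    have "z \<in> t ` X" using z YX by blast
    then have "z \<in> s ` X" using z Z(2) by blast
    then show ?thesis by auto
  qed
  then obtain succ where succ: "\<And>z. z \<in> t ` Y - Z \<Longrightarrow> succ z \<in> X \<and> s (succ z) = z"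
    by metis
  \<comment> \<open>A successor that landed in \<open>S\<close> would complete the forbidden return.
    So every target outside \<open>Z\<close> uses up an edge of \<open>Y\<close> outside
    \<open>S\<close>.\<close>
  have "succ ` (t ` Y - Z) \<subseteq> Y - S"
  proof
    fix a assume "a \<in> succ ` (t ` Y - Z)"
    then obtain z where z: "z \<in> t ` Y - Z" "a = succ z" by (rule imageE)
    then obtain r where "r \<in> Y" "z = t r" "z \<notin> Z" by blast
    with succ[OF z(1)] z(2) have r: "r \<in> Y" "t r \<notin> Z" "a \<in> X" "s a = t r" by simp_all
    then have "(r, a) \<in> R" using subsetD[OF YX r(1)] by (simp add: R_def)
    moreover obtain x where x: "x \<in> S" "(x, r) \<in> R\<^sup>*" using r unfolding Y_def by blast
    ultimately have "(x, a) \<in> R\<^sup>+" by (blast intro: rtrancl_into_trancl1)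
    then show "a \<in> Y - S" using no x(1) unfolding Y_def by (blast intro: trancl_into_rtrancl)
  qed
  moreover have "inj_on succ (t ` Y - Z)" by (rule inj_on_inverseI[of _ s]) (use succ in simp)
  ultimately have "card (t ` Y - Z) \<le> card (Y - S)" using finY by (meson card_inj_on_le finite_Diff)
  also have "\<dots> = card Y - card S"
    using SY finY by (intro card_Diff_subset) (auto intro: finite_subset)
  finally have 1: "card (t ` Y - Z) \<le> card Y - card S" .
  have 2: "card S \<le> card Y" using finY SY by (rule card_mono)
  have 3: "card (t ` Y) - card Z \<le> card (t ` Y - Z)" using Z(1) by (rule diff_card_le_card_Diff)
  \<comment> \<open>Each edge outside \<open>Y\<close> brings at most one new target, so the count
    for \<open>Y\<close> carries over to \<open>X\<close>.\<close>
  have "card (t ` X) \<le> card (t ` Y \<union> t ` (X - Y))" using finX finY by (intro card_mono) auto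
  also have "\<dots> \<le> card (t ` Y) + card (X - Y)"
    using finX card_Un_le[of "t ` Y" "t ` (X - Y)"] card_image_le[of "X - Y" t] by auto
  finally have 4: "card (t ` X) \<le> card (t ` Y) + card (X - Y)" .
  have 5: "card (X - Y) = card X - card Y" "card Y \<le> card X"
    using card_Diff_subset[OF finY YX] card_mono[OF finX YX] by simp_all
  show False using 1 2 3 4 5 card by linarith
qed

section \<open>Labelled graphs decomposed into unbranched segments\<close>

text \<open>Uniqueness of arcs is asked at inner vertices only. Nothing is demanded at the two ends,
  so a circle component cut open at any base point fits as well. \<open>det\<close> is what the
  forwards immersion provides.\<close>

locale seg_graph =
  fixes E :: "'e set" and src tgt :: "'e \<Rightarrow> 'v" and lab :: "'e \<Rightarrow> 'l"
    and J :: "'j set" and len :: "'j \<Rightarrow> nat" and seg :: "'j \<Rightarrow> nat \<Rightarrow> 'e"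
  assumes finE: "finite E" and finJ: "finite J"
    and det: "\<And>e e'. e \<in> E \<Longrightarrow> e' \<in> E \<Longrightarrow> src e = src e' \<Longrightarrow> lab e = lab e' \<Longrightarrow> e = e'"
    and seg_in: "\<And>c i. c \<in> J \<Longrightarrow> i < len c \<Longrightarrow> seg c i \<in> E"
    and seg_inj: "\<And>c c' i i'. c \<in> J \<Longrightarrow> c' \<in> J \<Longrightarrow> i < len c \<Longrightarrow> i' < len c' \<Longrightarrow>
                    seg c i = seg c' i' \<Longrightarrow> c = c' \<and> i = i'"
    and seg_cover: "\<And>e. e \<in> E \<Longrightarrow> \<exists>c\<in>J. \<exists>i<len c. e = seg c i"
    and seg_next: "\<And>c i. c \<in> J \<Longrightarrow> Suc i < len c \<Longrightarrow> tgt (seg c i) = src (seg c (Suc i))"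
    and seg_out: "\<And>c i e. c \<in> J \<Longrightarrow> Suc i < len c \<Longrightarrow> e \<in> E \<Longrightarrow> src e = src (seg c (Suc i)) \<Longrightarrow>
                    e = seg c (Suc i)"
    and seg_inn: "\<And>c i e. c \<in> J \<Longrightarrow> Suc i < len c \<Longrightarrow> e \<in> E \<Longrightarrow> tgt e = src (seg c (Suc i)) \<Longrightarrow>
                    e = seg c i"
begin

section \<open>Walks and branching in a segmented graph\<close>

definition walk :: "(nat \<Rightarrow> 'e) \<Rightarrow> nat \<Rightarrow> bool" where
  "walk w n \<longleftrightarrow> (\<forall>i\<le>n. w i \<in> E) \<and> (\<forall>i<n. tgt (w i) = src (w (Suc i)))"

definition inf_walk :: "(nat \<Rightarrow> 'e) \<Rightarrow> bool" where
  "inf_walk w \<longleftrightarrow> (\<forall>n. walk w n)"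

lemma inf_walk_iff: "inf_walk w \<longleftrightarrow> (\<forall>i. w i \<in> E \<and> tgt (w i) = src (w (Suc i)))"
  unfolding inf_walk_def walk_def by (meson lessI order_refl)

text \<open>In contrast to \<open>branch_verts\<close>, only the forward direction matters:
  elsewhere the next arc of a walk is known before its label is read.\<close>

definition branching :: "'v set" where
  "branching = {v. \<exists>e\<in>E. \<exists>e'\<in>E. e \<noteq> e' \<and> src e = v \<and> src e' = v}"

text \<open>An arc that leaves a branching vertex cannot continue a segment, so it is the first arc
  of one.\<close>

lemma card_branching_out: "card {e \<in> E. src e \<in> branching} \<le> card J"
proof -
  have "{e \<in> E. src e \<in> branching} \<subseteq> (\<lambda>c. seg c 0) ` J"
  proof
    fix e assume "e \<in> {e \<in> E. src e \<in> branching}"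
    then obtain e1 e2 where e: "e \<in> E" "e1 \<in> E" "e2 \<in> E" "e1 \<noteq> e2" "src e1 = src e" "src e2 = src e"
      by (auto simp: branching_def)
    obtain c i where c: "c \<in> J" "i < len c" "e = seg c i" using seg_cover e by blast
    have "i = 0"
    proof (rule ccontr)
      assume "i \<noteq> 0"
      then obtain i' where "i = Suc i'" by (cases i) auto
      with e c seg_out[of c i' e1] seg_out[of c i' e2] show False by auto
    qed
    with c show "e \<in> (\<lambda>c. seg c 0) ` J" by auto
  qed
  then show ?thesis using finJ by (meson card_image_le card_mono finite_imageI order_trans)
qed

lemma branching_eq: "branching = src ` {e \<in> E. src e \<in> branching}"
  by (auto simp: branching_def)

lemma finite_branching: "finite branching"
  by (subst branching_eq) (use finE in auto)

lemma card_branching: "card branching \<le> card J"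
proof -
  have "card (src ` {e \<in> E. src e \<in> branching}) \<le> card {e \<in> E. src e \<in> branching}"
    using finE by (intro card_image_le) simp
  then show ?thesis using card_branching_out branching_eq by simp
qed

lemma walk_forward:
  assumes "walk w n" "c \<in> J" "w s = seg c i" "i + t < len c" "s + t \<le> n"
  shows "w (s + t) = seg c (i + t)"
  using assms(4,5)
proof (induction t)
  case (Suc t)
  then have "tgt (seg c (i + t)) = src (w (Suc (s + t)))" "w (Suc (s + t)) \<in> E"
    using assms(1) by (auto simp: walk_def dest: spec[of _ "s + t"])
  with seg_next[OF assms(2), of "i + t"] seg_out[OF assms(2), of "i + t" "w (Suc (s + t))"] Suc.prems
  show ?case by simp
qed (use assms in simp)

text \<open>Unique predecessors inside a segment take the place of \<open>det\<close>, which works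
  forwards only.\<close>

lemma walk_backward:
  assumes "walk w n" "c \<in> J" "w s = seg c i" "i < len c" "s \<le> n" "t \<le> i" "t \<le> s"
  shows "w (s - t) = seg c (i - t)"
  using assms(6,7)
proof (induction t)
  case (Suc t)
  define s' i' where "s' = s - Suc t" and "i' = i - Suc t"
  have *: "s - t = Suc s'" "i - t = Suc i'" using Suc.prems by (auto simp: s'_def i'_def)
  have "s' < n" using assms(5) * by linarith
  then have "w s' \<in> E" "tgt (w s') = src (w (Suc s'))" using assms(1) by (auto simp: walk_def)
  moreover have "w (Suc s') = seg c (Suc i')" using Suc * by simp
  ultimately have "w s' = seg c i'" using seg_inn[OF assms(2), of i' "w s'"] assms(4) *(2) by simp
  then show ?case by (simp add: s'_def i'_def)
qed (use assms in simp)

text \<open>Unless the walk merely runs along \<open>c\<close>, it has to leave through the last arc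
  of \<open>c\<close> and come in again through the first one. The hypothesis
  \<open>i + n \<noteq> i'\<close> excludes the direct run.\<close>

lemma return_time:
  assumes "walk w n" "c \<in> J" "w 0 = seg c i" "w n = seg c i'" "i < len c" "i' < len c"
    and "i + n \<noteq> i'"
  shows "len c + i' \<le> n + i"
proof (rule ccontr)
  assume short: "\<not> ?thesis"
  show False
  proof (cases "i + n < len c")
    case True
    then have "w n = seg c (i + n)" using walk_forward[OF assms(1,2,3), of n] by simp
    with assms True seg_inj[of c c "i + n" i'] show False by auto
  next
    case False
    define s where "s = len c - 1 - i"
    have s: "s \<le> n" "i + s = len c - 1" "i + s < len c" "n - s \<le> i'"
      using False short assms(5) by (auto simp: s_def)
    have "w s = seg c (len c - 1)"
      using walk_forward[OF assms(1,2,3), of s] s by simp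
    moreover have "w (n - (n - s)) = seg c (i' - (n - s))"
      using s assms by (intro walk_backward) auto
    ultimately have "i' - (n - s) = len c - 1"
      using seg_inj[of c c "i' - (n - s)" "len c - 1"] s assms by auto
    then show False using s assms(6,7) by linarith
  qed
qed

lemma walk_det:
  assumes "walk w n" "walk w' n" "w 0 = w' 0" "\<And>i. i \<le> n \<Longrightarrow> lab (w i) = lab (w' i)" "i \<le> n"
  shows "w i = w' i"
  using assms(5)
proof (induction i)
  case (Suc i)
  then have "src (w (Suc i)) = src (w' (Suc i))" "w (Suc i) \<in> E" "w' (Suc i) \<in> E"
    using assms(1,2) by (auto simp: walk_def) (metis Suc_le_lessD)
  with det assms(4)[OF Suc.prems] show ?case by blast
qed (use assms in simp)

lemma walk_prepend:
  assumes w: "walk w n" "w 0 = seg c (j + d)" and c: "c \<in> J" "j + d < len c"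
  shows "walk (\<lambda>t. if t < d then seg c (j + t) else w (t - d)) (n + d)"
    (is "walk ?w _")
  unfolding walk_def
proof (intro conjI allI impI)
  fix i assume "i \<le> n + d"
  then show "?w i \<in> E" using seg_in c w(1) by (auto simp: walk_def)
next
  fix i assume i: "i < n + d"
  consider "Suc i < d" | "Suc i = d" | "d \<le> i" by linarith
  then show "tgt (?w i) = src (?w (Suc i))"
  proof cases
    case 1
    then show ?thesis using seg_next[of c "j + i"] c by simp
  next
    case 2
    then show ?thesis using seg_next[of c "j + i"] c w by auto
  next
    case 3
    with i have "i - d < n" by linarith
    then show ?thesis using w(1) 3 by (auto simp: walk_def Suc_diff_le)
  qed
qed

text \<open>By determinism, the walk from \<open>e\<close> that reads \<open>U\<close> stops in at most one vertex.\<close>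

definition dead_ends :: "'e \<Rightarrow> (nat \<Rightarrow> 'l) \<Rightarrow> 'v set" where
  "dead_ends e U = {tgt (w n) | w n. walk w n \<and> w 0 = e \<and> (\<forall>i\<le>n. lab (w i) = U i) \<and>
                      (\<forall>e'\<in>E. src e' = tgt (w n) \<longrightarrow> lab e' \<noteq> U (Suc n))}"

lemma dead_endsI:
  assumes "walk w n" "\<And>i. i \<le> n \<Longrightarrow> lab (w i) = U i"
    and "\<And>e'. e' \<in> E \<Longrightarrow> src e' = tgt (w n) \<Longrightarrow> lab e' \<noteq> U (Suc n)"
  shows "tgt (w n) \<in> dead_ends (w 0) U"
  using assms unfolding dead_ends_def by blast

lemma dead_ends_unique:
  assumes "v \<in> dead_ends e U" "v' \<in> dead_ends e U"
  shows "v = v'"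
proof -
  have aux: "n' \<le> n" if w: "walk w n" "w 0 = e" "\<forall>i\<le>n. lab (w i) = U i"
      "\<forall>e'\<in>E. src e' = tgt (w n) \<longrightarrow> lab e' \<noteq> U (Suc n)"
    and w': "walk w' n'" "w' 0 = e" "\<forall>i\<le>n'. lab (w' i) = U i" for w w' n n'
  proof (rule ccontr)
    assume n: "\<not> n' \<le> n"
    then have "walk w' n" using w'(1) by (auto simp: walk_def)
    then have "w n = w' n" using walk_det[of w n w' n] w w' n by auto
    then have "src (w' (Suc n)) = tgt (w n)" "w' (Suc n) \<in> E" using w'(1) n by (auto simp: walk_def)
    with w(4) w'(3) n show False by auto
  qed
  obtain w n where w: "walk w n" "w 0 = e" "\<forall>i\<le>n. lab (w i) = U i"
      "\<forall>e'\<in>E. src e' = tgt (w n) \<longrightarrow> lab e' \<noteq> U (Suc n)" "v = tgt (w n)"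
    using assms(1) unfolding dead_ends_def by blast
  obtain w' n' where w': "walk w' n'" "w' 0 = e" "\<forall>i\<le>n'. lab (w' i) = U i"
      "\<forall>e'\<in>E. src e' = tgt (w' n') \<longrightarrow> lab e' \<noteq> U (Suc n')" "v' = tgt (w' n')"
    using assms(2) unfolding dead_ends_def by blast
  have "n = n'" using aux[OF w(1-4) w'(1-3)] aux[OF w'(1-4) w(1-3)] by simp
  then show ?thesis using walk_det[of w n w' n] w w' by auto
qed

lemma dead_ends_card: "finite (dead_ends e U)" "card (dead_ends e U) \<le> 1"
proof -
  have "dead_ends e U \<subseteq> {SOME v. v \<in> dead_ends e U}"
    using dead_ends_unique someI_ex[of "\<lambda>v. v \<in> dead_ends e U"] by fastforce
  then show "finite (dead_ends e U)" "card (dead_ends e U) \<le> 1"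
    using card_mono[of "{SOME v. v \<in> dead_ends e U}" "dead_ends e U"] finite_subset by auto
qed

text \<open>The arcs between the two positions read a stretch of \<open>U\<close> after which
  \<open>U\<close> starts afresh. Prepending them changes the start of a walk but not its end, so
  positions in phase with \<open>U\<close> share one dead end.\<close>

lemma dead_ends_shift:
  assumes c: "c \<in> J" "j + d < len c" and per: "\<And>t. U (t + d) = U t"
    and lab: "\<And>t. t < d \<Longrightarrow> lab (seg c (j + t)) = U t"
  shows "dead_ends (seg c (j + d)) U \<subseteq> dead_ends (seg c j) U"
proof
  fix v assume "v \<in> dead_ends (seg c (j + d)) U"
  then obtain w n where w: "walk w n" "w 0 = seg c (j + d)" "\<forall>i\<le>n. lab (w i) = U i"
      "\<forall>e'\<in>E. src e' = tgt (w n) \<longrightarrow> lab e' \<noteq> U (Suc n)" "v = tgt (w n)"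
    unfolding dead_ends_def by blast
  define w' where "w' t = (if t < d then seg c (j + t) else w (t - d))" for t
  have "walk w' (n + d)" unfolding w'_def by (rule walk_prepend[OF w(1,2) c])
  moreover have "w' 0 = seg c j" using w by (auto simp: w'_def)
  moreover have "lab (w' i) = U i" if "i \<le> n + d" for i
    using lab w(3) per[of "i - d"] that by (auto simp: w'_def)
  moreover have "U (Suc (n + d)) = U (Suc n)" using per[of "Suc n"] by simp
  ultimately show "v \<in> dead_ends (seg c j) U"
    unfolding dead_ends_def using w(4,5)
    by (auto intro!: exI[of _ w'] exI[of _ "n + d"] simp: w'_def)
qed

lemma periodic_walk:
  assumes w: "walk w N" "w N = w 0" "0 < N"
  shows "inf_walk (\<lambda>t. w (t mod N))"
  unfolding inf_walk_iff
proof (intro allI conjI)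
  fix i
  have m: "i mod N < N" using w(3) by simp
  then show "w (i mod N) \<in> E" using w(1) by (simp add: walk_def)
  show "tgt (w (i mod N)) = src (w (Suc i mod N))"
  proof (cases "Suc (i mod N) = N")
    case True
    then have "Suc i mod N = 0" by (simp add: mod_Suc)
    then show ?thesis using w m True by (metis walk_def)
  next
    case False
    then have "Suc i mod N = Suc (i mod N)" by (simp add: mod_Suc)
    then show ?thesis using w m by (simp add: walk_def)
  qed
qed

lemma sum_len_le: "(\<Sum>c\<in>J. len c) \<le> card E"
proof -
  have "(\<Sum>c\<in>J. len c) = card (SIGMA c:J. {..<len c})" using finJ by simp
  also have "\<dots> \<le> card E"
  proof (rule card_inj_on_le[of "\<lambda>(c, i). seg c i"])
    show "inj_on (\<lambda>(c, i). seg c i) (SIGMA c:J. {..<len c})"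
      using seg_inj by (auto simp: inj_on_def)
    show "(\<lambda>(c, i). seg c i) ` (SIGMA c:J. {..<len c}) \<subseteq> E" using seg_in by auto
  qed (rule finE)
  finally show ?thesis .
qed

end

section \<open>Pairs of segments\<close>

text \<open>\<open>X\<close> is meant to be the edge set of \<Theta>. Being relatively core enters
  through \<open>sources\<close> alone: few vertices have outgoing but no incoming edges of
  \<open>X\<close>.\<close>

locale seg_pair =
  G: seg_graph E1 src1 tgt1 lab1 J1 len1 seg1 + H: seg_graph E2 src2 tgt2 lab2 J2 len2 seg2
  for E1 :: "'e1 set" and src1 tgt1 :: "'e1 \<Rightarrow> 'v1" and lab1 :: "'e1 \<Rightarrow> 'l"
    and J1 :: "'j1 set" and len1 :: "'j1 \<Rightarrow> nat" and seg1 :: "'j1 \<Rightarrow> nat \<Rightarrow> 'e1"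
    and E2 :: "'e2 set" and src2 tgt2 :: "'e2 \<Rightarrow> 'v2" and lab2 :: "'e2 \<Rightarrow> 'l"
    and J2 :: "'j2 set" and len2 :: "'j2 \<Rightarrow> nat" and seg2 :: "'j2 \<Rightarrow> nat \<Rightarrow> 'e2" +
  fixes X :: "('e1 \<times> 'e2) set" and N0 :: nat
  assumes X_sub: "\<And>e f. (e, f) \<in> X \<Longrightarrow> e \<in> E1 \<and> f \<in> E2 \<and> lab1 e = lab2 f"
    and sources: "card (map_prod src1 src2 ` X - map_prod tgt1 tgt2 ` X) \<le> N0"
begin

abbreviation "osrc \<equiv> map_prod src1 src2"
abbreviation "otgt \<equiv> map_prod tgt1 tgt2"

definition C :: nat where "C = card J1 * card J2 + N0"

text \<open>The factor \<open>12 * card J1\<close> stands for \<open>12 * betti1\<close>, which it dominates.\<close>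

definition long_pair :: "'e1 \<Rightarrow> 'e2 \<Rightarrow> bool" where
  "long_pair e f \<longleftrightarrow>
     (\<exists>g h N p t. 0 < N \<and> G.inf_walk g \<and> H.inf_walk h \<and>
        (\<forall>t. g (t + N) = g t) \<and> (\<forall>t. h (t + N) = h t) \<and> (\<forall>t. lab1 (g t) = lab2 (h t)) \<and>
        min_period p (\<lambda>t. lab1 (g t)) \<and>
        (\<forall>k>0. (\<forall>t. g (t + k) = g t) \<longrightarrow> 12 * card J1 * p \<le> k) \<and>
        (\<forall>k>0. (\<forall>t. h (t + k) = h t) \<longrightarrow> 12 * card J2 * p \<le> k) \<and>
        e = g t \<and> f = h t)"

section \<open>Counting sources, dead ends and confluences\<close>

lemma finX: "finite X"
  using X_sub G.finE H.finE by (intro finite_subset[of X "E1 \<times> E2"]) auto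

text \<open>Away from pairs of branching vertices \<open>osrc\<close> is injective: one coordinate
  is determined by its source, and its label then determines the other by \<open>det\<close>. This
  compares edges with sources; exchanging sources for targets costs the vertices counted in
  \<open>sources\<close>.\<close>

lemma excess_bound:
  "card X + card (otgt ` X - osrc ` X) \<le> card (otgt ` X) + C"
proof -
  define X1 where "X1 = {(e, f) \<in> X. src1 e \<in> G.branching \<and> src2 f \<in> H.branching}"
  have "X1 \<subseteq> {e \<in> E1. src1 e \<in> G.branching} \<times> {f \<in> E2. src2 f \<in> H.branching}"
    using X_sub by (auto simp: X1_def)
  then have "card X1 \<le> card ({e \<in> E1. src1 e \<in> G.branching} \<times> {f \<in> E2. src2 f \<in> H.branching})"
    using G.finE H.finE by (intro card_mono) auto
  also have "\<dots> \<le> card J1 * card J2"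
    using G.card_branching_out H.card_branching_out by (simp add: card_cartesian_product mult_le_mono)
  finally have X1: "card X1 \<le> card J1 * card J2" .
  have "inj_on osrc (X - X1)"
  proof (rule inj_onI, clarify)
    fix e f e' f' assume *: "(e, f) \<in> X" "(e, f) \<notin> X1" "(e', f') \<in> X" "(e', f') \<notin> X1"
      "osrc (e, f) = osrc (e', f')"
    have X: "e \<in> E1" "f \<in> E2" "lab1 e = lab2 f" "e' \<in> E1" "f' \<in> E2" "lab1 e' = lab2 f'"
      using X_sub * by blast+
    from * consider "src1 e \<notin> G.branching" | "src2 f \<notin> H.branching" by (auto simp: X1_def)
    then show "e = e' \<and> f = f'"
    proof cases
      case 1
      then have "e = e'" using X * by (auto simp: G.branching_def)
      then show ?thesis using H.det[of f f'] X * by auto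
    next
      case 2
      then have "f = f'" using X * by (auto simp: H.branching_def)
      then show ?thesis using G.det[of e e'] X * by auto
    qed
  qed
  then have "card (X - X1) = card (osrc ` (X - X1))" by (simp add: card_image)
  also have "\<dots> \<le> card (osrc ` X)" using finX by (intro card_mono) auto
  finally have "card (X - X1) \<le> card (osrc ` X)" .
  moreover have "X1 \<subseteq> X" by (auto simp: X1_def)
  then have "card X \<le> card (X - X1) + card X1"
    using finX card_Diff_subset[of X1 X] by (simp add: finite_subset)
  ultimately have "card X \<le> card (osrc ` X) + card J1 * card J2" using X1 by linarith
  moreover have "card (otgt ` X) + card (osrc ` X - otgt ` X) = card (osrc ` X) + card (otgt ` X - osrc ` X)"
  proof -
    have "card (A \<union> B) = card A + card (B - A)" if "finite A" "finite B" for A B :: "('v1 \<times> 'v2) set"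
      using that card_Un_disjoint[of A "B - A"] by auto
    from this[of "otgt ` X" "osrc ` X"] this[of "osrc ` X" "otgt ` X"] finX
    show ?thesis by (simp add: Un_commute)
  qed
  ultimately show ?thesis using sources unfolding C_def by linarith
qed

text \<open>A path in \<open>X\<close> can leave the word \<open>U\<close> only at a vertex where each of its two coordinates is
  branching or is the end of the walk reading \<open>U\<close>.\<close>

lemma walk_reads:
  assumes w: "\<And>i. i \<le> N \<Longrightarrow> w i \<in> X" "\<And>i. i < N \<Longrightarrow> otgt (w i) = osrc (w (Suc i))"
      "\<And>i. i < N \<Longrightarrow> otgt (w i) \<notin>
         (G.branching \<union> G.dead_ends (fst (w 0)) U) \<times> (H.branching \<union> H.dead_ends (snd (w 0)) U)"
    and U: "lab1 (fst (w 0)) = U 0" and i: "i \<le> N"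
  shows "lab1 (fst (w i)) = U i"
  using i
proof (induction i rule: less_induct)
  case (less i)
  show ?case
  proof (cases i)
    case 0
    then show ?thesis using U by simp
  next
    case (Suc k)
    have k: "k < N" using less.prems Suc by simp
    have walks: "G.walk (\<lambda>i. fst (w i)) k" "H.walk (\<lambda>i. snd (w i)) k"
      using w(1,2) k X_sub unfolding G.walk_def H.walk_def
      by (auto simp: prod_eq_iff dest: less_imp_le less_trans) (metis less_imp_le le_less_trans prod.collapse)+
    have labs: "\<forall>i\<le>k. lab1 (fst (w i)) = U i" using less Suc by simp
    have labs2: "\<forall>i\<le>k. lab2 (snd (w i)) = U i"
      using labs w(1) k X_sub by (metis less_imp_le order_trans prod.collapse)
    define e f where "e = fst (w (Suc k))" and "f = snd (w (Suc k))"
    have ef: "e \<in> E1" "f \<in> E2" "lab1 e = lab2 f"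
      using w(1)[of "Suc k"] k X_sub[of e f] by (auto simp: e_def f_def)
    have t: "src1 e = tgt1 (fst (w k))" "src2 f = tgt2 (snd (w k))"
      using w(2)[OF k] by (auto simp: e_def f_def prod_eq_iff)
    show ?thesis
    proof (rule ccontr)
      assume "lab1 (fst (w i)) \<noteq> U i"
      then have ne: "lab1 e \<noteq> U (Suc k)" "lab2 f \<noteq> U (Suc k)" using ef Suc by (auto simp: e_def)
      \<comment> \<open>At a vertex that does not branch, the only outgoing arc carries the wrong
        letter, so the walk reading \<open>U\<close> stops there.\<close>
      have "tgt1 (fst (w k)) \<in> G.branching \<union> G.dead_ends (fst (w 0)) U"
      proof (cases "tgt1 (fst (w k)) \<in> G.branching")
        case False
        then have "\<forall>e'\<in>E1. src1 e' = tgt1 (fst (w k)) \<longrightarrow> lab1 e' \<noteq> U (Suc k)"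
          using ef t ne unfolding G.branching_def mem_Collect_eq by metis
        then show ?thesis using G.dead_endsI[OF walks(1), of U] labs by simp
      qed simp
      moreover have "tgt2 (snd (w k)) \<in> H.branching \<union> H.dead_ends (snd (w 0)) U"
      proof (cases "tgt2 (snd (w k)) \<in> H.branching")
        case False
        then have "\<forall>e'\<in>E2. src2 e' = tgt2 (snd (w k)) \<longrightarrow> lab2 e' \<noteq> U (Suc k)"
          using ef t ne unfolding H.branching_def mem_Collect_eq by metis
        then show ?thesis using H.dead_endsI[OF walks(2), of U] labs2 by simp
      qed simp
      ultimately show False using w(3)[OF k] by (auto simp: map_prod_def split: prod.splits)
    qed
  qed
qed

text \<open>Unrolling the two closed walks gives periodic ones with common period
  \<open>N * M\<close>. Any period of the first leads back to \<open>seg1 c a\<close>, so it is at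
  least \<open>len1 c\<close> by \<open>return_time\<close>, and likewise for the second.\<close>

lemma long_pairI:
  assumes G: "G.walk w N" "w N = w 0" "0 < N" "w 0 = seg1 c a" "c \<in> J1" "a < len1 c"
    and H: "H.walk v M" "v M = v 0" "0 < M" "v 0 = seg2 d b" "d \<in> J2" "b < len2 d"
    and U: "min_period p U" "p dvd N" "p dvd M"
      "\<And>t. t < N \<Longrightarrow> lab1 (w t) = U t" "\<And>t. t < M \<Longrightarrow> lab2 (v t) = U t"
    and long: "12 * card J1 * p \<le> len1 c" "12 * card J2 * p \<le> len2 d"
  shows "long_pair (seg1 c a) (seg2 d b)"
proof -
  define g where "g t = w (t mod N)" for t
  define h where "h t = v (t mod M)" for t
  have per: "U (t + p) = U t" for t using U(1) by (simp add: min_period_def)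
  have walks: "G.inf_walk g" "H.inf_walk h"
    unfolding g_def h_def using G.periodic_walk H.periodic_walk G H by blast+
  have Umod: "U (t mod K) = U t" if "p dvd K" for K t
    using periodic_mod[of U K t] periodic_dvd[of U p K] per that by blast
  have labs: "lab1 (g t) = U t" "lab2 (h t) = U t" for t
    using U(4)[of "t mod N"] U(5)[of "t mod M"] Umod[OF U(2)] Umod[OF U(3)] G(3) H(3)
    by (auto simp: g_def h_def)
  have g: "len1 c \<le> k" if "0 < k" "\<forall>t. g (t + k) = g t" for k
  proof -
    have "g k = g 0" using that(2)[rule_format, of 0] by simp
    then show ?thesis
      using G.return_time[of g k c a a] walks that G by (auto simp: G.inf_walk_def g_def)
  qed
  have h: "len2 d \<le> k" if "0 < k" "\<forall>t. h (t + k) = h t" for k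
  proof -
    have "h k = h 0" using that(2)[rule_format, of 0] by simp
    then show ?thesis
      using H.return_time[of h k d b b] walks that H by (auto simp: H.inf_walk_def h_def)
  qed
  have "min_period p (\<lambda>t. lab1 (g t))" using U(1) by (simp add: labs)
  moreover have "\<forall>t. g (t + N * M) = g t" "\<forall>t. h (t + N * M) = h t"
    by (simp_all add: g_def h_def)
  moreover have "0 < N * M" using G H by simp
  moreover have "seg1 c a = g 0" "seg2 d b = h 0" using G H by (simp_all add: g_def h_def)
  moreover have "\<forall>k>0. (\<forall>t. g (t + k) = g t) \<longrightarrow> 12 * card J1 * p \<le> k"
    using g long(1) order_trans by blast
  moreover have "\<forall>k>0. (\<forall>t. h (t + k) = h t) \<longrightarrow> 12 * card J2 * p \<le> k"
    using h long(2) order_trans by blast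
  ultimately show ?thesis unfolding long_pair_def using walks labs by metis
qed

section \<open>Full diagonals and the periodicity argument\<close>

definition full_diag :: "'j1 \<Rightarrow> 'j2 \<Rightarrow> nat \<Rightarrow> nat \<Rightarrow> bool" where
  "full_diag c d i j \<longleftrightarrow>
     (\<forall>i'<len1 c. \<forall>j'<len2 d. i' + j = i + j' \<longrightarrow> (seg1 c i', seg2 d j') \<in> X)"

lemma full_diag_add:
  "full_diag c d i j \<Longrightarrow> i + t < len1 c \<Longrightarrow> j + t < len2 d \<Longrightarrow> (seg1 c (i + t), seg2 d (j + t)) \<in> X"
  by (simp add: full_diag_def)

lemma full_diag_diff:
  "full_diag c d i j \<Longrightarrow> i < len1 c \<Longrightarrow> j < len2 d \<Longrightarrow> t \<le> min i j \<Longrightarrow>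
     (seg1 c (i - t), seg2 d (j - t)) \<in> X"
  by (simp add: full_diag_def)

text \<open>The number of cells from \<open>(i, j)\<close> to the end of its diagonal, that cell
  included; \<open>min i j\<close> cells lie before it.\<close>

definition ahead :: "'j1 \<Rightarrow> 'j2 \<Rightarrow> nat \<Rightarrow> nat \<Rightarrow> nat" where
  "ahead c d i j = min (len1 c - i) (len2 d - j)"

text \<open>On either side of \<open>a\<close> the bounds on \<open>ahead\<close> make the overlap of any two of the diagonals
  longer than a small gap between them, which is what the periodicity argument needs.\<close>

lemma fibre_bound:
  assumes c: "c \<in> J1" "a < len1 c" and d: "d \<in> J2" "len2 d \<le> len1 c"
    and B: "B \<subseteq> {..<len2 d}"
    and group: "(\<forall>j\<in>B. a \<le> j) \<or> (\<forall>j\<in>B. j < a)"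
    and full: "\<And>j. j \<in> B \<Longrightarrow> full_diag c d a j"
    and short: "\<And>j. j \<in> B \<Longrightarrow> \<not> long_pair (seg1 c a) (seg2 d j)"
    and mid: "\<And>j. j \<in> B \<Longrightarrow> min a j < ahead c d a j"
      "\<And>j. j \<in> B \<Longrightarrow> ahead c d a j \<le> 3 * min a j + 3"
  shows "card B \<le> 17 * C"
proof (rule ccontr)
  assume "\<not> card B \<le> 17 * C"
  define L where "L = ahead c d a"
  have Ldef: "L j = min (len1 c - a) (len2 d - j)" for j by (simp add: L_def ahead_def)
  have mid1: "min a j < L j" and mid2: "L j \<le> 3 * min a j + 3" if "j \<in> B" for j
    using mid[OF that] by (simp_all add: L_def)
  have Bh: "j < len2 d" if "j \<in> B" for j using B that by auto
  have finB: "finite B" using B finite_subset by blast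
  have "card J1 > 0" "card J2 > 0" using c d G.finJ H.finJ by (auto simp: card_gt_0_iff)
  then have C1: "1 \<le> card J1 * card J2" "card J1 \<le> card J1 * card J2" "card J2 \<le> card J1 * card J2"
    by (auto simp: Suc_le_eq)
  then have Cpos: "0 < C" "card J1 \<le> C" "card J2 \<le> C" "card J1 * card J2 \<le> C"
    unfolding C_def by linarith+
  define q where "q = 12 * C"
  have "q + (5 * C + 1) \<le> card B" using \<open>\<not> card B \<le> 17 * C\<close> by (simp add: q_def)
  then obtain x y where xy: "x \<in> B" "y \<in> B" "x < y" "q * (y - x) \<le> Max B - Min B"
    and cardI: "5 * C + 1 \<le> card {j \<in> B. x \<le> j}"
    using small_gap[OF finB, of q "5 * C + 1"] Cpos by (auto simp: q_def)
  define g where "g = y - x"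
  have g: "0 < g" "y = x + g" "q * g \<le> Max B - Min B" using xy by (auto simp: g_def)
  have Bne: "B \<noteq> {}" using xy by auto
  have MM: "Max B \<in> B" "Min B \<in> B" using finB Bne by simp_all
  have q12: "12 * g \<le> q * g" using Cpos by (simp add: q_def)

  \<comment> \<open>The diagonal of \<open>j\<close> reaches all later positions of
    \<open>B\<close>: for \<open>a \<le> j\<close> it runs to the end of \<open>d\<close>, and for
    \<open>j' < a\<close> it has more than \<open>j'\<close> cells ahead.\<close>
  have F1: "j' < j + L j" if "j \<in> B" "j' \<in> B" "j < j'" for j j'
    using group
  proof
    assume "\<forall>j\<in>B. a \<le> j"
    then have "a \<le> j" using that by simp
    then have "L j = len2 d - j" using d Bh[OF that(1)] by (simp add: Ldef)
    then show ?thesis using Bh[OF that(2)] that by linarith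
  next
    assume "\<forall>j\<in>B. j < a"
    then have "min a j' = j'" using that by auto
    then have "j' < L j'" using mid1[OF that(2)] by simp
    also have "L j' \<le> L j" using that by (auto simp: Ldef)
    finally show ?thesis by simp
  qed
  \<comment> \<open>The spread of \<open>B\<close> is at least \<open>12 * g\<close> and at most
    \<open>3 * min a j + 2\<close>, so every diagonal has \<open>g\<close> cells behind
    \<open>a\<close>.\<close>
  have gmin: "g \<le> min a j" if "j \<in> B" for j
  proof -
    have *: "Max B - Min B \<le> 3 * min a j + 2"
      using group
    proof
      assume ge: "\<forall>j\<in>B. a \<le> j"
      have "Min B \<le> Max B" using MM finB by simp
      then have "Max B < Min B + L (Min B)"
        using F1[OF MM(2,1)] mid1[OF MM(2)] by (cases "Min B = Max B") auto
      moreover have "L (Min B) \<le> 3 * a + 3" "a \<le> j" using mid2[OF MM(2)] that ge MM by auto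
      ultimately show ?thesis by simp
    next
      assume lt: "\<forall>j\<in>B. j < a"
      have "j \<le> Max B" using that finB by simp
      then have "L (Max B) \<le> L j" by (auto simp: Ldef)
      moreover have "Max B < L (Max B)" using mid1[OF MM(1)] lt MM by (auto simp: min_def split: if_splits)
      ultimately show ?thesis using mid2[OF that] by linarith
    qed
    show ?thesis using * g q12 by linarith
  qed
  \<comment> \<open>A whole window of length \<open>g\<close> from \<open>j'\<close> on is still
    within reach of \<open>j\<close>; \<open>R3\<close> compares phases in it.\<close>
  have F3: "j' + t < j + L j" if "j \<in> B" "j' \<in> B" "j < j'" "t < g" for j j' t
    using group
  proof
    assume ge: "\<forall>j\<in>B. a \<le> j"
    then have "a \<le> j" "a \<le> j'" using that by simp_all
    then have "L j = len2 d - j" "L j' = len2 d - j'" using d Bh that by (auto simp: Ldef)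
    moreover have "g < L j'" using gmin mid1 that by (meson le_less_trans)
    ultimately show ?thesis using that by linarith
  next
    assume "\<forall>j\<in>B. j < a"
    then have "min a j' = j'" using that by auto
    then have "j' < L j'" using mid1[OF that(2)] by simp
    also have "L j' \<le> L j" using that by (auto simp: Ldef)
    finally show ?thesis using gmin[OF that(1)] that by simp
  qed

  have match: "lab1 (seg1 c (a + t)) = lab2 (seg2 d (j + t))" if "j \<in> B" "t < L j" for j t
  proof -
    have "a + t < len1 c" "j + t < len2 d" using that(2) unfolding Ldef by linarith+
    then have "(seg1 c (a + t), seg2 d (j + t)) \<in> X"
      using full_diag_add full[OF that(1)] by blast
    then show ?thesis using X_sub by blast
  qed
  have matchback: "lab1 (seg1 c (a - t)) = lab2 (seg2 d (j - t))" if "j \<in> B" "t \<le> min a j" for j t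
    using full_diag_diff[OF full[OF that(1)] c(2) Bh[OF that(1)] that(2)] X_sub by blast
  define U where "U t = lab2 (seg2 d (x + t mod g))" for t
  have Uper: "U (t + g) = U t" for t by (simp add: U_def)
  \<comment> \<open>Crossing from \<open>d\<close> to \<open>c\<close> along the diagonal of
    \<open>y\<close> and back along that of \<open>x\<close> moves a position of \<open>d\<close> by
    \<open>g\<close> without changing its label.\<close>
  have R1: "lab2 (seg2 d (x + t)) = U t" if "t < L x" for t
    using that
  proof (induction t rule: less_induct)
    case (less t)
    show ?case
    proof (cases "t < g")
      case True
      then show ?thesis by (simp add: U_def)
    next
      case False
      then have t: "t - g < L y" "t - g < L x" "y + (t - g) = x + t" "t - g < t"
        using less.prems g(1,2) by (auto simp: Ldef)
      have "lab2 (seg2 d (x + t)) = lab1 (seg1 c (a + (t - g)))"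
        using match[OF xy(2) t(1)] t(3) by simp
      also have "\<dots> = lab2 (seg2 d (x + (t - g)))" using match[OF xy(1) t(2)] by simp
      also have "\<dots> = U (t - g)" using less.IH t by blast
      also have "\<dots> = U t" using Uper[of "t - g"] False by simp
      finally show ?thesis .
    qed
  qed
  \<comment> \<open>Positions after \<open>x\<close> have at most \<open>L x\<close> cells ahead, so
    all labels along them fall in the range where \<open>U\<close> is known.\<close>
  define I where "I = {j \<in> B. x \<le> j}"
  have IB: "j \<in> B" "x \<le> j" if "j \<in> I" for j using that by (auto simp: I_def)
  have Lx: "L j \<le> L x" if "j \<in> I" for j using IB[OF that] by (auto simp: Ldef)
  have R2: "lab1 (seg1 c (a + t)) = U t" if "t < L x" for t
    using match[OF xy(1) that] R1[OF that] by simp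
  have R2': "lab2 (seg2 d (j + t)) = U t" if "j \<in> I" "t < L j" for j t
    using match[OF IB(1)[OF that(1)] that(2)] R2[of t] Lx[OF that(1)] that by simp
  obtain p where p: "min_period p U" "p \<le> g" using min_periodE[of g U] g Uper by blast
  have pper: "U (t + p) = U t" and ppos: "0 < p" for t using p(1) by (auto simp: min_period_def)
  \<comment> \<open>Both positions read \<open>U\<close> from its start, so \<open>U\<close> agrees
    with its shift by \<open>j' - j\<close> on a window of length \<open>p\<close>.\<close>
  have R3: "p dvd j' - j" if "j \<in> I" "j' \<in> I" "j < j'" for j j'
  proof (rule min_period_dvd[OF p(1)])
    fix t assume t: "t < p"
    have "j' - j + t < L j" using F3[of j j' t] IB that t p by simp
    then have "lab2 (seg2 d (j + (j' - j + t))) = U (j' - j + t)" by (rule R2'[OF that(1)])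
    moreover have "t < L j'" using mid1[of j'] gmin[of j'] IB that t p by (meson le_less_trans less_le_trans order_less_imp_le)
    then have "lab2 (seg2 d (j' + t)) = U t" by (rule R2'[OF that(2)])
    ultimately show "U (j' - j + t) = U t" using that(3) by simp
  qed
  \<comment> \<open>All positions of \<open>I\<close> are in phase with \<open>x\<close>, so one
    dead end serves for all of them and \<open>A'\<close> stays small.\<close>
  have de: "H.dead_ends (seg2 d j) U \<subseteq> H.dead_ends (seg2 d x) U" if "j \<in> I" for j
  proof (cases "x = j")
    case False
    then have "x < j" using IB(2)[OF that] by simp
    have xI: "x \<in> I" using xy by (simp add: I_def)
    have "H.dead_ends (seg2 d (x + (j - x))) U \<subseteq> H.dead_ends (seg2 d x) U"
    proof (rule H.dead_ends_shift[OF d(1)])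
      show "x + (j - x) < len2 d" using \<open>x < j\<close> Bh IB that by simp
      show "U (t + (j - x)) = U t" for t
        using periodic_dvd[of U p "j - x" t] pper R3[OF xI that \<open>x < j\<close>] by blast
      show "lab2 (seg2 d (x + t)) = U t" if "t < j - x" for t
        using R1[of t] F1[OF xy(1) IB(1)[OF \<open>j \<in> I\<close>] \<open>x < j\<close>] that by linarith
    qed
    then show ?thesis using \<open>x < j\<close> by simp
  qed simp

  define A where "A = G.branching \<union> G.dead_ends (seg1 c a) U"
  define A' where "A' = H.branching \<union> H.dead_ends (seg2 d x) U"
  have finA: "finite A" "finite A'"
    by (simp_all add: A_def A'_def G.finite_branching H.finite_branching G.dead_ends_card H.dead_ends_card)
  have cardA: "card A \<le> 2 * card J1" "card A' \<le> 2 * card J2"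
  proof -
    have "card A \<le> card G.branching + card (G.dead_ends (seg1 c a) U)"
      "card A' \<le> card H.branching + card (H.dead_ends (seg2 d x) U)"
      unfolding A_def A'_def by (rule card_Un_le)+
    then show "card A \<le> 2 * card J1" "card A' \<le> 2 * card J2"
      using G.card_branching H.card_branching G.dead_ends_card(2)[of "seg1 c a" U]
        H.dead_ends_card(2)[of "seg2 d x" U] \<open>card J1 > 0\<close> \<open>card J2 > 0\<close> by linarith+
  qed
  \<comment> \<open>Blocking the pairs in \<open>A \<times> A'\<close> forces a returning path to
    read \<open>U\<close> by \<open>walk_reads\<close>; the dead ends of \<open>X\<close> are
    included to meet the hypothesis of \<open>return_exists\<close>.\<close>
  define Z where "Z = (otgt ` X - osrc ` X) \<union> A \<times> A'"
  have "card (A \<times> A') \<le> (2 * card J1) * (2 * card J2)"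
    unfolding card_cartesian_product using cardA by (rule mult_le_mono)
  then have cardZ: "card Z \<le> card (otgt ` X - osrc ` X) + 4 * C"
    using card_Un_le[of "otgt ` X - osrc ` X" "A \<times> A'"] Cpos(4) unfolding Z_def by linarith
  have finZ: "finite Z" using finA finX by (simp add: Z_def)
  define S where "S = (\<lambda>j. (seg1 c a, seg2 d j)) ` I"
  have "inj_on (\<lambda>j. (seg1 c a, seg2 d j)) I"
    using H.seg_inj[OF d(1) d(1)] Bh IB by (auto simp: inj_on_def)
  then have cardS: "5 * C + 1 \<le> card S" using cardI by (simp add: S_def card_image I_def)
  have SX: "S \<subseteq> X"
    using full_diag_add[OF full, of _ 0] IB Bh c(2) by (auto simp: S_def)
  \<comment> \<open>\<open>excess_bound\<close> absorbs the dead ends in \<open>Z\<close> together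
    with the confluences at a cost of \<open>C\<close>; the rest of \<open>Z\<close> costs
    \<open>4 * C\<close>, and \<open>S\<close> has one element more.\<close>
  have "\<exists>s\<in>S. \<exists>s'\<in>S. (s, s') \<in> {(r, r'). r \<in> X \<and> r' \<in> X \<and> otgt r = osrc r' \<and> otgt r \<notin> Z}\<^sup>+"
    using cardZ cardS excess_bound by (intro return_exists[OF finX finZ _ SX]) (auto simp: Z_def)
  then obtain j j' where jj: "j \<in> I" "j' \<in> I"
    "((seg1 c a, seg2 d j), (seg1 c a, seg2 d j')) \<in> {(r, r'). r \<in> X \<and> r' \<in> X \<and> otgt r = osrc r' \<and> otgt r \<notin> Z}\<^sup>+"
    unfolding S_def by blast
  then obtain N w where N: "0 < N" and w0: "w 0 = (seg1 c a, seg2 d j)" and wN: "w N = (seg1 c a, seg2 d j')"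
    and w: "\<forall>i<N. (w i, w (Suc i)) \<in> {(r, r'). r \<in> X \<and> r' \<in> X \<and> otgt r = osrc r' \<and> otgt r \<notin> Z}"
    unfolding trancl_power relpow_fun_conv by blast
  have wX: "w i \<in> X" if "i \<le> N" for i
    using w N that by (cases "i < N") (auto dest: spec[of _ "N - 1"])
  have wt: "otgt (w i) = osrc (w (Suc i))" "otgt (w i) \<notin> Z" if "i < N" for i using w that by auto
  have walks: "G.walk (\<lambda>i. fst (w i)) N" "H.walk (\<lambda>i. snd (w i)) N"
  proof -
    have "fst (w i) \<in> E1" "snd (w i) \<in> E2" if "i \<le> N" for i
      using X_sub[of "fst (w i)" "snd (w i)"] wX[OF that] by simp_all
    moreover have "tgt1 (fst (w i)) = src1 (fst (w (Suc i)))" "tgt2 (snd (w i)) = src2 (snd (w (Suc i)))"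
      if "i < N" for i using wt(1)[OF that] by (simp_all add: prod_eq_iff)
    ultimately show "G.walk (\<lambda>i. fst (w i)) N" "H.walk (\<lambda>i. snd (w i)) N"
      by (simp_all add: G.walk_def H.walk_def)
  qed
  have Lpos: "0 < L i" if "i \<in> B" for i using mid1[OF that] by simp
  have reads: "lab1 (fst (w i)) = U i" if "i \<le> N" for i
  proof (rule walk_reads[OF _ _ _ _ that])
    show "lab1 (fst (w 0)) = U 0" using R2[of 0] Lpos[OF xy(1)] w0 by simp
    show "otgt (w i) \<notin> (G.branching \<union> G.dead_ends (fst (w 0)) U) \<times> (H.branching \<union> H.dead_ends (snd (w 0)) U)"
      if "i < N" for i
      using wt(2)[OF that] de[OF jj(1)] unfolding Z_def A_def A'_def w0 by auto
  qed (use wX wt in auto)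
  have reads2: "lab2 (snd (w i)) = U i" if "i \<le> N" for i
    using reads[OF that] X_sub[of "fst (w i)" "snd (w i)"] wX[OF that] by simp
  have Nm: "len1 c \<le> N"
    using G.return_time[OF walks(1) c(1), of a a] w0 wN c N by simp
  have pdg: "p dvd g" by (rule min_period_dvd[OF p(1)]) (metis Uper add.commute)
  have ga: "g \<le> a" "g \<le> y" using gmin[OF xy(2)] by auto
  \<comment> \<open>The arc at time \<open>N\<close> compares a single letter, which need not fix
    the phase. The \<open>p\<close> arcs before it do: they lie in \<open>c\<close>, and the
    diagonal of \<open>y\<close>, rather than that of \<open>x\<close>, carries them to positions of
    \<open>d\<close> from \<open>x\<close> on, where \<open>R1\<close> applies.\<close>
  have pNp: "p dvd N - p"
  proof (rule min_period_dvd[OF p(1)])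
    fix t assume t: "t < p"
    have ineq: "p - t \<le> N" "p - t \<le> a" "p - t \<le> min a y" "p \<le> N" using p(2) ga Nm c by auto
    have "U (N - p + t) = U (N - (p - t))" using t ineq by simp
    also have "\<dots> = lab1 (fst (w (N - (p - t))))" using reads[of "N - (p - t)"] by simp
    also have "fst (w (N - (p - t))) = seg1 c (a - (p - t))"
      using ineq wN c by (intro G.walk_backward[OF walks(1) c(1)]) auto
    also have "lab1 \<dots> = lab2 (seg2 d (y - (p - t)))" using matchback[OF xy(2) ineq(3)] .
    also have "y - (p - t) = x + (g - (p - t))" using g(2) p(2) by simp
    also have "lab2 (seg2 d \<dots>) = U (g - (p - t))"
    proof (rule R1)
      have "g \<le> min a x" using gmin[OF xy(1)] .
      then show "g - (p - t) < L x" using mid1[OF xy(1)] by linarith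
    qed
    also have "g - (p - t) = t + (g - p)" using p(2) t by simp
    also have "U (t + (g - p)) = U t" by (rule periodic_dvd[where p = p]) (use pper pdg in \<open>simp_all add: dvd_diff_nat\<close>)
    finally show "U (N - p + t) = U t" .
  qed
  have "p \<le> N" using p(2) ga Nm c by linarith
  then have "N - p + p = N" by (rule le_add_diff_inverse2)
  then have pN: "p dvd N" using dvd_add[OF pNp dvd_refl[of p]] by metis
  have Glab: "lab1 (fst (w t)) = U t" if "t < N" for t using reads that by simp
  \<comment> \<open>\<open>q * g\<close> is at most the spread of \<open>B\<close>, which is less
    than the length of \<open>d\<close>, the shorter segment.\<close>
  have long: "12 * card J1 * p \<le> len1 c" "12 * card J2 * p \<le> len2 d"
  proof -
    have "12 * card J1 * p \<le> q * g" "12 * card J2 * p \<le> q * g"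
      using Cpos p(2) by (auto simp: q_def intro!: mult_le_mono)
    moreover have "Max B < len2 d" using Bh MM by blast
    ultimately show "12 * card J1 * p \<le> len1 c" "12 * card J2 * p \<le> len2 d"
      using g(3) d(2) by linarith+
  qed
  \<comment> \<open>The first coordinate of the path is closed already. It remains to close the
    second one at some \<open>b \<in> B\<close>, by a walk whose length is a multiple of
    \<open>p\<close>.\<close>
  have closing: False
    if v: "H.walk v M" "v M = v 0" "0 < M" "v 0 = seg2 d b" "b \<in> B" "p dvd M"
      "\<And>t. t < M \<Longrightarrow> lab2 (v t) = U t" for v M b
  proof -
    have "long_pair (seg1 c a) (seg2 d b)"
      using long_pairI[OF walks(1) _ N _ c v(1-4) d(1) Bh[OF v(5)] p(1) pN v(6) Glab v(7) long] w0 wN by simp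
    then show False using short[OF v(5)] by simp
  qed
  show False
  proof (cases "j' \<le> j")
    case True
    \<comment> \<open>The path ends at or behind its start in \<open>d\<close>; running along
      \<open>d\<close> from \<open>j'\<close> to \<open>j\<close> beforehand closes it at
      \<open>j'\<close>.\<close>
    define \<delta> where "\<delta> = j - j'"
    have j: "j = j' + \<delta>" using True by (simp add: \<delta>_def)
    have pd: "p dvd \<delta>" using R3[OF jj(2,1)] True by (cases "j' = j") (auto simp: \<delta>_def)
    let ?v = "\<lambda>t. if t < \<delta> then seg2 d (j' + t) else snd (w (t - \<delta>))"
    have "H.walk ?v (N + \<delta>)"
      using walks(2) w0 d(1) Bh[OF IB(1)[OF jj(1)]] by (intro H.walk_prepend) (auto simp: j)
    moreover have "?v (N + \<delta>) = ?v 0" using w0 wN j by auto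
    moreover have "?v 0 = seg2 d j'" using w0 j by auto
    moreover have "lab2 (?v t) = U t" if "t < N + \<delta>" for t
    proof (cases "t < \<delta>")
      case True
      then have "t < L j'" using F1[OF IB(1)[OF jj(2)] IB(1)[OF jj(1)]] j by linarith
      then show ?thesis using R2'[OF jj(2)] True by simp
    next
      case False
      have "U (t - \<delta> + \<delta>) = U (t - \<delta>)" by (rule periodic_dvd[where p = p]) (use pper pd in simp_all)
      then show ?thesis using reads2[of "t - \<delta>"] \<open>t < N + \<delta>\<close> False by simp
    qed
    ultimately show False
      using closing[of ?v "N + \<delta>" j'] N IB[OF jj(2)] pN pd by auto
  next
    case False
    \<comment> \<open>The path ends ahead of its start, so its last \<open>\<delta>\<close> steps
      run along \<open>d\<close> from \<open>j\<close>; dropping them closes it.\<close>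
    define \<delta> where "\<delta> = j' - j"
    have j: "j' = j + \<delta>" "0 < \<delta>" using False by (auto simp: \<delta>_def)
    have pd: "p dvd \<delta>" using R3[OF jj(1,2)] False by (simp add: \<delta>_def)
    have \<delta>N: "\<delta> < N" using Bh[OF IB(1)[OF jj(2)]] d(2) Nm j by linarith
    have "H.walk (\<lambda>i. snd (w i)) (N - \<delta>)" using walks(2) unfolding H.walk_def by auto
    moreover have "snd (w (N - \<delta>)) = seg2 d (j' - \<delta>)"
      using wN \<delta>N j Bh[OF IB(1)[OF jj(2)]] by (intro H.walk_backward[OF walks(2) d(1)]) auto
    ultimately show False
      using closing[of "\<lambda>i. snd (w i)" "N - \<delta>" j] w0 j \<delta>N IB[OF jj(1)] pN pd reads2 by auto
  qed
qed

text \<open>As long as both walks stay inside their segments they are forced in either direction, so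
  they run through the entire diagonal.\<close>

lemma long_pair_diag:
  assumes lp: "long_pair (seg1 c i) (seg2 d j)" and cd: "c \<in> J1" "d \<in> J2"
    and ij: "i < len1 c" "j < len2 d" "i' < len1 c" "j' < len2 d" "i' + j = i + j'"
  shows "long_pair (seg1 c i') (seg2 d j')"
proof -
  obtain g h N p t where l: "0 < N" "G.inf_walk g" "H.inf_walk h"
    "\<forall>t. g (t + N) = g t" "\<forall>t. h (t + N) = h t" "\<forall>t. lab1 (g t) = lab2 (h t)"
    "min_period p (\<lambda>t. lab1 (g t))"
    "\<forall>k>0. (\<forall>t. g (t + k) = g t) \<longrightarrow> 12 * card J1 * p \<le> k"
    "\<forall>k>0. (\<forall>t. h (t + k) = h t) \<longrightarrow> 12 * card J2 * p \<le> k"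
    and t: "seg1 c i = g t" "seg2 d j = h t"
    using lp unfolding long_pair_def by (elim exE conjE) (rule that; assumption)
  have walks: "G.walk g n" "H.walk h n" for n using l(2,3) unfolding G.inf_walk_def H.inf_walk_def by blast+
  have "\<exists>t'. seg1 c i' = g t' \<and> seg2 d j' = h t'"
  proof (cases "i \<le> i'")
    case True
    define \<delta> where "\<delta> = i' - i"
    have *: "i' = i + \<delta>" "j' = j + \<delta>" using True ij by (auto simp: \<delta>_def)
    have "g (t + \<delta>) = seg1 c (i + \<delta>)" "h (t + \<delta>) = seg2 d (j + \<delta>)"
      using G.walk_forward[OF walks(1)[of "t + \<delta>"] cd(1) t(1)[symmetric]]
        H.walk_forward[OF walks(2)[of "t + \<delta>"] cd(2) t(2)[symmetric]] * ij by simp_all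
    then show ?thesis using * by metis
  next
    case False
    define \<delta> where "\<delta> = i - i'"
    have *: "i' = i - \<delta>" "j' = j - \<delta>" "\<delta> \<le> i" "\<delta> \<le> j" using False ij by (auto simp: \<delta>_def)
    \<comment> \<open>Walks begin at time 0; a later visit to the same pair leaves room for
      \<open>\<delta>\<close> steps back.\<close>
    define s where "s = t + \<delta> * N"
    have "g (t + \<delta> * N) = g t" by (rule periodic_mult) (rule l(4)[rule_format])
    moreover have "h (t + \<delta> * N) = h t" by (rule periodic_mult) (rule l(5)[rule_format])
    ultimately have s: "g s = seg1 c i" "h s = seg2 d j" "\<delta> \<le> s"
      using l(1) t by (simp_all add: s_def trans_le_add2)
    have "g (s - \<delta>) = seg1 c (i - \<delta>)" "h (s - \<delta>) = seg2 d (j - \<delta>)"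
      using G.walk_backward[OF walks(1)[of s] cd(1) s(1)] H.walk_backward[OF walks(2)[of s] cd(2) s(2)]
        * s ij by simp_all
    then show ?thesis using * by metis
  qed
  then obtain t' where "seg1 c i' = g t'" "seg2 d j' = h t'" by blast
  then show ?thesis unfolding long_pair_def
    using l by (intro exI[of _ g] exI[of _ h] exI[of _ N] exI[of _ p] exI[of _ t'] conjI)
qed

section \<open>Counting the cells of one rectangle\<close>

definition cells :: "'j1 \<Rightarrow> 'j2 \<Rightarrow> (nat \<times> nat) set" where
  "cells c d = {(i, j). i < len1 c \<and> j < len2 d \<and> (seg1 c i, seg2 d j) \<in> X \<and>
                  \<not> long_pair (seg1 c i) (seg2 d j)}"

lemma finite_cells: "finite (cells c d)"
  by (rule finite_subset[of _ "{..<len1 c} \<times> {..<len2 d}"]) (auto simp: cells_def)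

lemma card_ends: "card (otgt ` X - osrc ` X) \<le> C" "card (osrc ` X - otgt ` X) \<le> C"
  using excess_bound card_image_le[OF finX, of otgt] sources by (auto simp: C_def)

text \<open>A broken diagonal is determined by the first dead end ahead of the cell and its distance.\<close>

lemma card_broken_ahead:
  assumes cd: "c \<in> J1" "d \<in> J2"
  shows "card {(i, j) \<in> cells c d. \<exists>t. i + t < len1 c \<and> j + t < len2 d \<and>
                 (seg1 c (i + t), seg2 d (j + t)) \<notin> X} \<le> C * len2 d" (is "card ?A \<le> _")
proof -
  define Q where "Q = (\<lambda>(i, j) t. i + t < len1 c \<and> j + t < len2 d \<and> (seg1 c (i + t), seg2 d (j + t)) \<notin> X)"
  define \<tau> where "\<tau> x = (LEAST t. Q x t)" for x
  define F where "F = (\<lambda>(i, j). ((src1 (seg1 c (i + \<tau> (i, j))), src2 (seg2 d (j + \<tau> (i, j)))), \<tau> (i, j)))"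
  have \<tau>: "Q x (\<tau> x)" "0 < \<tau> x" "\<not> Q x (\<tau> x - 1)" if "x \<in> ?A" for x
  proof -
    have "\<exists>t. Q x t" using that by (auto simp: Q_def)
    then show "Q x (\<tau> x)" unfolding \<tau>_def by (rule LeastI_ex)
    moreover have "\<not> Q x 0" using that by (auto simp: Q_def cells_def)
    ultimately show *: "0 < \<tau> x" by (metis gr0I)
    show "\<not> Q x (\<tau> x - 1)" using * not_less_Least[of "\<tau> x - 1" "Q x"] by (simp add: \<tau>_def)
  qed
  have "inj_on F ?A"
  proof (rule inj_onI)
    fix x x' assume x: "x \<in> ?A" "x' \<in> ?A" "F x = F x'"
    obtain i j i' j' where xx: "x = (i, j)" "x' = (i', j')" by (metis surj_pair)
    obtain s where s: "\<tau> (i, j) = Suc s" "\<tau> (i', j') = Suc s"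
      using \<tau>(2)[OF x(1)] x(3) by (auto simp: F_def xx gr0_conv_Suc)
    have lt: "Suc (i + s) < len1 c" "Suc (j + s) < len2 d" "Suc (i' + s) < len1 c" "Suc (j' + s) < len2 d"
      using \<tau>(1)[OF x(1)] \<tau>(1)[OF x(2)] s by (auto simp: xx Q_def)
    have "src1 (seg1 c (Suc (i + s))) = src1 (seg1 c (Suc (i' + s)))"
      "src2 (seg2 d (Suc (j + s))) = src2 (seg2 d (Suc (j' + s)))"
      using x(3) s by (simp_all add: F_def xx)
    then have "seg1 c (Suc (i + s)) = seg1 c (Suc (i' + s))" "seg2 d (Suc (j + s)) = seg2 d (Suc (j' + s))"
      using G.seg_out[OF cd(1) lt(3) G.seg_in[OF cd(1) lt(1)]]
        H.seg_out[OF cd(2) lt(4) H.seg_in[OF cd(2) lt(2)]] by simp_all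
    then show "x = x'"
      using G.seg_inj[OF cd(1,1) lt(1,3)] H.seg_inj[OF cd(2,2) lt(2,4)] by (simp add: xx)
  qed
  moreover have "F ` ?A \<subseteq> (otgt ` X - osrc ` X) \<times> {..<len2 d}"
  proof
    fix y assume "y \<in> F ` ?A"
    then obtain i j where x: "(i, j) \<in> ?A" "y = F (i, j)" by auto
    obtain s where s: "\<tau> (i, j) = Suc s" using \<tau>(2)[OF x(1)] by (auto simp: gr0_conv_Suc)
    have lt: "Suc (i + s) < len1 c" "Suc (j + s) < len2 d"
      and nX: "(seg1 c (Suc (i + s)), seg2 d (Suc (j + s))) \<notin> X"
      and inX: "(seg1 c (i + s), seg2 d (j + s)) \<in> X"
      using \<tau>(1,3)[OF x(1)] s by (auto simp: Q_def)
    define z where "z = (src1 (seg1 c (Suc (i + s))), src2 (seg2 d (Suc (j + s))))"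
    have "z = otgt (seg1 c (i + s), seg2 d (j + s))"
      using G.seg_next[OF cd(1) lt(1)] H.seg_next[OF cd(2) lt(2)] by (simp add: z_def)
    then have "z \<in> otgt ` X" using inX by (rule image_eqI)
    \<comment> \<open>Both coordinates of \<open>z\<close> are inner vertices, so the missing cell
      is the only edge that could leave \<open>z\<close>.\<close>
    moreover have "z \<notin> osrc ` X"
    proof
      assume "z \<in> osrc ` X"
      then obtain e f where ef: "(e, f) \<in> X" "src1 e = fst z" "src2 f = snd z"
        by (auto simp: image_iff)
      then have "e = seg1 c (Suc (i + s))" "f = seg2 d (Suc (j + s))"
        using G.seg_out[OF cd(1) lt(1)] H.seg_out[OF cd(2) lt(2)] X_sub by (auto simp: z_def)
      then show False using ef nX by simp
    qed
    moreover have "y = (z, Suc s)" by (simp add: x(2) F_def s z_def)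
    ultimately show "y \<in> (otgt ` X - osrc ` X) \<times> {..<len2 d}" using lt by simp
  qed
  ultimately have "card ?A \<le> card ((otgt ` X - osrc ` X) \<times> {..<len2 d})"
    using finX by (intro card_inj_on_le[of F]) auto
  also have "\<dots> \<le> C * len2 d" using card_ends(1) by (simp add: card_cartesian_product)
  finally show ?thesis .
qed

text \<open>The mirror image: the vertex between the nearest missing cell behind and its successor
  has no incoming edge in \<open>X\<close>. Unique predecessors now give injectivity, and
  \<open>sources\<close> bounds the number of such vertices.\<close>

lemma card_broken_behind:
  assumes cd: "c \<in> J1" "d \<in> J2"
  shows "card {(i, j) \<in> cells c d. \<exists>t\<le>min i j. (seg1 c (i - t), seg2 d (j - t)) \<notin> X} \<le> C * len2 d"
    (is "card ?A \<le> _")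
proof -
  define Q where "Q = (\<lambda>(i, j) t. t \<le> min i j \<and> (seg1 c (i - t), seg2 d (j - t)) \<notin> X)"
  define \<tau> where "\<tau> x = (LEAST t. Q x t)" for x
  define F where "F = (\<lambda>(i, j). ((tgt1 (seg1 c (i - \<tau> (i, j))), tgt2 (seg2 d (j - \<tau> (i, j)))), \<tau> (i, j)))"
  have \<tau>: "Q x (\<tau> x)" "0 < \<tau> x" "\<not> Q x (\<tau> x - 1)" if "x \<in> ?A" for x
  proof -
    have "\<exists>t. Q x t" using that by (auto simp: Q_def)
    then show "Q x (\<tau> x)" unfolding \<tau>_def by (rule LeastI_ex)
    moreover have "\<not> Q x 0" using that by (auto simp: Q_def cells_def)
    ultimately show *: "0 < \<tau> x" by (metis gr0I)
    show "\<not> Q x (\<tau> x - 1)" using * not_less_Least[of "\<tau> x - 1" "Q x"] by (simp add: \<tau>_def)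
  qed
  have split: "\<exists>k l s. \<tau> (i, j) = Suc s \<and> i = Suc (k + s) \<and> j = Suc (l + s) \<and> i < len1 c \<and> j < len2 d"
    if ij: "(i, j) \<in> ?A" for i j
  proof -
    obtain s where s: "\<tau> (i, j) = Suc s" using \<tau>(2)[OF ij] by (auto simp: gr0_conv_Suc)
    then have "Suc s \<le> i" "Suc s \<le> j" using \<tau>(1)[OF ij] by (auto simp: Q_def)
    then have "i = Suc ((i - Suc s) + s)" "j = Suc ((j - Suc s) + s)" by simp_all
    then show ?thesis using s ij by (auto simp: cells_def)
  qed
  have "inj_on F ?A"
  proof (rule inj_onI)
    fix x x' assume x: "x \<in> ?A" "x' \<in> ?A" "F x = F x'"
    obtain i j i' j' where xx: "x = (i, j)" "x' = (i', j')" by (metis surj_pair)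
    obtain k l s where s: "\<tau> (i, j) = Suc s" "i = Suc (k + s)" "j = Suc (l + s)" "i < len1 c" "j < len2 d"
      using split x(1) xx by blast
    obtain k' l' s' where s': "\<tau> (i', j') = Suc s'" "i' = Suc (k' + s')" "j' = Suc (l' + s')" "i' < len1 c" "j' < len2 d"
      using split x(2) xx by blast
    have ss: "s' = s" using x(3) s(1) s'(1) by (simp add: F_def xx)
    have diff: "i - Suc s = k" "j - Suc s = l" "i' - Suc s = k'" "j' - Suc s = l'"
      using s(2,3) s'(2,3) ss by simp_all
    have lt: "Suc k < len1 c" "Suc l < len2 d" "Suc k' < len1 c" "Suc l' < len2 d" using s s' by auto
    have "tgt1 (seg1 c k) = tgt1 (seg1 c k')" "tgt2 (seg2 d l) = tgt2 (seg2 d l')"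
      using x(3) by (simp_all add: F_def xx s(1) s'(1) ss diff)
    then have "seg1 c k = seg1 c k'" "seg2 d l = seg2 d l'"
      using G.seg_inn[OF cd(1) lt(3), of "seg1 c k"] H.seg_inn[OF cd(2) lt(4), of "seg2 d l"]
        G.seg_next[OF cd(1) lt(3)] H.seg_next[OF cd(2) lt(4)] G.seg_in[OF cd(1)] H.seg_in[OF cd(2)] lt
      by simp_all
    then have "k = k'" "l = l'"
      using G.seg_inj[OF cd(1,1), of k k'] H.seg_inj[OF cd(2,2), of l l'] lt by simp_all
    then show "x = x'" using s s' ss by (simp add: xx)
  qed
  moreover have "F ` ?A \<subseteq> (osrc ` X - otgt ` X) \<times> {..<len2 d}"
  proof
    fix y assume "y \<in> F ` ?A"
    then obtain i j where x: "(i, j) \<in> ?A" "y = F (i, j)" by auto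
    obtain k l s where s: "\<tau> (i, j) = Suc s" "i = Suc (k + s)" "j = Suc (l + s)" "i < len1 c" "j < len2 d"
      using split x(1) by blast
    have lt: "Suc k < len1 c" "Suc l < len2 d" using s by auto
    have nX: "(seg1 c k, seg2 d l) \<notin> X" and inX: "(seg1 c (Suc k), seg2 d (Suc l)) \<in> X"
      using \<tau>(1,3)[OF x(1)] s by (auto simp: Q_def Suc_diff_le)
    define z where "z = (tgt1 (seg1 c k), tgt2 (seg2 d l))"
    have "z = osrc (seg1 c (Suc k), seg2 d (Suc l))"
      using G.seg_next[OF cd(1) lt(1)] H.seg_next[OF cd(2) lt(2)] by (simp add: z_def)
    then have "z \<in> osrc ` X" using inX by (rule image_eqI)
    moreover have "z \<notin> otgt ` X"
    proof
      assume "z \<in> otgt ` X"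
      then obtain e f where ef: "(e, f) \<in> X" "tgt1 e = fst z" "tgt2 f = snd z"
        by (auto simp: image_iff)
      have "e \<in> E1" "f \<in> E2" using X_sub[OF ef(1)] by simp_all
      moreover have "tgt1 e = src1 (seg1 c (Suc k))" "tgt2 f = src2 (seg2 d (Suc l))"
        using ef(2,3) G.seg_next[OF cd(1) lt(1)] H.seg_next[OF cd(2) lt(2)] by (simp_all add: z_def)
      ultimately have "e = seg1 c k" "f = seg2 d l"
        using G.seg_inn[OF cd(1) lt(1), of e] H.seg_inn[OF cd(2) lt(2), of f] by blast+
      then show False using ef nX by simp
    qed
    moreover have "i - Suc s = k" "j - Suc s = l" using s by simp_all
    then have "y = (z, Suc s)" by (simp add: x(2) F_def s(1) z_def)
    ultimately show "y \<in> (osrc ` X - otgt ` X) \<times> {..<len2 d}" using s by simp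
  qed
  ultimately have "card ?A \<le> card ((osrc ` X - otgt ` X) \<times> {..<len2 d})"
    using finX by (intro card_inj_on_le[of F]) auto
  also have "\<dots> \<le> C * len2 d" using card_ends(2) by (simp add: card_cartesian_product)
  finally show ?thesis .
qed

text \<open>The rectangle is sliced along the longer segment. \<open>fibre_bound\<close> is applied
  in each slice to \<open>i \<le> j\<close> and to \<open>j < i\<close>, whence 34 as twice
  17.\<close>

lemma card_middle:
  assumes cd: "c \<in> J1" "d \<in> J2" "len2 d \<le> len1 c"
  shows "card {(i, j) \<in> cells c d. full_diag c d i j \<and> min i j < ahead c d i j \<and>
                 ahead c d i j \<le> 3 * min i j + 3} \<le> len1 c * (34 * C)" (is "card ?M \<le> _")
proof -
  define B where "B i = {j. (i, j) \<in> ?M}" for i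
  have B: "card (B i) \<le> 34 * C" if i: "i < len1 c" for i
  proof -
    have "card {j \<in> B i. i \<le> j} \<le> 17 * C" "card {j \<in> B i. j < i} \<le> 17 * C"
      by (rule fibre_bound[OF cd(1) i cd(2,3)]; auto simp: B_def cells_def)+
    moreover have "card (B i) = card ({j \<in> B i. i \<le> j} \<union> {j \<in> B i. j < i})"
      by (rule arg_cong[where f = card]) auto
    ultimately show ?thesis
      using card_Un_le[of "{j \<in> B i. i \<le> j}" "{j \<in> B i. j < i}"] by linarith
  qed
  have finB: "finite (B i)" for i
    by (rule finite_subset[of _ "{..<len2 d}"]) (auto simp: B_def cells_def)
  have "card ?M = card (SIGMA i:{..<len1 c}. B i)"
    by (rule arg_cong[where f = card]) (auto simp: B_def cells_def)
  also have "\<dots> = (\<Sum>i<len1 c. card (B i))" using finB by simp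
  also have "\<dots> \<le> (\<Sum>i<len1 c. 34 * C)" using B by (intro sum_mono) simp
  finally show ?thesis by simp
qed

text \<open>Position \<open>b\<close> on a diagonal of length \<open>l\<close> is sent to the middle position \<open>l div 4 + b div 4\<close>.\<close>

lemma card_full:
  assumes cd: "c \<in> J1" "d \<in> J2"
  shows "card {(i, j) \<in> cells c d. full_diag c d i j} \<le>
         4 * card {(i, j) \<in> cells c d. full_diag c d i j \<and> min i j < ahead c d i j \<and>
                 ahead c d i j \<le> 3 * min i j + 3}" (is "card ?A \<le> 4 * card ?M")
proof -
  define l where "l i j = min i j + ahead c d i j" for i j
  define s where "s i j = l i j div 4 + min i j div 4" for i j
  \<comment> \<open>The residue restores what the division of \<open>min i j\<close> by 4 forgets;
    it is the source of the factor 4.\<close>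
  define F where "F = (\<lambda>(i, j). ((i - min i j + s i j, j - min i j + s i j), min i j mod 4))"
  \<comment> \<open>With \<open>s\<close> cells behind and \<open>l - s\<close> ahead, these two
    bounds are exactly the conditions that define the middle part.\<close>
  have arith: "2 * (l div 4 + b div 4) < l \<and> l \<le> 4 * (l div 4 + b div 4) + 3" if "b < l" for b l :: nat
  proof -
    define x y where "x = l div 4" and "y = b div 4"
    have "y \<le> x" "4 * x \<le> l" "4 * y \<le> b" "l < 4 * x + 4"
      using that by (simp_all add: x_def y_def div_le_mono)
    then have "2 * (x + y) < l" "l \<le> 4 * (x + y) + 3" using that by (cases "y < x", simp_all)
    then show ?thesis by (simp add: x_def y_def)
  qed
  have F: "i' < len1 c" "j' < len2 d" "i' + j = i + j'" "min i' j' = s i j" "l i' j' = l i j"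
      "min i' j' < ahead c d i' j'" "ahead c d i' j' \<le> 3 * min i' j' + 3"
    if "i < len1 c" "j < len2 d" "i' = i - min i j + s i j" "j' = j - min i j + s i j" for i j i' j'
  proof -
    have "min i j < l i j" using that by (simp add: l_def ahead_def)
    from arith[OF this] have a: "2 * s i j < l i j" "l i j \<le> 4 * s i j + 3" by (auto simp: s_def)
    show 1: "min i' j' = s i j" using that by (auto simp: min_def)
    show 2: "i' + j = i + j'" using that by (auto simp: min_def)
    have l: "l i j = min (len1 c - (i - min i j)) (len2 d - (j - min i j))"
      using that by (auto simp: l_def ahead_def min_def)
    then have "s i j < len1 c - (i - min i j)" "s i j < len2 d - (j - min i j)" using a by simp_all
    then show "i' < len1 c" "j' < len2 d"
      unfolding that(3,4) less_diff_conv by (simp_all only: add.commute)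
    have "ahead c d i' j' = min (len1 c - (i - min i j) - s i j) (len2 d - (j - min i j) - s i j)"
      by (simp add: ahead_def that(3,4))
    also have "\<dots> = l i j - s i j" by (simp only: l min_diff)
    finally have "ahead c d i' j' = l i j - s i j" .
    then show "l i' j' = l i j" "min i' j' < ahead c d i' j'" "ahead c d i' j' \<le> 3 * min i' j' + 3"
      using 1 a by (simp_all add: l_def)
  qed
  have "inj_on F ?A"
  proof (rule inj_onI)
    fix x x' assume x: "x \<in> ?A" "x' \<in> ?A" "F x = F x'"
    obtain i j i' j' where xx: "x = (i, j)" "x' = (i', j')" by (metis surj_pair)
    have lt: "i < len1 c" "j < len2 d" "i' < len1 c" "j' < len2 d"
      using x by (auto simp: xx cells_def)
    have eq: "i - min i j + s i j = i' - min i' j' + s i' j'" "j - min i j + s i j = j' - min i' j' + s i' j'"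
      "min i j mod 4 = min i' j' mod 4"
      using x(3) by (simp_all add: F_def xx)
    have "s i j = s i' j'" "l i j = l i' j'"
      using F(4,5)[OF lt(1,2) refl refl] F(4,5)[OF lt(3,4) refl refl] eq by metis+
    then have "min i j div 4 = min i' j' div 4" by (simp add: s_def)
    then have "min i j = min i' j'" using eq(3) by (metis div_mult_mod_eq)
    then show "x = x'" using eq \<open>s i j = s i' j'\<close> by (auto simp: xx min_def split: if_splits)
  qed
  moreover have "F ` ?A \<subseteq> ?M \<times> {..<4}"
  proof
    fix y assume "y \<in> F ` ?A"
    then obtain i j where x: "(i, j) \<in> ?A" "y = F (i, j)" by auto
    have lt: "i < len1 c" "j < len2 d" using x by (auto simp: cells_def)
    define i' j' where "i' = i - min i j + s i j" and "j' = j - min i j + s i j"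
    note F' = F[OF lt i'_def j'_def]
    have full: "full_diag c d i' j'"
      using x F'(3) unfolding full_diag_def by auto
    then have "(seg1 c i', seg2 d j') \<in> X" using F'(1,2) by (simp add: full_diag_def)
    moreover have "\<not> long_pair (seg1 c i') (seg2 d j')"
      using long_pair_diag[OF _ cd, of i' j' i j] F'(1-3) lt x by (auto simp: cells_def)
    ultimately have "(i', j') \<in> ?M" using F' full by (simp add: cells_def)
    moreover have "y = ((i', j'), min i j mod 4)" by (simp add: x(2) F_def i'_def j'_def)
    ultimately show "y \<in> ?M \<times> {..<4}" by simp
  qed
  moreover have "finite ?M" using finite_cells by (rule finite_subset[rotated]) auto
  ultimately have "card ?A \<le> card (?M \<times> {..<4::nat})" by (intro card_inj_on_le[of F]) auto
  then show ?thesis by (simp add: card_cartesian_product)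
qed

text \<open>A diagonal is full, broken ahead or broken behind. The three counts add up to
  \<open>136 * C * len1 c + 2 * C * len2 d\<close>.\<close>

lemma card_cells_le:
  assumes cd: "c \<in> J1" "d \<in> J2" "len2 d \<le> len1 c"
  shows "card (cells c d) \<le> 508 * C * (len1 c + len2 d)"
proof -
  let ?A = "{(i, j) \<in> cells c d. \<exists>t. i + t < len1 c \<and> j + t < len2 d \<and> (seg1 c (i + t), seg2 d (j + t)) \<notin> X}"
  let ?B = "{(i, j) \<in> cells c d. \<exists>t\<le>min i j. (seg1 c (i - t), seg2 d (j - t)) \<notin> X}"
  let ?F = "{(i, j) \<in> cells c d. full_diag c d i j}"
  have "(i, j) \<in> ?A \<union> ?B \<union> ?F" if ij: "(i, j) \<in> cells c d" for i j
  proof (rule ccontr)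
    assume none: "(i, j) \<notin> ?A \<union> ?B \<union> ?F"
    then have x: "(i, j) \<in> cells c d" "(i, j) \<notin> ?F" "(i, j) \<notin> ?B" using ij by blast+
    obtain i' j' where ij: "i' < len1 c" "j' < len2 d" "i' + j = i + j'" "(seg1 c i', seg2 d j') \<notin> X"
      using x unfolding full_diag_def by blast
    have "(i, j) \<in> ?A"
    proof (cases "i \<le> i'")
      case True
      then have "i' = i + (i' - i)" "j' = j + (i' - i)" using ij by linarith+
      then show ?thesis using x ij by (auto intro!: exI[of _ "i' - i"])
    next
      case False
      then have "i' = i - (i - i')" "j' = j - (i - i')" "i - i' \<le> min i j" using ij by linarith+
      then show ?thesis using x ij by auto
    qed
    then show False using none by blast
  qed
  then have "cells c d \<subseteq> ?A \<union> ?B \<union> ?F" by (rule subrelI)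
  then have "card (cells c d) \<le> card (?A \<union> ?B \<union> ?F)"
    using finite_cells by (intro card_mono) (auto intro: finite_subset[OF _ finite_cells[of c d]])
  also have "\<dots> \<le> card ?A + card ?B + card ?F"
    by (meson add_le_mono1 card_Un_le le_trans)
  also have "\<dots> \<le> C * len2 d + C * len2 d + 4 * (len1 c * (34 * C))"
    using card_broken_ahead[OF cd(1,2)] card_broken_behind[OF cd(1,2)] card_full[OF cd(1,2)]
      card_middle[OF cd] by linarith
  also have "\<dots> \<le> 508 * C * (len1 c + len2 d)" by (simp add: algebra_simps)
  finally show ?thesis .
qed

text \<open>Slicing requires \<open>c\<close> to be the longer segment. The other case follows by
  exchanging the two graphs, since \<open>C\<close> and \<open>long_pair\<close> are
  symmetric.\<close>

lemma card_cells:
  assumes cd: "c \<in> J1" "d \<in> J2"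
  shows "card (cells c d) \<le> 508 * C * (len1 c + len2 d)"
proof (cases "len2 d \<le> len1 c")
  case True
  then show ?thesis using card_cells_le[OF cd] by simp
next
  case False
  interpret sw: seg_pair E2 src2 tgt2 lab2 J2 len2 seg2 E1 src1 tgt1 lab1 J1 len1 seg1 "prod.swap ` X" N0
  proof
    fix f e assume "(f, e) \<in> prod.swap ` X"
    then show "f \<in> E2 \<and> e \<in> E1 \<and> lab2 f = lab1 e" using X_sub[of e f] by auto
  next
    have 1: "map_prod src2 src1 ` prod.swap ` X = prod.swap ` osrc ` X"
      and 2: "map_prod tgt2 tgt1 ` prod.swap ` X = prod.swap ` otgt ` X"
      by (auto simp: image_image prod.swap_def)
    have "map_prod src2 src1 ` prod.swap ` X - map_prod tgt2 tgt1 ` prod.swap ` X =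
        prod.swap ` (osrc ` X - otgt ` X)"
      unfolding 1 2 by (rule image_set_diff[symmetric]) simp
    then show "card (map_prod src2 src1 ` prod.swap ` X - map_prod tgt2 tgt1 ` prod.swap ` X) \<le> N0"
      using sources by (simp add: card_image)
  qed
  have lp: "sw.long_pair f e \<longleftrightarrow> long_pair e f" for e f
  proof
    assume "sw.long_pair f e"
    then obtain h g N p t where *: "0 < N" "H.inf_walk h" "G.inf_walk g"
      "\<forall>t. h (t + N) = h t" "\<forall>t. g (t + N) = g t" "\<forall>t. lab2 (h t) = lab1 (g t)"
      "min_period p (\<lambda>t. lab2 (h t))"
      "\<forall>k>0. (\<forall>t. h (t + k) = h t) \<longrightarrow> 12 * card J2 * p \<le> k"
      "\<forall>k>0. (\<forall>t. g (t + k) = g t) \<longrightarrow> 12 * card J1 * p \<le> k"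
      "f = h t" "e = g t"
      unfolding sw.long_pair_def by (elim exE conjE) (rule that; assumption)
    have labs: "\<forall>t. lab1 (g t) = lab2 (h t)" using *(6) by simp
    then have "(\<lambda>t. lab1 (g t)) = (\<lambda>t. lab2 (h t))" by (simp add: fun_eq_iff)
    with *(7) have "min_period p (\<lambda>t. lab1 (g t))" by simp
    with * labs show "long_pair e f"
      unfolding long_pair_def
      by (intro exI[of _ g] exI[of _ h] exI[of _ N] exI[of _ p] exI[of _ t] conjI)
  next
    assume "long_pair e f"
    then obtain g h N p t where *: "0 < N" "G.inf_walk g" "H.inf_walk h"
      "\<forall>t. g (t + N) = g t" "\<forall>t. h (t + N) = h t" "\<forall>t. lab1 (g t) = lab2 (h t)"
      "min_period p (\<lambda>t. lab1 (g t))"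
      "\<forall>k>0. (\<forall>t. g (t + k) = g t) \<longrightarrow> 12 * card J1 * p \<le> k"
      "\<forall>k>0. (\<forall>t. h (t + k) = h t) \<longrightarrow> 12 * card J2 * p \<le> k"
      "e = g t" "f = h t"
      unfolding long_pair_def by (elim exE conjE) (rule that; assumption)
    have labs: "\<forall>t. lab2 (h t) = lab1 (g t)" using *(6) by simp
    then have "(\<lambda>t. lab2 (h t)) = (\<lambda>t. lab1 (g t))" by (simp add: fun_eq_iff)
    with *(7) have "min_period p (\<lambda>t. lab2 (h t))" by simp
    with * labs show "sw.long_pair f e"
      unfolding sw.long_pair_def
      by (intro exI[of _ h] exI[of _ g] exI[of _ N] exI[of _ p] exI[of _ t] conjI)
  qed
  have swX: "(f, e) \<in> prod.swap ` X \<longleftrightarrow> (e, f) \<in> X" for e f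
    by (metis image_iff pair_in_swap_image)
  have "cells c d = prod.swap ` sw.cells d c"
    by (auto simp: cells_def sw.cells_def lp swX)
  then have "card (cells c d) = card (sw.cells d c)" by (simp add: card_image)
  also have "\<dots> \<le> 508 * sw.C * (len2 d + len1 c)" using False cd by (intro sw.card_cells_le) auto
  also have "sw.C = C" by (simp add: C_def sw.C_def mult.commute)
  finally show ?thesis by (simp add: add.commute)
qed

text \<open>In the sum of \<open>len1 c + len2 d\<close> over all rectangles each length occurs once
  per segment of the other graph; this is the origin of the two mixed products.\<close>

theorem card_not_long:
  "card {(e, f) \<in> X. \<not> long_pair e f} \<le> 508 * C * (card J2 * card E1 + card J1 * card E2)"
proof -
  let ?Y = "{(e, f) \<in> X. \<not> long_pair e f}"
  have "?Y \<subseteq> (\<Union>(c, d)\<in>J1 \<times> J2. (\<lambda>(i, j). (seg1 c i, seg2 d j)) ` cells c d)"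
  proof clarify
    fix e f assume ef: "(e, f) \<in> X" "\<not> long_pair e f"
    then obtain c i d j where "c \<in> J1" "i < len1 c" "e = seg1 c i" "d \<in> J2" "j < len2 d" "f = seg2 d j"
      using X_sub[OF ef(1)] G.seg_cover[of e] H.seg_cover[of f] by blast
    then show "(e, f) \<in> (\<Union>(c, d)\<in>J1 \<times> J2. (\<lambda>(i, j). (seg1 c i, seg2 d j)) ` cells c d)"
      using ef by (intro UN_I[of "(c, d)"]) (auto simp: cells_def)
  qed
  then have "card ?Y \<le> card (\<Union>(c, d)\<in>J1 \<times> J2. (\<lambda>(i, j). (seg1 c i, seg2 d j)) ` cells c d)"
    using G.finJ H.finJ finite_cells by (intro card_mono) auto
  also have "\<dots> \<le> (\<Sum>x\<in>J1 \<times> J2. card (case x of (c, d) \<Rightarrow> (\<lambda>(i, j). (seg1 c i, seg2 d j)) ` cells c d))"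
    using G.finJ H.finJ by (intro card_UN_le) simp
  also have "\<dots> \<le> (\<Sum>(c, d)\<in>J1 \<times> J2. 508 * C * (len1 c + len2 d))"
  proof (rule sum_mono, clarify)
    fix c d assume cd: "c \<in> J1" "d \<in> J2"
    have "card ((\<lambda>(i, j). (seg1 c i, seg2 d j)) ` cells c d) \<le> card (cells c d)"
      using finite_cells by (rule card_image_le)
    also have "\<dots> \<le> 508 * C * (len1 c + len2 d)" using cd by (rule card_cells)
    finally show "card ((\<lambda>(i, j). (seg1 c i, seg2 d j)) ` cells c d) \<le> 508 * C * (len1 c + len2 d)" .
  qed
  also have "\<dots> = 508 * C * (card J2 * (\<Sum>c\<in>J1. len1 c) + card J1 * (\<Sum>d\<in>J2. len2 d))"
    by (simp add: sum.cartesian_product[symmetric] sum_distrib_left[symmetric] sum.distrib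
        distrib_left sum_distrib_right[symmetric] mult.commute)
  also have "\<dots> \<le> 508 * C * (card J2 * card E1 + card J1 * card E2)"
    using G.sum_len_le H.sum_len_le by (intro mult_le_mono add_le_mono) auto
  finally show ?thesis .
qed

end

section \<open>Maximal unbranched segments\<close>

text \<open>Only the arcs of a bar edge are kept, since its vertices are their tails and heads.
  Paths and cycles can thus be compared arc by arc.\<close>

definition chain :: "('v, 'e) pre_digraph \<Rightarrow> nat \<Rightarrow> (nat \<Rightarrow> 'e) \<Rightarrow> bool" where
  "chain G n f \<longleftrightarrow> 0 < n \<and> (\<forall>i<n. f i \<in> arcs G) \<and> inj_on f {..<n} \<and>
     (\<forall>i. Suc i < n \<longrightarrow> head G (f i) = tail G (f (Suc i)) \<and> tail G (f (Suc i)) \<notin> branch_verts G)"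

definition open_chain :: "('v, 'e) pre_digraph \<Rightarrow> nat \<Rightarrow> (nat \<Rightarrow> 'e) \<Rightarrow> bool" where
  "open_chain G n f \<longleftrightarrow> chain G n f \<and> tail G (f 0) \<in> branch_verts G \<and> head G (f (n - 1)) \<in> branch_verts G"

definition closed_chain :: "('v, 'e) pre_digraph \<Rightarrow> nat \<Rightarrow> (nat \<Rightarrow> 'e) \<Rightarrow> bool" where
  "closed_chain G n f \<longleftrightarrow> chain G n f \<and> head G (f (n - 1)) = tail G (f 0) \<and> tail G (f 0) \<notin> branch_verts G"

context fin_digraph begin

lemma unbranched_in:
  assumes "e \<in> arcs G" "e' \<in> arcs G" "head G e = head G e'" "head G e \<notin> branch_verts G"
  shows "e = e'"
proof -
  have "card (in_arcs G (head G e)) = 1"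
    using assms by (auto simp: branch_verts_def in_degree_def)
  then obtain x where "in_arcs G (head G e) = {x}" by (rule card_1_singletonE)
  moreover have "e \<in> in_arcs G (head G e)" "e' \<in> in_arcs G (head G e)" using assms by auto
  ultimately have "e \<in> {x}" "e' \<in> {x}" by metis+
  then show ?thesis by simp
qed

lemma unbranched_out:
  assumes "e \<in> arcs G" "e' \<in> arcs G" "tail G e = tail G e'" "tail G e \<notin> branch_verts G"
  shows "e = e'"
proof -
  have "card (out_arcs G (tail G e)) = 1"
    using assms by (auto simp: branch_verts_def out_degree_def)
  then obtain x where "out_arcs G (tail G e) = {x}" by (rule card_1_singletonE)
  moreover have "e \<in> out_arcs G (tail G e)" "e' \<in> out_arcs G (tail G e)" using assms by auto
  ultimately have "e \<in> {x}" "e' \<in> {x}" by metis+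
  then show ?thesis by simp
qed

lemma unbranched_ex_in:
  assumes "v \<in> verts G" "v \<notin> branch_verts G"
  obtains e where "e \<in> arcs G" "head G e = v"
proof -
  have "card (in_arcs G v) = 1" using assms by (auto simp: branch_verts_def in_degree_def)
  then obtain x where "in_arcs G v = {x}" by (rule card_1_singletonE)
  then have "x \<in> in_arcs G v" by simp
  then show thesis using that by auto
qed

lemma unbranched_ex_out:
  assumes "v \<in> verts G" "v \<notin> branch_verts G"
  obtains e where "e \<in> arcs G" "tail G e = v"
proof -
  have "card (out_arcs G v) = 1" using assms by (auto simp: branch_verts_def out_degree_def)
  then obtain x where "out_arcs G v = {x}" by (rule card_1_singletonE)
  then have "x \<in> out_arcs G v" by simp
  then show thesis using that by auto
qed

text \<open>A chain of maximal length through an arc can be extended at neither end.\<close>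

lemma chain_through_arc:
  assumes e: "e \<in> arcs G"
  obtains n f i where "open_chain G n f \<or> closed_chain G n f" "i < n" "f i = e"
proof -
  define P where "P n \<longleftrightarrow> (\<exists>f i. chain G n f \<and> i < n \<and> f i = e)" for n
  have "P 1" using e by (auto simp: P_def chain_def inj_on_def)
  moreover have "n \<le> card (arcs G)" if Pn: "P n" for n
  proof -
    obtain f where "chain G n f" using Pn by (auto simp: P_def)
    then have "inj_on f {..<n}" "f ` {..<n} \<subseteq> arcs G" by (auto simp: chain_def)
    then have "card {..<n} \<le> card (arcs G)" by (intro card_inj_on_le) auto
    then show ?thesis by simp
  qed
  ultimately have "\<exists>n. P n \<and> (\<forall>m. P m \<longrightarrow> m \<le> n)"
    using ex_has_greatest_nat[of P 1 id "card (arcs G) + 1"] by (auto simp: less_Suc_eq_le)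
  then obtain n where "P n" and max: "\<And>m. P m \<Longrightarrow> m \<le> n" by blast
  then obtain f i where f: "chain G n f" and i: "i < n" "f i = e" by (auto simp: P_def)
  have n0: "0 < n" and fa: "\<And>i. i < n \<Longrightarrow> f i \<in> arcs G" and inj: "inj_on f {..<n}"
    and nxt: "\<And>i. Suc i < n \<Longrightarrow> head G (f i) = tail G (f (Suc i))"
    and nb: "\<And>i. Suc i < n \<Longrightarrow> tail G (f (Suc i)) \<notin> branch_verts G"
    using f by (auto simp: chain_def)
  show thesis
  proof (cases "tail G (f 0) \<in> branch_verts G")
    case False
    obtain p where p: "p \<in> arcs G" "head G p = tail G (f 0)"
      using unbranched_ex_in[OF tail_in_verts[OF fa[OF n0]] False] by blast
    have "p \<in> f ` {..<n}"
    proof (rule ccontr)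
      assume np: "p \<notin> f ` {..<n}"
      define f' where "f' i = (case i of 0 \<Rightarrow> p | Suc i \<Rightarrow> f i)" for i
      have "chain G (Suc n) f'"
        unfolding chain_def
      proof (intro conjI allI impI)
        show "f' i \<in> arcs G" if "i < Suc n" for i using that p fa by (auto simp: f'_def split: nat.split)
        show "inj_on f' {..<Suc n}"
          using inj np by (auto simp: inj_on_def f'_def split: nat.splits)
        show "head G (f' i) = tail G (f' (Suc i))" if "Suc i < Suc n" for i
          using that nxt p by (cases i) (auto simp: f'_def)
        show "tail G (f' (Suc i)) \<notin> branch_verts G" if "Suc i < Suc n" for i
          using that nb False by (cases i) (auto simp: f'_def)
      qed simp
      moreover have "f' (Suc i) = e" using i by (simp add: f'_def)
      ultimately have "P (Suc n)" using i(1) unfolding P_def by blast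
      then show False using max by fastforce
    qed
    then obtain j where j: "j < n" "p = f j" by auto
    \<comment> \<open>Otherwise \<open>f (Suc j)\<close> and \<open>f 0\<close> would both leave the
      same unbranched vertex.\<close>
    have "j = n - 1"
    proof (rule ccontr)
      assume "j \<noteq> n - 1"
      then have "Suc j < n" using j by linarith
      then have "f (Suc j) = f 0" using nxt[of j] nb[of j] fa[of "Suc j"] fa[of 0] j p n0
          by (intro unbranched_out) auto
      then show False using inj_onD[OF inj, of "Suc j" 0] \<open>Suc j < n\<close> n0 by simp
    qed
    then have "closed_chain G n f" using f p j False by (simp add: closed_chain_def)
    then show thesis using that i by blast
  next
    case True
    have "head G (f (n - 1)) \<in> branch_verts G"
    proof (rule ccontr)
      assume nbh: "head G (f (n - 1)) \<notin> branch_verts G"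
      have "n - 1 < n" using n0 by simp
      from unbranched_ex_out[OF head_in_verts[OF fa[OF this]] nbh]
      obtain p where p: "p \<in> arcs G" "tail G p = head G (f (n - 1))" by blast
      have "p \<in> f ` {..<n}"
      proof (rule ccontr)
        assume np: "p \<notin> f ` {..<n}"
        define f' where "f' = f(n := p)"
        have "chain G (Suc n) f'"
          unfolding chain_def
        proof (intro conjI allI impI)
          show "f' i \<in> arcs G" if "i < Suc n" for i using that p fa by (auto simp: f'_def)
          show "inj_on f' {..<Suc n}"
            using inj np by (auto simp: inj_on_def f'_def less_Suc_eq)
          show "head G (f' i) = tail G (f' (Suc i))" if "Suc i < Suc n" for i
            using that nxt p by (cases "Suc i = n") (auto simp: f'_def)
          show "tail G (f' (Suc i)) \<notin> branch_verts G" if "Suc i < Suc n" for i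
            using that nb nbh p by (cases "Suc i = n") (auto simp: f'_def)
        qed simp
        moreover have "f' i = e" using i by (simp add: f'_def)
        ultimately have "P (Suc n)" using i(1) unfolding P_def by (intro exI[of _ f'] exI[of _ i]) simp
        then show False using max by fastforce
      qed
      then obtain j where j: "j < n" "p = f j" by auto
      show False
      proof (cases j)
        case 0
        then show False using j p True nbh by simp
      next
        case (Suc j')
        then have "f j' = f (n - 1)"
          using nbh nxt[of j'] j p fa[of j'] fa[of "n - 1"] n0 by (intro unbranched_in) auto
        then show False using inj_onD[OF inj, of j' "n - 1"] j Suc n0 by simp
      qed
    qed
    then have "open_chain G n f" using f True by (simp add: open_chain_def)
    then show thesis using that i by blast
  qed
qed

text \<open>Backwards from the common arc both chains are forced and stop at the first branch
  vertex, so they begin with the same arc; forwards they are forced again and stop together.\<close>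

lemma open_chains_meet:
  assumes f: "open_chain G n f" and g: "open_chain G m g" and meet: "i < n" "j < m" "f i = g j"
  shows "n = m \<and> (\<forall>t<n. f t = g t)"
proof -
  have F: "0 < n" "\<And>i. i < n \<Longrightarrow> f i \<in> arcs G" "\<And>i. Suc i < n \<Longrightarrow> head G (f i) = tail G (f (Suc i))"
      "\<And>i. Suc i < n \<Longrightarrow> tail G (f (Suc i)) \<notin> branch_verts G"
      "tail G (f 0) \<in> branch_verts G" "head G (f (n - 1)) \<in> branch_verts G"
    using f by (auto simp: open_chain_def chain_def)
  have Gg: "0 < m" "\<And>i. i < m \<Longrightarrow> g i \<in> arcs G" "\<And>i. Suc i < m \<Longrightarrow> head G (g i) = tail G (g (Suc i))"
      "\<And>i. Suc i < m \<Longrightarrow> tail G (g (Suc i)) \<notin> branch_verts G"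
      "tail G (g 0) \<in> branch_verts G" "head G (g (m - 1)) \<in> branch_verts G"
    using g by (auto simp: open_chain_def chain_def)
  have "f 0 = g 0" using meet
  proof (induction i arbitrary: j)
    case 0
    then show ?case using Gg F by (cases j) auto
  next
    case (Suc i)
    then obtain j' where j: "j = Suc j'" using Gg(5) F(4)[of i] by (cases j) auto
    have "f i = g j'"
      using Suc.prems j F(2)[of i] F(3,4)[of i] Gg(2)[of j'] Gg(3)[of j'] by (intro unbranched_in) auto
    then show ?case using Suc.IH[of j'] Suc.prems j by simp
  qed
  have eq: "t < n \<Longrightarrow> t < m \<Longrightarrow> f t = g t" for t
  proof (induction t)
    case (Suc t)
    then show ?case using F(2)[of "Suc t"] F(3,4)[of t] Gg(2)[of "Suc t"] Gg(3)[of t]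
      by (intro unbranched_out) auto
  qed (rule \<open>f 0 = g 0\<close>)
  have "\<not> n < m" using eq[of "n - 1"] F(1,6) Gg(3,4)[of "n - 1"] by auto
  moreover have "\<not> m < n" using eq[of "m - 1"] Gg(1,6) F(3,4)[of "m - 1"] by auto
  ultimately show ?thesis using eq by auto
qed

text \<open>Going backwards, the open chain arrives at a branch vertex, while the closed one can be
  followed forever without meeting any.\<close>

lemma open_closed_disjoint:
  assumes f: "open_chain G n f" and g: "closed_chain G m g" and meet: "i < n" "j < m"
  shows "f i \<noteq> g j"
proof
  assume eq: "f i = g j"
  have F: "0 < n" "\<And>i. i < n \<Longrightarrow> f i \<in> arcs G" "\<And>i. Suc i < n \<Longrightarrow> head G (f i) = tail G (f (Suc i))"
      "\<And>i. Suc i < n \<Longrightarrow> tail G (f (Suc i)) \<notin> branch_verts G" "tail G (f 0) \<in> branch_verts G"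
    using f by (auto simp: open_chain_def chain_def)
  have Gg: "0 < m" "\<And>i. i < m \<Longrightarrow> g i \<in> arcs G" "\<And>i. Suc i < m \<Longrightarrow> head G (g i) = tail G (g (Suc i))"
      "\<And>i. Suc i < m \<Longrightarrow> tail G (g (Suc i)) \<notin> branch_verts G"
      "tail G (g 0) \<notin> branch_verts G" "head G (g (m - 1)) = tail G (g 0)"
    using g by (auto simp: closed_chain_def chain_def)
  show False using meet eq
  proof (induction i arbitrary: j)
    case 0
    then show ?case using Gg F by (cases j) auto
  next
    case (Suc i)
    define j' where "j' = (if j = 0 then m - 1 else j - 1)"
    have j': "j' < m" "head G (g j') = tail G (g j)"
      using Suc.prems Gg(1,6) Gg(3)[of "j - 1"] by (auto simp: j'_def)
    have "f i = g j'"
      using Suc.prems j' F(2)[of i] F(3,4)[of i] Gg(2)[of j'] by (intro unbranched_in) auto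
    then show ?case using Suc.IH[of j'] Suc.prems j' by simp
  qed
qed

lemma closed_chain_next:
  assumes "closed_chain G m g" "j < m"
  shows "head G (g j) = tail G (g (Suc j mod m))" "tail G (g (Suc j mod m)) \<notin> branch_verts G"
  using assms by (cases "Suc j = m"; auto simp: closed_chain_def chain_def)+

text \<open>From the common arc on the chains agree cyclically. By injectivity each length divides
  the other. The rotation is written \<open>n - i + j\<close> to avoid a negative shift.\<close>

lemma closed_chains_meet:
  assumes f: "closed_chain G n f" and g: "closed_chain G m g" and meet: "i < n" "j < m" "f i = g j"
  shows "n = m \<and> (\<forall>t<n. f t = g ((t + (n - i + j)) mod n))"
proof -
  have F: "0 < n" "\<And>i. i < n \<Longrightarrow> f i \<in> arcs G" "inj_on f {..<n}"
    using f by (auto simp: closed_chain_def chain_def)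
  have Gg: "0 < m" "\<And>i. i < m \<Longrightarrow> g i \<in> arcs G" "inj_on g {..<m}"
    using g by (auto simp: closed_chain_def chain_def)
  have eq: "f ((i + t) mod n) = g ((j + t) mod m)" for t
  proof (induction t)
    case (Suc t)
    have lt: "(i + t) mod n < n" "(j + t) mod m < m" using F Gg by simp_all
    have "tail G (f (Suc ((i + t) mod n) mod n)) = tail G (g (Suc ((j + t) mod m) mod m))"
      using closed_chain_next(1)[OF f lt(1)] closed_chain_next(1)[OF g lt(2)] Suc by simp
    then have "f (Suc ((i + t) mod n) mod n) = g (Suc ((j + t) mod m) mod m)"
      using closed_chain_next(2)[OF f lt(1)] F Gg by (intro unbranched_out) auto
    then show ?case by (simp add: mod_Suc_eq)
  qed (use meet in simp)
  have "(i + m) mod n = i mod n"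
    using eq[of m] meet F(1,3) by (auto simp: inj_on_def)
  then have nm: "n dvd m" by (metis add_diff_cancel_left' mod_eq_dvd_iff_nat le_add1)
  have "(j + n) mod m = j mod m"
    using eq[of n] meet Gg(1,3) by (auto simp: inj_on_def)
  then have "m dvd n" by (metis add_diff_cancel_left' mod_eq_dvd_iff_nat le_add1)
  with nm have "n = m" by (rule dvd_antisym)
  moreover have "f t = g ((t + (n - i + j)) mod n)" if t: "t < n" for t
  proof -
    have "(i + (t + (n - i))) mod n = t" using t meet by simp
    then show ?thesis using eq[of "t + (n - i)"] \<open>n = m\<close> by (simp add: ac_simps)
  qed
  ultimately show ?thesis by simp
qed

end

section \<open>Bar edges and their arc sets\<close>

definition curve_length :: "('v, 'e) curve \<Rightarrow> nat" where
  "curve_length x = card (arcs (fst x))"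

definition curve_arc :: "('v, 'e) curve \<Rightarrow> nat \<Rightarrow> 'e" where
  "curve_arc x = on_arcs (snd x)"

definition curve_image :: "('v, 'e) curve \<Rightarrow> 'e set" where
  "curve_image x = curve_arc x ` {..<curve_length x}"

lemma segment_simps [simp]:
  "verts (segment n) = {..n}" "arcs (segment n) = {..<n}"
  "tail (segment n) = id" "head (segment n) = Suc"
  by (simp_all add: segment_def)

lemma circle_simps [simp]:
  "verts (circle n) = {..<n}" "arcs (circle n) = {..<n}"
  "tail (circle n) = id" "head (circle n) i = Suc i mod n"
  by (simp_all add: circle_def)

lemma gcomp_simps [simp]:
  "on_verts (g \<circ>\<^sub>g f) v = on_verts g (on_verts f v)"
  "on_arcs (g \<circ>\<^sub>g f) e = on_arcs g (on_arcs f e)"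
  by (simp_all add: gcomp_def)

context fin_digraph begin

abbreviation "curves \<equiv> bar_edge_paths G \<union> bar_edge_cycles G"

lemma bar_edge_path_chain:
  assumes "x \<in> bar_edge_paths G"
  shows "fst x = segment (curve_length x)" "open_chain G (curve_length x) (curve_arc x)"
    "\<And>i. i < curve_length x \<Longrightarrow> on_verts (snd x) i = tail G (curve_arc x i)"
    "on_verts (snd x) (curve_length x) = head G (curve_arc x (curve_length x - 1))"
proof -
  obtain n f where x: "x = (segment n, f)" and n: "1 \<le> n" and f: "graph_map (segment n) G f"
    and inj: "inj_on (on_arcs f) {..<n}" and br: "{i. i \<le> n \<and> on_verts f i \<in> branch_verts G} = {0, n}"
    using assms by (auto simp: bar_edge_paths_def is_path_def)
  have len: "curve_length x = n" and arc: "curve_arc x = on_arcs f"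
    by (simp_all add: x curve_length_def curve_arc_def)
  have a: "on_arcs f i \<in> arcs G" "tail G (on_arcs f i) = on_verts f i"
      "head G (on_arcs f i) = on_verts f (Suc i)" if "i < n" for i
    using f that by (auto simp: graph_map_def)
  have "on_verts f (Suc i) \<notin> branch_verts G" if "Suc i < n" for i
  proof
    assume "on_verts f (Suc i) \<in> branch_verts G"
    then have "Suc i \<in> {i. i \<le> n \<and> on_verts f i \<in> branch_verts G}" using that by simp
    then show False unfolding br using that by simp
  qed
  moreover have "on_verts f 0 \<in> branch_verts G" "on_verts f n \<in> branch_verts G"
    using br by auto
  ultimately show "open_chain G (curve_length x) (curve_arc x)"
    using a n inj by (auto simp: open_chain_def chain_def len arc)
  show "fst x = segment (curve_length x)" by (simp add: len) (simp add: x)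
  show "on_verts (snd x) i = tail G (curve_arc x i)" if "i < curve_length x" for i
    using a that by (simp add: len arc) (simp add: x)
  show "on_verts (snd x) (curve_length x) = head G (curve_arc x (curve_length x - 1))"
    using a(3)[of "n - 1"] n by (simp add: len arc) (simp add: x)
qed

lemma bar_edge_cycle_chain:
  assumes "x \<in> bar_edge_cycles G"
  shows "fst x = circle (curve_length x)" "closed_chain G (curve_length x) (curve_arc x)"
    "\<And>i. i < curve_length x \<Longrightarrow> on_verts (snd x) i = tail G (curve_arc x i)"
proof -
  obtain n f where x: "x = (circle n, f)" and n: "1 \<le> n" and f: "graph_map (circle n) G f"
    and inj: "inj_on (on_arcs f) {..<n}" and br: "on_verts f ` {..<n} \<inter> branch_verts G = {}"
    using assms by (auto simp: bar_edge_cycles_def is_cycle_def)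
  have len: "curve_length x = n" and arc: "curve_arc x = on_arcs f"
    by (simp_all add: x curve_length_def curve_arc_def)
  have a: "on_arcs f i \<in> arcs G" "tail G (on_arcs f i) = on_verts f i"
      "head G (on_arcs f i) = on_verts f (Suc i mod n)" if "i < n" for i
    using f that by (auto simp: graph_map_def)
  have b: "on_verts f i \<notin> branch_verts G" if "i < n" for i using br that by auto
  show "closed_chain G (curve_length x) (curve_arc x)"
    using a n inj b by (auto simp: closed_chain_def chain_def len arc)
  show "fst x = circle (curve_length x)" by (simp add: len) (simp add: x)
  show "on_verts (snd x) i = tail G (curve_arc x i)" if "i < curve_length x" for i
    using a that by (simp add: len arc) (simp add: x)
qed

lemma open_chain_bar_edge:
  assumes f: "open_chain G n f"
  obtains x where "x \<in> bar_edge_paths G" "curve_length x = n" "curve_arc x = f"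
proof -
  define h where "h = \<lparr>on_verts = (\<lambda>i. if i < n then tail G (f i) else head G (f (n - 1))), on_arcs = f\<rparr>"
  have F: "0 < n" "\<And>i. i < n \<Longrightarrow> f i \<in> arcs G" "\<And>i. Suc i < n \<Longrightarrow> head G (f i) = tail G (f (Suc i))"
      "\<And>i. Suc i < n \<Longrightarrow> tail G (f (Suc i)) \<notin> branch_verts G" "inj_on f {..<n}"
      "tail G (f 0) \<in> branch_verts G" "head G (f (n - 1)) \<in> branch_verts G"
    using f by (auto simp: open_chain_def chain_def)
  have arc: "on_arcs h = f" by (simp add: h_def)
  have "n - 1 < n" using F(1) by simp
  have "graph_map (segment n) G h"
    unfolding graph_map_def
  proof (intro conjI ballI)
    show "on_verts h ` verts (segment n) \<subseteq> verts G" "on_arcs h ` arcs (segment n) \<subseteq> arcs G"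
      using F(2) F(2)[OF \<open>n - 1 < n\<close>] by (auto simp: h_def)
    fix e assume "e \<in> arcs (segment n)"
    then have e: "e < n" by simp
    then show "tail G (on_arcs h e) = on_verts h (tail (segment n) e)" by (simp add: h_def)
    show "head G (on_arcs h e) = on_verts h (head (segment n) e)"
    proof (cases "Suc e < n")
      case True
      then show ?thesis using F(3) by (simp add: h_def)
    next
      case False
      then have "e = n - 1" using e by linarith
      then show ?thesis using False by (simp add: h_def)
    qed
  qed
  moreover have "{i. i \<le> n \<and> on_verts h i \<in> branch_verts G} = {0, n}"
  proof (intro set_eqI)
    fix i
    show "i \<in> {i. i \<le> n \<and> on_verts h i \<in> branch_verts G} \<longleftrightarrow> i \<in> {0, n}"
      using F(1,6,7) F(4)[of "i - 1"] by (cases "i = 0") (auto simp: h_def)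
  qed
  ultimately have "(segment n, h) \<in> bar_edge_paths G"
    unfolding bar_edge_paths_def is_path_def mem_Collect_eq
    by (intro exI[of _ n] exI[of _ h] conjI refl) (use F(1,5) arc in simp_all)
  then show thesis by (rule that) (simp_all add: curve_length_def curve_arc_def h_def)
qed

lemma closed_chain_bar_edge:
  assumes f: "closed_chain G n f"
  obtains x where "x \<in> bar_edge_cycles G" "curve_length x = n" "curve_arc x = f"
proof -
  define h where "h = \<lparr>on_verts = (\<lambda>i. tail G (f i)), on_arcs = f\<rparr>"
  have F: "0 < n" "\<And>i. i < n \<Longrightarrow> f i \<in> arcs G" "inj_on f {..<n}"
      "\<And>i. Suc i < n \<Longrightarrow> tail G (f (Suc i)) \<notin> branch_verts G" "tail G (f 0) \<notin> branch_verts G"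
    using f by (auto simp: closed_chain_def chain_def)
  have "graph_map (circle n) G h"
    using F closed_chain_next(1)[OF f] by (auto simp: graph_map_def h_def)
  moreover have "tail G (f i) \<notin> branch_verts G" if "i < n" for i
    using F(4)[of "i - 1"] F(5) that by (cases "i = 0") auto
  ultimately have "(circle n, h) \<in> bar_edge_cycles G"
    using F by (auto simp: bar_edge_cycles_def is_cycle_def h_def)
  then show thesis by (rule that) (simp_all add: curve_length_def curve_arc_def h_def)
qed

lemma curve_chain:
  assumes "x \<in> curves"
  shows "chain G (curve_length x) (curve_arc x)" "arcs (fst x) = {..<curve_length x}"
proof -
  have "chain G (curve_length x) (curve_arc x) \<and> arcs (fst x) = {..<curve_length x}"
  proof (cases "x \<in> bar_edge_paths G")
    case True
    show ?thesis
      using bar_edge_path_chain(2)[OF True] by (subst bar_edge_path_chain(1)[OF True]) (simp add: open_chain_def)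
  next
    case False
    then have "x \<in> bar_edge_cycles G" using assms by blast
    note X = bar_edge_cycle_chain[OF this]
    show ?thesis using X(2) by (subst X(1)) (simp add: closed_chain_def)
  qed
  then show "chain G (curve_length x) (curve_arc x)" "arcs (fst x) = {..<curve_length x}" by simp_all
qed

text \<open>A path is determined by any of its arcs, and a cycle is determined up to rotation, which
  is an isomorphism over \<open>G\<close>. A path never meets a cycle.\<close>

lemma curves_meet:
  assumes x: "x \<in> curves" and y: "y \<in> curves" and meet: "curve_image x \<inter> curve_image y \<noteq> {}"
  shows "iso_over x y \<and> curve_image x = curve_image y"
proof -
  obtain i j where ij: "i < curve_length x" "j < curve_length y" "curve_arc x i = curve_arc y j"
    using meet by (auto simp: curve_image_def)
  have "\<not> (x \<in> bar_edge_paths G \<and> y \<in> bar_edge_cycles G)"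
    using open_closed_disjoint[OF bar_edge_path_chain(2) bar_edge_cycle_chain(2) ij(1,2)] ij(3) by blast
  moreover have "\<not> (y \<in> bar_edge_paths G \<and> x \<in> bar_edge_cycles G)"
    using open_closed_disjoint[OF bar_edge_path_chain(2) bar_edge_cycle_chain(2) ij(2,1)] ij(3) by metis
  ultimately consider (oo) "x \<in> bar_edge_paths G" "y \<in> bar_edge_paths G"
    | (cc) "x \<in> bar_edge_cycles G" "y \<in> bar_edge_cycles G"
    using x y by blast
  then show ?thesis
  proof cases
    case oo
    note X = bar_edge_path_chain[OF oo(1)] and Y = bar_edge_path_chain[OF oo(2)]
    have eq: "curve_length x = curve_length y" "\<And>t. t < curve_length x \<Longrightarrow> curve_arc x t = curve_arc y t"
      using open_chains_meet[OF X(2) Y(2) ij] by auto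
    define \<phi> :: "(nat, nat, nat, nat) gmap" where "\<phi> = \<lparr>on_verts = id, on_arcs = id\<rparr>"
    have "graph_iso (fst x) (fst y) \<phi>"
      by (subst X(1), subst Y(1)) (auto simp: graph_iso_def graph_map_def \<phi>_def eq(1))
    moreover have "on_verts (snd x) v = on_verts (snd y) v" if "v \<le> curve_length x" for v
    proof (cases "v < curve_length x")
      case True
      then show ?thesis using X(3) Y(3) eq by simp
    next
      case False
      then have "v = curve_length x" using that by simp
      moreover have "0 < curve_length x" using X(2) by (simp add: open_chain_def chain_def)
      ultimately show ?thesis using X(4) Y(4) eq(2)[of "curve_length x - 1"] eq(1) by simp
    qed
    then have "gmap_eq (fst x) (snd x) (snd y \<circ>\<^sub>g \<phi>)"
      using eq(2) by (subst X(1)) (simp add: gmap_eq_def \<phi>_def curve_arc_def)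
    ultimately have "iso_over x y" by (auto simp: iso_over_def)
    then show ?thesis using eq by (auto simp: curve_image_def)
  next
    case cc
    note X = bar_edge_cycle_chain[OF cc(1)] and Y = bar_edge_cycle_chain[OF cc(2)]
    define n where "n = curve_length x"
    define s where "s = n - i + j"
    have eq: "curve_length y = n" "\<And>t. t < n \<Longrightarrow> curve_arc x t = curve_arc y ((t + s) mod n)"
      using closed_chains_meet[OF X(2) Y(2) ij] by (auto simp: n_def s_def)
    have n0: "0 < n" using ij(1) by (auto simp: n_def)
    define \<phi> :: "(nat, nat, nat, nat) gmap" where
      "\<phi> = \<lparr>on_verts = (\<lambda>t. (t + s) mod n), on_arcs = (\<lambda>t. (t + s) mod n)\<rparr>"
    have "inj_on (\<lambda>t. (t + s) mod n) {..<n}"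
    proof (rule inj_onI)
      fix t t' assume t: "t \<in> {..<n}" "t' \<in> {..<n}" "(t + s) mod n = (t' + s) mod n"
      then have "curve_arc x t = curve_arc x t'" using eq(2) by simp
      then show "t = t'" using curve_chain(1)[OF x] t by (auto simp: chain_def n_def inj_on_def)
    qed
    moreover have "(\<lambda>t. (t + s) mod n) ` {..<n} \<subseteq> {..<n}" using n0 by auto
    ultimately have bij: "bij_betw (\<lambda>t. (t + s) mod n) {..<n} {..<n}"
      by (simp add: bij_betw_def endo_inj_surj)
    have "graph_iso (circle n) (circle n) \<phi>"
      using bij n0 by (auto simp: graph_iso_def graph_map_def \<phi>_def mod_simps)
    then have "graph_iso (fst x) (fst y) \<phi>"
      by (subst X(1), subst Y(1)) (simp add: eq(1) flip: n_def)
    moreover have "gmap_eq (circle n) (snd x) (snd y \<circ>\<^sub>g \<phi>)"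
      using X(3) Y(3) eq n0 by (simp add: gmap_eq_def \<phi>_def curve_arc_def n_def)
    then have "gmap_eq (fst x) (snd x) (snd y \<circ>\<^sub>g \<phi>)" by (subst X(1)) (simp flip: n_def)
    ultimately have "iso_over x y" by (auto simp: iso_over_def)
    moreover have "curve_image x = curve_arc y ` (\<lambda>t. (t + s) mod n) ` {..<n}"
      using eq(2) by (auto simp: curve_image_def image_image n_def[symmetric])
    then have "curve_image x = curve_image y"
      using bij by (simp add: bij_betw_def curve_image_def eq(1))
    ultimately show ?thesis by simp
  qed
qed

text \<open>Equality of arc sets is visibly an equivalence relation, so the classes in
  \<open>bar_edges\<close> become manageable.\<close>

lemma iso_over_curves:
  assumes x: "x \<in> curves" and y: "y \<in> curves"
  shows "iso_over x y \<longleftrightarrow> curve_image x = curve_image y"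
proof
  assume "iso_over x y"
  then obtain \<phi> where \<phi>: "graph_iso (fst x) (fst y) \<phi>" "gmap_eq (fst x) (snd x) (snd y \<circ>\<^sub>g \<phi>)"
    by (auto simp: iso_over_def)
  have "0 < curve_length x" using curve_chain[OF x] by (simp add: chain_def)
  then have 0: "0 \<in> arcs (fst x)" using curve_chain(2)[OF x] by simp
  then have "curve_arc x 0 = curve_arc y (on_arcs \<phi> 0)" using \<phi>(2) by (simp add: gmap_eq_def curve_arc_def)
  moreover have "on_arcs \<phi> 0 < curve_length y"
    using \<phi>(1) 0 curve_chain(2)[OF y] unfolding graph_iso_def bij_betw_def by blast
  ultimately have "curve_image x \<inter> curve_image y \<noteq> {}"
    using \<open>0 < curve_length x\<close> unfolding curve_image_def by blast
  then show "curve_image x = curve_image y" using curves_meet x y by blast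
next
  assume "curve_image x = curve_image y"
  moreover have "curve_arc x 0 \<in> curve_image x"
    using curve_chain[OF x] by (auto simp: chain_def curve_image_def)
  ultimately show "iso_over x y" using curves_meet x y by blast
qed

lemma bar_edges_repr:
  assumes "c \<in> bar_edges G"
  shows "repr c \<in> curves" "c = {y \<in> curves. curve_image (repr c) = curve_image y}"
proof -
  obtain x where x: "x \<in> curves" "c = {y \<in> curves. iso_over x y}"
    using assms unfolding bar_edges_def iso_classes_def quotient_def by auto
  then have c: "c = {y \<in> curves. curve_image x = curve_image y}" using iso_over_curves by blast
  then have "x \<in> c" using x(1) by simp
  then have "repr c \<in> c" unfolding repr_def by (rule someI)
  from subsetD[OF equalityD1[OF c] this]
  have "repr c \<in> curves \<and> curve_image x = curve_image (repr c)" by simp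
  then show "repr c \<in> curves" "c = {y \<in> curves. curve_image (repr c) = curve_image y}"
    using c by simp_all
qed

lemma bar_edges_eq:
  assumes c: "c \<in> bar_edges G" and d: "d \<in> bar_edges G"
    and meet: "curve_image (repr c) \<inter> curve_image (repr d) \<noteq> {}"
  shows "c = d"
proof -
  have "curve_image (repr c) = curve_image (repr d)"
    using curves_meet bar_edges_repr(1) meet c d by blast
  then show ?thesis using bar_edges_repr(2)[OF c] bar_edges_repr(2)[OF d] by simp
qed

lemma bar_edges_cover:
  assumes "e \<in> arcs G"
  shows "\<exists>c\<in>bar_edges G. e \<in> curve_image (repr c)"
proof -
  obtain n f i where f: "open_chain G n f \<or> closed_chain G n f" and i: "i < n" "f i = e"
    using chain_through_arc[OF assms] .
  from f obtain x where x: "x \<in> curves" "curve_length x = n" "curve_arc x = f"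
    using open_chain_bar_edge closed_chain_bar_edge by (metis UnCI)
  define c where "c = {y \<in> curves. iso_over x y}"
  have c: "c \<in> bar_edges G"
    using x(1) unfolding bar_edges_def iso_classes_def quotient_def c_def by blast
  have "x \<in> c" using x(1) iso_over_curves by (simp add: c_def)
  then have "curve_image (repr c) = curve_image x" using bar_edges_repr(2)[OF c] by blast
  then show ?thesis using c x i by (auto simp: curve_image_def intro!: bexI[of _ c])
qed

lemma finite_bar_edges: "finite (bar_edges G)"
proof (rule finite_imageD)
  have "(\<lambda>c. curve_image (repr c)) ` bar_edges G \<subseteq> Pow (arcs G)"
  proof clarify
    fix c e assume c: "c \<in> bar_edges G" and e: "e \<in> curve_image (repr c)"
    show "e \<in> arcs G"
      using curve_chain(1)[OF bar_edges_repr(1)[OF c]] e by (auto simp: curve_image_def chain_def)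
  qed
  then show "finite ((\<lambda>c. curve_image (repr c)) ` bar_edges G)" by (rule finite_subset) simp
  show "inj_on (\<lambda>c. curve_image (repr c)) (bar_edges G)"
  proof (rule inj_onI)
    fix c d assume cd: "c \<in> bar_edges G" "d \<in> bar_edges G" "curve_image (repr c) = curve_image (repr d)"
    have "c = {y \<in> curves. curve_image (repr c) = curve_image y}" by (rule bar_edges_repr(2)[OF cd(1)])
    also have "\<dots> = {y \<in> curves. curve_image (repr d) = curve_image y}" by (simp only: cd(3))
    also have "\<dots> = d" by (rule bar_edges_repr(2)[OF cd(2), symmetric])
    finally show "c = d" .
  qed
qed

lemma seg_graph_bar_edges:
  assumes det: "\<And>v. v \<in> verts G \<Longrightarrow> inj_on lab (out_arcs G v)"
  shows "seg_graph (arcs G) (tail G) (head G) lab (bar_edges G)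
           (\<lambda>c. curve_length (repr c)) (\<lambda>c. curve_arc (repr c))"
proof
  show "e = e'" if "e \<in> arcs G" "e' \<in> arcs G" "tail G e = tail G e'" "lab e = lab e'" for e e'
  proof (rule inj_onD[OF det that(4)])
    show "tail G e \<in> verts G" using that(1) by simp
  qed (use that in auto)
  note ch = curve_chain(1)[OF bar_edges_repr(1)]
  have img: "curve_arc (repr c) i \<in> curve_image (repr c)" if "i < curve_length (repr c)" for c i
    using that by (simp add: curve_image_def)
  show "c = c' \<and> i = i'" if "c \<in> bar_edges G" "c' \<in> bar_edges G" "i < curve_length (repr c)"
      "i' < curve_length (repr c')" "curve_arc (repr c) i = curve_arc (repr c') i'" for c c' i i'
  proof -
    have "c = c'" using img[OF that(3)] img[OF that(4)] that(5) by (intro bar_edges_eq[OF that(1,2)]) auto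
    moreover have "inj_on (curve_arc (repr c)) {..<curve_length (repr c)}"
      using ch[OF that(1)] by (simp add: chain_def)
    ultimately show ?thesis using that by (auto dest: inj_onD)
  qed
  show "\<exists>c\<in>bar_edges G. \<exists>i<curve_length (repr c). e = curve_arc (repr c) i" if "e \<in> arcs G" for e
    using bar_edges_cover[OF that] by (auto simp: curve_image_def)
  fix c i assume c: "c \<in> bar_edges G"
  show "curve_arc (repr c) i \<in> arcs G" if "i < curve_length (repr c)"
    using ch[OF c] that by (simp add: chain_def)
  assume i: "Suc i < curve_length (repr c)"
  have *: "curve_arc (repr c) i \<in> arcs G" "curve_arc (repr c) (Suc i) \<in> arcs G"
    "head G (curve_arc (repr c) i) = tail G (curve_arc (repr c) (Suc i))"
    "tail G (curve_arc (repr c) (Suc i)) \<notin> branch_verts G"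
    using ch[OF c] i by (auto simp: chain_def)
  show "head G (curve_arc (repr c) i) = tail G (curve_arc (repr c) (Suc i))" by (rule *(3))
  show "e = curve_arc (repr c) (Suc i)" if "e \<in> arcs G" "tail G e = tail G (curve_arc (repr c) (Suc i))" for e
    using that * by (intro unbranched_out) auto
  show "e = curve_arc (repr c) i" if "e \<in> arcs G" "head G e = tail G (curve_arc (repr c) (Suc i))" for e
    using that * by (intro unbranched_in) auto
qed (simp_all add: finite_bar_edges)

section \<open>The first Betti number\<close>

lemma one_cycle_chain:
  assumes z: "z \<in> one_cycles G" and f: "chain G n f" and i: "i < n"
  shows "z (f i) = z (f 0)"
  using i
proof (induction i)
  case (Suc i)
  have *: "f i \<in> arcs G" "f (Suc i) \<in> arcs G" "head G (f i) = tail G (f (Suc i))"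
      "tail G (f (Suc i)) \<notin> branch_verts G"
    using f Suc.prems by (auto simp: chain_def)
  define v where "v = tail G (f (Suc i))"
  have "e = f i" if "e \<in> arcs G" "head G e = v" for e
    using that * by (intro unbranched_in) (simp_all add: v_def)
  then have "in_arcs G v = {f i}" using *(1,3) unfolding in_arcs_def v_def by blast
  moreover have "e = f (Suc i)" if "e \<in> arcs G" "tail G e = v" for e
    using that * by (intro unbranched_out) (simp_all add: v_def)
  then have "out_arcs G v = {f (Suc i)}" using *(2) unfolding out_arcs_def v_def by blast
  moreover have "v \<in> verts G" using *(2) unfolding v_def by simp
  then have "(\<Sum>e\<in>in_arcs G v. z e) = (\<Sum>e\<in>out_arcs G v. z e)" using z by (simp add: one_cycles_def)
  ultimately show ?case using Suc.IH Suc.prems by simp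
qed simp

text \<open>At inner vertices the balance condition equates the coefficients of the two arcs, so a
  homology cycle is constant on each bar edge. The indicator functions of the bar edges therefore
  span the cycle space.\<close>

lemma betti1_le: "betti1 G \<le> card (bar_edges G)"
proof -
  interpret vs: vector_space "\<lambda>(a::rat) c (e::'b). a * c e"
    by unfold_locales (auto simp: fun_eq_iff algebra_simps)
  define \<chi> :: "('a, 'b) curve set \<Rightarrow> 'b \<Rightarrow> rat" where
    "\<chi> c e = (if e \<in> curve_image (repr c) then 1 else 0)" for c e
  have app: "(\<Sum>c\<in>A. F c) e = (\<Sum>c\<in>A. F c e)" if "finite A" for A :: "('a, 'b) curve set set"
    and F :: "('a, 'b) curve set \<Rightarrow> 'b \<Rightarrow> rat" and e
    using that by induction auto
  have "one_cycles G \<subseteq> vs.span (\<chi> ` bar_edges G)"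
  proof
    fix z assume z: "z \<in> one_cycles G"
    have "z = (\<Sum>c\<in>bar_edges G. (\<lambda>e. z (curve_arc (repr c) 0) * \<chi> c e))"
    proof
      fix e
      have "z e = (\<Sum>c\<in>bar_edges G. z (curve_arc (repr c) 0) * \<chi> c e)"
      proof (cases "e \<in> arcs G")
        case True
        obtain d where d: "d \<in> bar_edges G" "e \<in> curve_image (repr d)" using bar_edges_cover[OF True] by blast
        have "(\<Sum>c\<in>bar_edges G. z (curve_arc (repr c) 0) * \<chi> c e) =
            (\<Sum>c\<in>bar_edges G. if c = d then z (curve_arc (repr d) 0) else 0)"
        proof (rule sum.cong[OF refl])
          fix c assume c: "c \<in> bar_edges G"
          show "z (curve_arc (repr c) 0) * \<chi> c e = (if c = d then z (curve_arc (repr d) 0) else 0)"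
            using bar_edges_eq[OF c d(1)] d(2) by (auto simp: \<chi>_def)
        qed
        also have "\<dots> = z (curve_arc (repr d) 0)" using d finite_bar_edges by simp
        also have "\<dots> = z e"
        proof -
          obtain i where i: "i < curve_length (repr d)" "e = curve_arc (repr d) i"
            using d(2) by (auto simp: curve_image_def)
          show ?thesis
            unfolding i(2)
            by (rule one_cycle_chain[OF z curve_chain(1)[OF bar_edges_repr(1)[OF d(1)]] i(1), symmetric])
        qed
        finally show ?thesis by (rule sym)
      next
        case False
        have "e \<notin> curve_image (repr c)" if "c \<in> bar_edges G" for c
          using False curve_chain(1)[OF bar_edges_repr(1)[OF that]] by (auto simp: curve_image_def chain_def)
        moreover have "z e = 0" using z False by (simp add: one_cycles_def)
        ultimately show ?thesis by (simp add: \<chi>_def)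
      qed
      then show "z e = (\<Sum>c\<in>bar_edges G. (\<lambda>e. z (curve_arc (repr c) 0) * \<chi> c e)) e"
        by (simp add: app[OF finite_bar_edges])
    qed
    also have "\<dots> \<in> vs.span (\<chi> ` bar_edges G)"
      by (intro vs.span_sum vs.span_scale vs.span_base) simp
    finally show "z \<in> vs.span (\<chi> ` bar_edges G)" .
  qed
  then have "vs.dim (one_cycles G) \<le> card (\<chi> ` bar_edges G)"
    using finite_bar_edges by (intro vs.dim_le_card) auto
  also have "\<dots> \<le> card (bar_edges G)" using finite_bar_edges by (rule card_image_le)
  finally show ?thesis by (simp add: betti1_def)
qed

end

section \<open>Long cycles\<close>

text \<open>A covering of circles commutes with the successor map, so it is reduction modulo
  \<open>m\<close> followed by a rotation.\<close>

lemma covering_circle: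
  assumes p: "covering_of_degree d (circle k) (circle m) p" and k: "0 < k" and m: "0 < m"
  shows "on_verts p (t mod k) = (on_verts p 0 + t) mod m" "m dvd k" "k = d * m"
    "\<And>i. i < k \<Longrightarrow> on_arcs p i = on_verts p i"
proof -
  have gm: "graph_map (circle k) (circle m) p" and deg: "\<And>w. w < m \<Longrightarrow> card {v. v < k \<and> on_verts p v = w} = d"
    using p by (auto simp: covering_of_degree_def)
  have both: "on_arcs p i = on_verts p i \<and> Suc (on_arcs p i) mod m = on_verts p (Suc i mod k)"
    if "i < k" for i
  proof -
    have "\<forall>e\<in>arcs (circle k). tail (circle m) (on_arcs p e) = on_verts p (tail (circle k) e) \<and>
        head (circle m) (on_arcs p e) = on_verts p (head (circle k) e)"
      using gm unfolding graph_map_def by blast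
    moreover have "i \<in> arcs (circle k)" using that by simp
    ultimately have "tail (circle m) (on_arcs p i) = on_verts p (tail (circle k) i) \<and>
        head (circle m) (on_arcs p i) = on_verts p (head (circle k) i)" by (rule bspec)
    then show ?thesis unfolding circle_simps id_apply .
  qed
  show arcs: "on_arcs p i = on_verts p i" if "i < k" for i using both[OF that] by blast
  have step: "on_verts p (Suc i mod k) = Suc (on_verts p i) mod m" if "i < k" for i
    using both[OF that] by metis
  have lt: "on_verts p i < m" if "i < k" for i using gm that by (auto simp: graph_map_def)
  have all: "on_verts p (t mod k) = (on_verts p 0 + t) mod m" for t
  proof (induction t)
    case 0
    then show ?case using lt[OF k] by simp
  next
    case (Suc t)
    have "on_verts p (Suc t mod k) = on_verts p (Suc (t mod k) mod k)" by (simp add: mod_Suc_eq)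
    also have "\<dots> = Suc (on_verts p (t mod k)) mod m" using step k by simp
    also have "\<dots> = (on_verts p 0 + Suc t) mod m" by (simp add: Suc mod_Suc_eq)
    finally show ?case .
  qed
  show "on_verts p (t mod k) = (on_verts p 0 + t) mod m" by (rule all)
  have "(on_verts p 0 + k) mod m = on_verts p 0 mod m" using all[of k] lt[OF k] by simp
  then show "m dvd k" by (metis add_diff_cancel_left' mod_eq_dvd_iff_nat le_add1)
  have "{..<k} = (\<Union>w<m. {v. v < k \<and> on_verts p v = w})" using lt by auto
  then have "card {..<k} = (\<Sum>w<m. card {v. v < k \<and> on_verts p v = w})"
    by (simp only:) (rule card_UN_disjoint, auto)
  then show "k = d * m" using deg by simp
qed

lemma covering_circle_mod:
  assumes p: "0 < p" "p dvd k" and k: "0 < k"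
  shows "covering_of_degree (k div p) (circle k) (circle p) \<lparr>on_verts = (\<lambda>i. i mod p), on_arcs = (\<lambda>i. i mod p)\<rparr>"
    (is "covering_of_degree _ _ _ ?m")
proof -
  have pk: "p \<le> k" using p k by (simp add: dvd_imp_le)
  have outs: "out_arcs (circle n) v = {v}" if "v < n" for n v using that by (auto simp: out_arcs_def)
  \<comment> \<open>Adding \<open>n - 1\<close> is subtraction of 1 modulo \<open>n\<close>.\<close>
  have ins: "in_arcs (circle n) v = {(v + (n - 1)) mod n}" if "v < n" for n v
  proof -
    have "Suc e mod n = v \<longleftrightarrow> e = (v + (n - 1)) mod n" if "e < n" for e
    proof
      assume "Suc e mod n = v"
      then have "(v + (n - 1)) mod n = (Suc e + (n - 1)) mod n" by (metis mod_add_left_eq)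
      also have "\<dots> = e" using that by simp
      finally show "e = (v + (n - 1)) mod n" by simp
    next
      assume "e = (v + (n - 1)) mod n"
      then have "Suc e mod n = Suc (v + (n - 1)) mod n" by (simp add: mod_Suc_eq)
      also have "\<dots> = v" using \<open>v < n\<close> by simp
      finally show "Suc e mod n = v" .
    qed
    then show ?thesis using that by (auto simp: in_arcs_def)
  qed
  have "graph_map (circle k) (circle p) ?m"
    using p by (auto simp: graph_map_def mod_mod_cancel mod_Suc_eq)
  moreover have "on_verts ?m ` verts (circle k) = verts (circle p)"
  proof -
    have "v \<in> (\<lambda>i. i mod p) ` {..<k}" if "v < p" for v
      using that pk by (intro image_eqI[of _ _ v]) auto
    then show ?thesis using p by auto
  qed
  moreover have "bij_betw (on_arcs ?m) (out_arcs (circle k) v) (out_arcs (circle p) (on_verts ?m v))"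
    if "v < k" for v using that p by (simp add: outs)
  moreover have "bij_betw (on_arcs ?m) (in_arcs (circle k) v) (in_arcs (circle p) (on_verts ?m v))"
    if "v < k" for v
  proof -
    have "(v + (k - 1)) mod p = (v mod p + (p - 1)) mod p"
    proof -
      obtain q where q: "k = p * q" using p(2) by blast
      then obtain q' where "q = Suc q'" using k by (cases q) auto
      then have "v + (k - 1) = v + (p - 1) + p * q'" using q p(1) by simp
      then have "(v + (k - 1)) mod p = (v + (p - 1)) mod p" by (simp only: mod_mult_self2)
      then show ?thesis by (simp only: mod_add_left_eq)
    qed
    then show ?thesis using that p by (simp add: ins mod_mod_cancel)
  qed
  moreover have "card {v \<in> verts (circle k). on_verts ?m v = w} = k div p" if "w < p" for w
  proof -
    have "{v \<in> verts (circle k). on_verts ?m v = w} = (\<lambda>j. w + j * p) ` {..<k div p}"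
    proof (intro equalityI subsetI)
      fix v assume v: "v \<in> {v \<in> verts (circle k). on_verts ?m v = w}"
      then have "v = w + (v div p) * p" by (auto simp: mod_div_mult_eq)
      moreover have "v div p < k div p" using v p by (intro less_mult_imp_div_less) simp
      ultimately show "v \<in> (\<lambda>j. w + j * p) ` {..<k div p}" by blast
    next
      fix v assume "v \<in> (\<lambda>j. w + j * p) ` {..<k div p}"
      then obtain j where j: "j < k div p" "v = w + j * p" by auto
      have "w + j * p < Suc j * p" using that by simp
      also have "\<dots> \<le> (k div p) * p" using j by (intro mult_le_mono1) simp
      also have "\<dots> = k" using p by simp
      finally show "v \<in> {v \<in> verts (circle k). on_verts ?m v = w}" using j that by simp
    qed
    moreover have "inj_on (\<lambda>j. w + j * p) {..<k div p}" using p by (auto simp: inj_on_def)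
    ultimately show ?thesis by (simp add: card_image)
  qed
  ultimately show ?thesis unfolding covering_of_degree_def by simp
qed

text \<open>\<open>Max\<close> gives an upper bound only on finite sets; here every degree divides
  \<open>k\<close>.\<close>

lemma cycle_degree_ge:
  assumes "0 < k" "covering_of_degree d (circle k) (circle m) p" "is_cycle G m g"
    "gmap_eq (circle k) f (g \<circ>\<^sub>g p)"
  shows "d \<le> cycle_degree G k f"
proof -
  let ?S = "{d. \<exists>m p g. covering_of_degree d (circle k) (circle m) p \<and> is_cycle G m g \<and>
              gmap_eq (circle k) f (g \<circ>\<^sub>g p)}"
  have "e \<le> k" if e: "e \<in> ?S" for e
  proof -
    obtain m p g where "covering_of_degree e (circle k) (circle m) p" "is_cycle G m g"
      using e by blast
    then show "e \<le> k" using covering_circle(3)[of e k m p] assms(1) by (simp add: is_cycle_def)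
  qed
  then have "finite ?S" by (meson finite_nat_set_iff_bounded_le)
  moreover have "d \<in> ?S" using assms by blast
  ultimately show ?thesis unfolding cycle_degree_def by (rule Max_ge)
qed

section \<open>Periodic walks as cycles\<close>

definition periodic_cycle :: "('v, 'e) pre_digraph \<Rightarrow> (nat \<Rightarrow> 'e) \<Rightarrow> (nat, nat, 'v, 'e) gmap" where
  "periodic_cycle G g = \<lparr>on_verts = (\<lambda>i. tail G (g i)), on_arcs = g\<rparr>"

lemma periodic_cycle_simps [simp]:
  "on_verts (periodic_cycle G g) i = tail G (g i)" "on_arcs (periodic_cycle G g) = g"
  by (simp_all add: periodic_cycle_def)

context wf_digraph begin

lemma is_cycle_periodic:
  assumes g: "\<And>t. g t \<in> arcs G \<and> head G (g t) = tail G (g (Suc t))"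
    and k: "0 < k" "\<And>t. g (t + k) = g t"
  shows "is_cycle G k (periodic_cycle G g)"
proof -
  have "g (Suc i mod k) = g (Suc i)" for i using periodic_mod[of g k] k(2) by blast
  then show ?thesis using g k by (auto simp: is_cycle_def graph_map_def)
qed

text \<open>Factoring through a covering onto \<open>circle m\<close> would give \<open>g\<close>
  the period \<open>m\<close>, so minimality of \<open>k\<close> leaves degree 1 only; the identity
  attains it.\<close>

lemma primitive_periodic_cycle:
  assumes g: "\<And>t. g t \<in> arcs G \<and> head G (g t) = tail G (g (Suc t))" and k: "min_period k g"
  shows "primitive_cycle G k (periodic_cycle G g)"
proof -
  let ?f = "periodic_cycle G g"
  have k0: "0 < k" and per: "\<And>t. g (t + k) = g t" using k by (auto simp: min_period_def)
  have cyc: "is_cycle G k ?f" using g k0 per by (rule is_cycle_periodic)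
  have "{d. \<exists>m p h. covering_of_degree d (circle k) (circle m) p \<and> is_cycle G m h \<and>
              gmap_eq (circle k) ?f (h \<circ>\<^sub>g p)} = {1}"
  proof (intro equalityI subsetI)
    fix d assume "d \<in> {d. \<exists>m p h. covering_of_degree d (circle k) (circle m) p \<and> is_cycle G m h \<and>
              gmap_eq (circle k) ?f (h \<circ>\<^sub>g p)}"
    then obtain m p h where p: "covering_of_degree d (circle k) (circle m) p" and h: "is_cycle G m h"
      and eq: "gmap_eq (circle k) ?f (h \<circ>\<^sub>g p)" by blast
    have m: "0 < m" using h by (simp add: is_cycle_def)
    note cov = covering_circle[OF p k0 m]
    have "g t = on_arcs h ((on_verts p 0 + t) mod m)" for t
    proof -
      have "g t = g (t mod k)" using periodic_mod[of g k t] per by simp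
      also have "\<dots> = on_arcs h (on_arcs p (t mod k))" using eq k0 by (simp add: gmap_eq_def)
      also have "on_arcs p (t mod k) = (on_verts p 0 + t) mod m"
        using cov(4)[of "t mod k"] cov(1)[of t] k0 by simp
      finally show ?thesis .
    qed
    then have "g (t + m) = g t" for t by (simp add: add.assoc[symmetric])
    then have "k \<le> m" using k m by (auto simp: min_period_def)
    then have "d * m \<le> 1 * m" using cov(3) by simp
    then have "d \<le> 1" using m by simp
    moreover have "d \<noteq> 0" using cov(3) k0 by auto
    ultimately show "d \<in> {1}" by simp
  next
    fix d :: nat assume "d \<in> {1}"
    moreover have "covering_of_degree (k div k) (circle k) (circle k)
        \<lparr>on_verts = (\<lambda>i. i mod k), on_arcs = (\<lambda>i. i mod k)\<rparr>"
      using k0 by (intro covering_circle_mod) auto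
    moreover have "gmap_eq (circle k) ?f (?f \<circ>\<^sub>g \<lparr>on_verts = (\<lambda>i. i mod k), on_arcs = (\<lambda>i. i mod k)\<rparr>)"
      by (simp add: gmap_eq_def)
    ultimately show "d \<in> {d. \<exists>m p h. covering_of_degree d (circle k) (circle m) p \<and> is_cycle G m h \<and>
              gmap_eq (circle k) ?f (h \<circ>\<^sub>g p)}"
      using cyc k0 by auto
  qed
  then show ?thesis using cyc by (simp add: primitive_cycle_def cycle_degree_def)
qed

text \<open>The labels have period \<open>p\<close>, so the image cycle factors through
  \<open>circle p\<close> by a covering of degree \<open>k div p\<close>.\<close>

lemma long_periodic_cycle:
  assumes \<gamma>: "graph_map G D \<gamma>"
    and g: "\<And>t. g t \<in> arcs G \<and> head G (g t) = tail G (g (Suc t))"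
    and k: "min_period k g" and p: "min_period p (\<lambda>t. on_arcs \<gamma> (g t))"
    and long: "12 * betti1 G * p \<le> k"
  shows "(circle k, periodic_cycle G g) \<in> long_cycles G D \<gamma>"
proof -
  have k0: "0 < k" and per: "\<And>t. g (t + k) = g t" using k by (auto simp: min_period_def)
  have p0: "0 < p" and pper: "\<And>t. on_arcs \<gamma> (g (t + p)) = on_arcs \<gamma> (g t)"
    using p by (auto simp: min_period_def)
  have "p dvd k" using p by (rule min_period_dvd) (use per in \<open>simp add: add.commute\<close>)
  have tails: "tail D (on_arcs \<gamma> (g t)) = on_verts \<gamma> (tail G (g t))"
    and heads: "head D (on_arcs \<gamma> (g t)) = on_verts \<gamma> (tail G (g (Suc t)))"
    and arcs: "on_arcs \<gamma> (g t) \<in> arcs D" and vs: "on_verts \<gamma> (tail G (g t)) \<in> verts D" for t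
  proof -
    have a: "g t \<in> arcs G" "tail G (g t) \<in> verts G" "head G (g t) = tail G (g (Suc t))" using g[of t] by auto
    then show "tail D (on_arcs \<gamma> (g t)) = on_verts \<gamma> (tail G (g t))"
      "head D (on_arcs \<gamma> (g t)) = on_verts \<gamma> (tail G (g (Suc t)))"
      "on_arcs \<gamma> (g t) \<in> arcs D" "on_verts \<gamma> (tail G (g t)) \<in> verts D"
      using \<gamma> by (auto simp: graph_map_def)
  qed
  have pmod: "on_arcs \<gamma> (g (t mod p)) = on_arcs \<gamma> (g t)" for t
    using periodic_mod[of "\<lambda>t. on_arcs \<gamma> (g t)" p t] pper by blast
  then have pmodv: "on_verts \<gamma> (tail G (g (t mod p))) = on_verts \<gamma> (tail G (g t))" for t
    using tails by metis
  have "is_cycle D p (\<gamma> \<circ>\<^sub>g periodic_cycle G g)"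
    using p0 arcs vs tails heads pmodv by (auto simp: is_cycle_def graph_map_def)
  moreover have "gmap_eq (circle k) (\<gamma> \<circ>\<^sub>g periodic_cycle G g)
      ((\<gamma> \<circ>\<^sub>g periodic_cycle G g) \<circ>\<^sub>g \<lparr>on_verts = (\<lambda>i. i mod p), on_arcs = (\<lambda>i. i mod p)\<rparr>)"
    using pmod pmodv by (simp add: gmap_eq_def)
  ultimately have "k div p \<le> cycle_degree D k (\<gamma> \<circ>\<^sub>g periodic_cycle G g)"
    using cycle_degree_ge[OF k0 covering_circle_mod[OF p0 \<open>p dvd k\<close> k0]] by blast
  moreover have "12 * betti1 G \<le> k div p" using long p0 by (simp add: less_eq_div_iff_mult_less_eq)
  ultimately show ?thesis
    using primitive_periodic_cycle[OF g k] unfolding long_cycles_def by (auto intro: order_trans)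
qed

text \<open>The long cycle graph is built on representatives chosen by \<open>repr\<close>, which
  need not be the cycle made from \<open>g\<close>. An isomorphism carries the walk over to the
  representative, where \<open>\<psi>\<close> and \<open>\<phi>\<close> list its vertices and
  arcs.\<close>

lemma long_cycle_lift:
  assumes \<gamma>: "graph_map G D \<gamma>"
    and g: "\<And>t. g t \<in> arcs G \<and> head G (g t) = tail G (g (Suc t))"
    and N: "0 < N" "\<And>t. g (t + N) = g t" and p: "min_period p (\<lambda>t. on_arcs \<gamma> (g t))"
    and long: "\<forall>k>0. (\<forall>t. g (t + k) = g t) \<longrightarrow> 12 * betti1 G * p \<le> k"
  shows "\<exists>c \<psi> \<phi> k. c \<in> iso_classes (long_cycles G D \<gamma>) \<and> 0 < k \<and>
    (\<forall>t. \<psi> (t + k) = \<psi> t) \<and> (\<forall>t. \<phi> (t + k) = \<phi> t) \<and>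
    (\<forall>t. \<psi> t \<in> verts (fst (repr c)) \<and> \<phi> t \<in> arcs (fst (repr c)) \<and>
         tail (fst (repr c)) (\<phi> t) = \<psi> t \<and> head (fst (repr c)) (\<phi> t) = \<psi> (Suc t) \<and>
         on_verts (snd (repr c)) (\<psi> t) = tail G (g t) \<and> on_arcs (snd (repr c)) (\<phi> t) = g t)"
proof -
  obtain k where k: "min_period k g" using min_periodE[of N g] N by blast
  have k0: "0 < k" and per: "\<And>t. g (t + k) = g t" using k by (auto simp: min_period_def)
  have kmod: "g (t mod k) = g t" for t using periodic_mod[of g k t] per by blast
  define x where "x = (circle k, periodic_cycle G g)"
  define L where "L = long_cycles G D \<gamma>"
  have x: "x \<in> L" using long_periodic_cycle[OF \<gamma> g k p] long k0 per by (simp add: x_def L_def)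
  define c where "c = {y. y \<in> L \<and> iso_over x y}"
  have "c = {(x, y). x \<in> L \<and> y \<in> L \<and> iso_over x y} `` {x}" using x by (auto simp: c_def)
  also have "\<dots> \<in> iso_classes L" unfolding iso_classes_def using x by (rule quotientI)
  finally have c: "c \<in> iso_classes L" .
  have "iso_over x x"
    unfolding iso_over_def
    by (rule exI[of _ "\<lparr>on_verts = id, on_arcs = id\<rparr>"]) (auto simp: graph_iso_def graph_map_def gmap_eq_def)
  then have "x \<in> c" using x by (simp add: c_def)
  then have "repr c \<in> c" unfolding repr_def by (rule someI)
  have "iso_over x (repr c)" using \<open>repr c \<in> c\<close> by (simp add: c_def)
  then obtain \<theta> where iso: "graph_map (circle k) (fst (repr c)) \<theta>"
    and eq: "gmap_eq (circle k) (periodic_cycle G g) (snd (repr c) \<circ>\<^sub>g \<theta>)"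
    by (auto simp: iso_over_def graph_iso_def x_def)
  define \<psi> where "\<psi> t = on_verts \<theta> (t mod k)" for t
  define \<phi> where "\<phi> t = on_arcs \<theta> (t mod k)" for t
  show ?thesis
  proof (rule exI[of _ c], rule exI[of _ \<psi>], rule exI[of _ \<phi>], rule exI[of _ k], intro conjI allI)
    show "c \<in> iso_classes (long_cycles G D \<gamma>)" using c by (simp add: L_def)
    show "0 < k" by (rule k0)
    fix t
    have m: "t mod k \<in> {..<k}" using k0 by simp
    show "\<psi> (t + k) = \<psi> t" "\<phi> (t + k) = \<phi> t" by (simp_all add: \<psi>_def \<phi>_def)
    show "\<psi> t \<in> verts (fst (repr c))" "\<phi> t \<in> arcs (fst (repr c))"
      using iso m by (auto simp: \<psi>_def \<phi>_def graph_map_def)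
    show "tail (fst (repr c)) (\<phi> t) = \<psi> t" "head (fst (repr c)) (\<phi> t) = \<psi> (Suc t)"
      using iso m by (auto simp: \<psi>_def \<phi>_def graph_map_def mod_Suc_eq)
    have "on_verts (periodic_cycle G g) (t mod k) = on_verts (snd (repr c) \<circ>\<^sub>g \<theta>) (t mod k)"
      "on_arcs (periodic_cycle G g) (t mod k) = on_arcs (snd (repr c) \<circ>\<^sub>g \<theta>) (t mod k)"
      using eq m unfolding gmap_eq_def circle_simps by blast+
    then show "on_verts (snd (repr c)) (\<psi> t) = tail G (g t)" "on_arcs (snd (repr c)) (\<phi> t) = g t"
      by (simp_all add: \<psi>_def \<phi>_def kmod)
  qed
qed

end

text \<open>The lifts of both walks to the long cycles agree over \<open>D\<close>, so together they
  form a closed walk in the fibre product, hence lie in its core. The two cycles may differ in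
  length; \<open>k * k'\<close> is a common period.\<close>

lemma long_pair_in_core:
  assumes wf: "wf_digraph G" "wf_digraph H" and \<gamma>: "graph_map G D \<gamma>" and lam: "graph_map H D lam"
    and g: "\<And>t. g t \<in> arcs G \<and> head G (g t) = tail G (g (Suc t))"
    and h: "\<And>t. h t \<in> arcs H \<and> head H (h t) = tail H (h (Suc t))"
    and N: "0 < N" "\<And>t. g (t + N) = g t" "\<And>t. h (t + N) = h t"
    and labs: "\<And>t. on_arcs \<gamma> (g t) = on_arcs lam (h t)"
    and p: "min_period p (\<lambda>t. on_arcs \<gamma> (g t))"
    and longg: "\<forall>k>0. (\<forall>t. g (t + k) = g t) \<longrightarrow> 12 * betti1 G * p \<le> k"
    and longh: "\<forall>k>0. (\<forall>t. h (t + k) = h t) \<longrightarrow> 12 * betti1 H * p \<le> k"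
  shows "(g t, h t) \<in> on_arcs (gmap_prod long_cycle_map long_cycle_map) ` arcs (core (fibre_product
           (long_cycle_graph G D \<gamma>) (\<gamma> \<circ>\<^sub>g long_cycle_map)
           (long_cycle_graph H D lam) (lam \<circ>\<^sub>g long_cycle_map)))"
proof -
  obtain c \<psi> \<phi> k where c: "c \<in> iso_classes (long_cycles G D \<gamma>)" "0 < k"
      "\<forall>t. \<psi> (t + k) = \<psi> t" "\<forall>t. \<phi> (t + k) = \<phi> t"
    and c_lift: "\<forall>t. \<psi> t \<in> verts (fst (repr c)) \<and> \<phi> t \<in> arcs (fst (repr c)) \<and>
         tail (fst (repr c)) (\<phi> t) = \<psi> t \<and> head (fst (repr c)) (\<phi> t) = \<psi> (Suc t) \<and>
         on_verts (snd (repr c)) (\<psi> t) = tail G (g t) \<and> on_arcs (snd (repr c)) (\<phi> t) = g t"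
    using wf_digraph.long_cycle_lift[OF wf(1) \<gamma> g N(1,2) p longg] by (elim exE conjE) (rule that; assumption)
  have p': "min_period p (\<lambda>t. on_arcs lam (h t))" using p by (simp add: labs)
  obtain d \<psi>' \<phi>' k' where d: "d \<in> iso_classes (long_cycles H D lam)" "0 < k'"
      "\<forall>t. \<psi>' (t + k') = \<psi>' t" "\<forall>t. \<phi>' (t + k') = \<phi>' t"
    and d_lift: "\<forall>t. \<psi>' t \<in> verts (fst (repr d)) \<and> \<phi>' t \<in> arcs (fst (repr d)) \<and>
         tail (fst (repr d)) (\<phi>' t) = \<psi>' t \<and> head (fst (repr d)) (\<phi>' t) = \<psi>' (Suc t) \<and>
         on_verts (snd (repr d)) (\<psi>' t) = tail H (h t) \<and> on_arcs (snd (repr d)) (\<phi>' t) = h t"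
    using wf_digraph.long_cycle_lift[OF wf(2) lam h N(1,3) p' longh] by (elim exE conjE) (rule that; assumption)
  define K where "K = k * k'"
  have K0: "0 < K" using c(2) d(2) by (simp add: K_def)
  have m: "\<psi> (t mod K) = \<psi> t" "\<phi> (t mod K) = \<phi> t" "\<psi>' (t mod K) = \<psi>' t" "\<phi>' (t mod K) = \<phi>' t" for t
    using c(3,4) d(3,4) by (simp_all add: K_def periodic_mod_multiple)
  define F where "F = \<lparr>on_verts = (\<lambda>t. ((c, \<psi> t), (d, \<psi>' t))), on_arcs = (\<lambda>t. ((c, \<phi> t), (d, \<phi>' t)))\<rparr>"
  define P where "P = fibre_product (long_cycle_graph G D \<gamma>) (\<gamma> \<circ>\<^sub>g long_cycle_map)
           (long_cycle_graph H D lam) (lam \<circ>\<^sub>g long_cycle_map)"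
  have vs: "on_verts \<gamma> (tail G (g t)) = on_verts lam (tail H (h t))" for t
  proof -
    have "on_verts \<gamma> (tail G (g t)) = tail D (on_arcs \<gamma> (g t))" using \<gamma> g[of t] by (simp add: graph_map_def)
    moreover have "on_verts lam (tail H (h t)) = tail D (on_arcs lam (h t))" using lam h[of t] by (simp add: graph_map_def)
    ultimately show ?thesis by (simp add: labs)
  qed
  have "((c, \<psi> t), (d, \<psi>' t)) \<in> verts P" "((c, \<phi> t), (d, \<phi>' t)) \<in> arcs P"
    "tail P ((c, \<phi> t), (d, \<phi>' t)) = ((c, \<psi> t), (d, \<psi>' t))"
    "head P ((c, \<phi> t), (d, \<phi>' t)) = ((c, \<psi> (Suc t)), (d, \<psi>' (Suc t)))" for t
    using c(1) d(1) c_lift d_lift vs[of t] labs[of t]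
    by (simp_all add: P_def fibre_product_def long_cycle_graph_def long_cycle_map_def)
  then have "is_cycle P K F"
    using K0 by (auto simp: is_cycle_def graph_map_def F_def m)
  then have "on_arcs F (t mod K) \<in> arcs (core P)"
    using K0 unfolding core_def by (auto intro!: exI[of _ K] exI[of _ F])
  moreover have "on_arcs (gmap_prod long_cycle_map long_cycle_map) (on_arcs F (t mod K)) = (g t, h t)"
    using c_lift d_lift m by (simp add: gmap_prod_def long_cycle_map_def F_def)
  ultimately show ?thesis unfolding P_def by (metis image_eqI)
qed

section \<open>The bound\<close>

lemma rel_core_arcs:
  "a \<in> arcs (dg (rel_core P)) \<longleftrightarrow>
     (\<exists>n f i. is_path (dg P) n f \<and> admissible P n f \<and> i < n \<and> a = on_arcs f i)"
  by (auto simp: rel_core_def Let_def)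

lemma rel_core_arcs_subset: "arcs (dg (rel_core P)) \<subseteq> arcs (dg P)"
proof
  fix a assume "a \<in> arcs (dg (rel_core P))"
  then obtain n f i where "is_path (dg P) n f" "i < n" "a = on_arcs f i" by (auto simp: rel_core_arcs)
  then show "a \<in> arcs (dg P)" unfolding is_path_def graph_map_def by auto
qed

text \<open>Take an admissible path through \<open>a\<close>. If no edge of the core ends where
  \<open>a\<close> begins, then \<open>a\<close> is its first edge and the path is not closed, so it
  is accepting.\<close>

lemma rel_core_source:
  assumes a: "a \<in> arcs (dg (rel_core P))"
    and none: "\<And>b. b \<in> arcs (dg (rel_core P)) \<Longrightarrow> head (dg P) b \<noteq> tail (dg P) a"
  shows "tail (dg P) a \<in> initials P"
proof -
  obtain n f i where f: "is_path (dg P) n f" "admissible P n f" and i: "i < n" "a = on_arcs f i"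
    using a by (auto simp: rel_core_arcs)
  have ends: "tail (dg P) (on_arcs f j) = on_verts f j" "head (dg P) (on_arcs f j) = on_verts f (Suc j)"
    if "j < n" for j using f(1) that by (auto simp: is_path_def graph_map_def)
  have inX: "on_arcs f j \<in> arcs (dg (rel_core P))" if "j < n" for j
    using f that by (auto simp: rel_core_arcs)
  have no: "on_verts f (Suc j) \<noteq> on_verts f i" if "j < n" for j
    using none[OF inX[OF that]] ends i that by simp
  have "i = 0" using no[of "i - 1"] i by (cases i) auto
  moreover have "on_verts f n \<noteq> on_verts f 0" using no[of "n - 1"] i \<open>i = 0\<close> by simp
  ultimately show ?thesis
    using f(2) i ends[of 0] by (auto simp: admissible_def accepting_def)
qed

theorem theorem5p7:
  fixes \<Gamma> :: "('u, 'd) marked_graph"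
    and \<Lambda> :: "('v, 'e) marked_graph"
    and \<Delta> :: "('w, 'f) marked_graph"
    and \<gamma> :: "('u, 'd, 'w, 'f) gmap"
    and lam :: "('v, 'e, 'w, 'f) gmap"
  assumes "finite_marked_graph \<Gamma>" and "finite_marked_graph \<Lambda>" and "finite_marked_graph \<Delta>"
    and "forwards_immersion \<Gamma> \<Delta> \<gamma>" and "forwards_immersion \<Lambda> \<Delta> lam"
    and "Digraph_Component.connected (dg \<Gamma>)" and "Digraph_Component.connected (dg \<Lambda>)"
    and "relatively_core \<Gamma>" and "relatively_core \<Lambda>"
  shows
    "let \<Theta> = rel_core (marked_fibre_product \<Gamma> \<gamma> \<Lambda> lam);
         s\<^sub>\<Gamma> = (long_cycle_map :: (_, _, 'u, 'd) gmap);
         s\<^sub>\<Lambda> = (long_cycle_map :: (_, _, 'v, 'e) gmap);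
         S = core (fibre_product
                     (long_cycle_graph (dg \<Gamma>) (dg \<Delta>) \<gamma>) (\<gamma> \<circ>\<^sub>g s\<^sub>\<Gamma>)
                     (long_cycle_graph (dg \<Lambda>) (dg \<Delta>) lam) (lam \<circ>\<^sub>g s\<^sub>\<Lambda>));
         s = gmap_prod s\<^sub>\<Gamma> s\<^sub>\<Lambda>;
         \<Theta>\<^sub>s = (dg \<Theta>)\<lparr>arcs := arcs (dg \<Theta>) - on_arcs s ` arcs S\<rparr>;
         C\<^sub>\<Gamma> = card (bar_edges (dg \<Gamma>)) + card (initials \<Gamma>);
         C\<^sub>\<Lambda> = card (bar_edges (dg \<Lambda>)) + card (initials \<Lambda>)
     in card (arcs \<Theta>\<^sub>s) \<le>
          508 * C\<^sub>\<Gamma> * C\<^sub>\<Lambda> *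
          (card (bar_edges (dg \<Lambda>)) * card (arcs (dg \<Gamma>)) +
           card (bar_edges (dg \<Gamma>)) * card (arcs (dg \<Lambda>)))"
proof -
  define n1 n2 where "n1 = card (bar_edges (dg \<Gamma>))" and "n2 = card (bar_edges (dg \<Lambda>))"
  define i1 i2 where "i1 = card (initials \<Gamma>)" and "i2 = card (initials \<Lambda>)"
  define P where "P = marked_fibre_product \<Gamma> \<gamma> \<Lambda> lam"
  define X where "X = arcs (dg (rel_core P))"
  interpret A: fin_digraph "dg \<Gamma>" using assms(1) by (simp add: finite_marked_graph_def)
  interpret B: fin_digraph "dg \<Lambda>" using assms(2) by (simp add: finite_marked_graph_def)
  have \<gamma>: "graph_map (dg \<Gamma>) (dg \<Delta>) \<gamma>" and lam: "graph_map (dg \<Lambda>) (dg \<Delta>) lam"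
    using assms(4,5) by (simp_all add: forwards_immersion_def marked_graph_map_def)
  have P_simps: "tail (dg P) = map_prod (tail (dg \<Gamma>)) (tail (dg \<Lambda>))"
    "head (dg P) = map_prod (head (dg \<Gamma>)) (head (dg \<Lambda>))"
    "initials P \<subseteq> initials \<Gamma> \<times> initials \<Lambda>"
    "arcs (dg P) = {(d, e). d \<in> arcs (dg \<Gamma>) \<and> e \<in> arcs (dg \<Lambda>) \<and> on_arcs \<gamma> d = on_arcs lam e}"
    by (auto simp: P_def marked_fibre_product_def fibre_product_def Let_def)
  have finI: "finite (initials \<Gamma>)" "finite (initials \<Lambda>)"
    using assms(1,2) A.finite_verts B.finite_verts by (auto simp: finite_marked_graph_def intro: finite_subset)
  have X_sub: "X \<subseteq> arcs (dg P)"
    unfolding X_def by (rule rel_core_arcs_subset)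
  have sg1: "seg_graph (arcs (dg \<Gamma>)) (tail (dg \<Gamma>)) (head (dg \<Gamma>)) (on_arcs \<gamma>) (bar_edges (dg \<Gamma>))
           (\<lambda>c. curve_length (repr c)) (\<lambda>c. curve_arc (repr c))"
    using assms(4) by (intro A.seg_graph_bar_edges) (simp add: forwards_immersion_def)
  have sg2: "seg_graph (arcs (dg \<Lambda>)) (tail (dg \<Lambda>)) (head (dg \<Lambda>)) (on_arcs lam) (bar_edges (dg \<Lambda>))
           (\<lambda>c. curve_length (repr c)) (\<lambda>c. curve_arc (repr c))"
    using assms(5) by (intro B.seg_graph_bar_edges) (simp add: forwards_immersion_def)
  have sources: "card (map_prod (tail (dg \<Gamma>)) (tail (dg \<Lambda>)) ` X - map_prod (head (dg \<Gamma>)) (head (dg \<Lambda>)) ` X)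
      \<le> i1 * i2"
  proof -
    have "map_prod (tail (dg \<Gamma>)) (tail (dg \<Lambda>)) ` X - map_prod (head (dg \<Gamma>)) (head (dg \<Lambda>)) ` X
        \<subseteq> initials \<Gamma> \<times> initials \<Lambda>"
    proof
      fix z assume "z \<in> map_prod (tail (dg \<Gamma>)) (tail (dg \<Lambda>)) ` X - map_prod (head (dg \<Gamma>)) (head (dg \<Lambda>)) ` X"
      then have z: "z \<in> tail (dg P) ` X" "z \<notin> head (dg P) ` X" by (simp_all add: P_simps)
      from z(1) obtain a where a: "a \<in> X" "z = tail (dg P) a" by (rule imageE)
      have "tail (dg P) a \<in> initials P"
      proof (rule rel_core_source)
        show "a \<in> arcs (dg (rel_core P))" using a(1) by (simp add: X_def)
        fix b assume "b \<in> arcs (dg (rel_core P))"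
        then have "head (dg P) b \<in> head (dg P) ` X" unfolding X_def by (rule imageI)
        then show "head (dg P) b \<noteq> tail (dg P) a" using z(2) a(2) by metis
      qed
      then show "z \<in> initials \<Gamma> \<times> initials \<Lambda>" using a(2) P_simps(3) by blast
    qed
    then have "card (map_prod (tail (dg \<Gamma>)) (tail (dg \<Lambda>)) ` X - map_prod (head (dg \<Gamma>)) (head (dg \<Lambda>)) ` X)
        \<le> card (initials \<Gamma> \<times> initials \<Lambda>)" using finI by (intro card_mono) auto
    then show ?thesis by (simp add: i1_def i2_def card_cartesian_product)
  qed
  interpret seg_pair "arcs (dg \<Gamma>)" "tail (dg \<Gamma>)" "head (dg \<Gamma>)" "on_arcs \<gamma>" "bar_edges (dg \<Gamma>)"
      "\<lambda>c. curve_length (repr c)" "\<lambda>c. curve_arc (repr c)"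
      "arcs (dg \<Lambda>)" "tail (dg \<Lambda>)" "head (dg \<Lambda>)" "on_arcs lam" "bar_edges (dg \<Lambda>)"
      "\<lambda>c. curve_length (repr c)" "\<lambda>c. curve_arc (repr c)" X "i1 * i2"
  proof (intro seg_pair.intro seg_pair_axioms.intro sg1 sg2 sources)
    fix e f assume "(e, f) \<in> X"
    then show "e \<in> arcs (dg \<Gamma>) \<and> f \<in> arcs (dg \<Lambda>) \<and> on_arcs \<gamma> e = on_arcs lam f"
      using X_sub P_simps(4) by auto
  qed
  define Y where "Y = on_arcs (gmap_prod long_cycle_map long_cycle_map) ` arcs (core (fibre_product
           (long_cycle_graph (dg \<Gamma>) (dg \<Delta>) \<gamma>) (\<gamma> \<circ>\<^sub>g long_cycle_map)
           (long_cycle_graph (dg \<Lambda>) (dg \<Delta>) lam) (lam \<circ>\<^sub>g long_cycle_map)))"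
  have inY: "(e, f) \<in> Y" if "long_pair e f" for e f
  proof -
    obtain g h N p t where *: "0 < N" "seg_graph.inf_walk (arcs (dg \<Gamma>)) (tail (dg \<Gamma>)) (head (dg \<Gamma>)) g"
      "seg_graph.inf_walk (arcs (dg \<Lambda>)) (tail (dg \<Lambda>)) (head (dg \<Lambda>)) h"
      "\<forall>t. g (t + N) = g t" "\<forall>t. h (t + N) = h t" "\<forall>t. on_arcs \<gamma> (g t) = on_arcs lam (h t)"
      "min_period p (\<lambda>t. on_arcs \<gamma> (g t))"
      "\<forall>k>0. (\<forall>t. g (t + k) = g t) \<longrightarrow> 12 * n1 * p \<le> k"
      "\<forall>k>0. (\<forall>t. h (t + k) = h t) \<longrightarrow> 12 * n2 * p \<le> k"
      "e = g t" "f = h t"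
      using \<open>long_pair e f\<close> unfolding long_pair_def n1_def[symmetric] n2_def[symmetric] by (elim exE conjE) (rule that, assumption+)
    \<comment> \<open>Here the number of bar edges is exchanged for the Betti number, which it
      dominates.\<close>
    have "12 * betti1 (dg \<Gamma>) * p \<le> 12 * n1 * p" "12 * betti1 (dg \<Lambda>) * p \<le> 12 * n2 * p"
      using A.betti1_le B.betti1_le by (simp_all add: n1_def n2_def)
    then have long: "\<forall>k>0. (\<forall>t. g (t + k) = g t) \<longrightarrow> 12 * betti1 (dg \<Gamma>) * p \<le> k"
      "\<forall>k>0. (\<forall>t. h (t + k) = h t) \<longrightarrow> 12 * betti1 (dg \<Lambda>) * p \<le> k"
      using *(8,9) order_trans by blast+
    have walks: "g t \<in> arcs (dg \<Gamma>) \<and> head (dg \<Gamma>) (g t) = tail (dg \<Gamma>) (g (Suc t))"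
      "h t \<in> arcs (dg \<Lambda>) \<and> head (dg \<Lambda>) (h t) = tail (dg \<Lambda>) (h (Suc t))" for t
      using *(2,3) G.inf_walk_iff H.inf_walk_iff by blast+
    show ?thesis
      unfolding Y_def *(10,11)
      by (rule long_pair_in_core[OF A.wf_digraph B.wf_digraph \<gamma> lam walks *(1) _ _ _ *(7) long])
        (use *(4,5,6) in blast)+
  qed
  have "X - Y \<subseteq> {(e, f) \<in> X. \<not> long_pair e f}" using inY by auto
  then have "card (X - Y) \<le> card {(e, f) \<in> X. \<not> long_pair e f}"
    using finX by (intro card_mono) (auto intro: finite_subset[of _ X])
  also have "\<dots> \<le> 508 * C * (n2 * card (arcs (dg \<Gamma>)) + n1 * card (arcs (dg \<Lambda>)))"
    using card_not_long by (simp add: n1_def n2_def)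
  \<comment> \<open>\<open>C\<close> equals \<open>n1 * n2 + i1 * i2\<close>; adding the mixed terms
    turns it into the product of the statement.\<close>
  also have "\<dots> \<le> 508 * ((n1 + i1) * (n2 + i2)) * (n2 * card (arcs (dg \<Gamma>)) + n1 * card (arcs (dg \<Lambda>)))"
    by (intro mult_le_mono order_refl) (simp add: C_def n1_def n2_def algebra_simps)
  finally show ?thesis
    by (simp add: Let_def X_def Y_def P_def n1_def n2_def i1_def i2_def mult.assoc)
qed

end
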